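(* Let $a,b\in\mathbb{F}_q^*$, $a\ne b$, and let $d$ be the multiplicative order of $a/b$. Then \[ \mathrm{Fix}(A_{\{a,b\}})=\begin{cases} \displaystyle q^{2n/d-2}+\frac{(d-1)(q^{2n/d}-1)}{q+1}&\text{if}\ n\equiv 0\pmod d,\\[0.5em] \displaystyle \frac{q^{2\lfloor n/d\rfloor+1}+1}{q+1}&\text{if}\ n\not\equiv 0\pmod d. \end{cases} \]
   Context: Let $n\ge 1$ and let $\mathcal F_n$ be the set of subfields $F\subset\mathbb{F}_q(X)$ with $[\mathbb{F}_q(X):F]=n$ (each of the form $\mathbb{F}_q(f)$ with $f\in\mathbb{F}_q(X)$ of degree $n$). The group $\mathrm{GL}(2,\mathbb{F}_q)$ acts on $\mathcal F_n$ by $A(\mathbb{F}_q(f))=\mathbb{F}_q(f\circ\phi_A)$, where for $A=\begin{bmatrix}a&b\\ c&d\end{bmatrix}$, $\phi_A=(aX+b)/(cX+d)$. For $A\in\mathrm{GL}(2,\mathbb{F}_q)$, $\mathrm{Fix}(A)$ denotes the number of $F\in\mathcal F_n$ with $A(F)=F$. Here $A_{\{a,b\}}=\begin{bmatrix}a&0\\ 0&b\end{bmatrix}$, so $\phi_{A_{\{a,b\}}}=(a/b)X$. *)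

theory Defs
  imports
    "HOL-Algebra.Algebraic_Closure_Type"
    "HOL-Algebra.Generated_Fields"
    "HOL-Algebra.Embedded_Algebras"
    "HOL-Algebra.Multiplicative_Group"
    "HOL-Computational_Algebra.Polynomial_Factorial"
    "HOL-Analysis.Cartesian_Space"
begin

text \<open>
  A finite field \<open>\<bbbF>\<^sub>q\<close> is a type \<open>'a :: {field, finite}\<close>, with \<open>q = CARD('a)\<close>, and \<open>\<bbbF>\<^sub>q(X)\<close> is
  the type \<open>'a poly fract\<close>.  The record \<open>ratfun_field\<close> only makes HOL-Algebra's subfields, generated
  fields and dimensions over subfields applicable to that type.
\<close>

abbreviation ratfun_field :: "'a::field poly fract ring" where
  "ratfun_field \<equiv> ring_of_type_algebra"

definition ratfun_const :: "'a::field \<Rightarrow> 'a poly fract" where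
  "ratfun_const c = to_fract [:c:]"

definition poly_subst :: "'a::field poly \<Rightarrow> 'a poly fract \<Rightarrow> 'a poly fract" where
  "poly_subst p g = poly (map_poly ratfun_const p) g"

text \<open>
  Composition \<open>f \<circ> g\<close>.  Any representation \<open>f = p / s\<close> with \<open>s(g) \<noteq> 0\<close> gives the same value; one
  exists unless \<open>g\<close> is a constant at which \<open>f\<close> has a pole.
\<close>

definition ratfun_compose :: "'a::field poly fract \<Rightarrow> 'a poly fract \<Rightarrow> 'a poly fract" where
  "ratfun_compose f g =
    (THE r. \<exists>p s. s \<noteq> 0 \<and> f = Fract p s \<and> poly_subst s g \<noteq> 0 \<and> r = poly_subst p g / poly_subst s g)"

definition adjoin_ratfun :: "'a::field poly fract \<Rightarrow> 'a poly fract set" where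
  "adjoin_ratfun f = generate_field ratfun_field (insert f (range ratfun_const))"

text \<open>
  Only subfields containing the constants are meant: \<open>\<bbbF>\<^sub>q(X)\<close> also has subfields of finite index
  that do not contain \<open>\<bbbF>\<^sub>q\<close> (such as \<open>\<bbbF>\<^sub>2(X)\<close> in \<open>\<bbbF>\<^sub>4(X)\<close>), and these are not of the form \<open>\<bbbF>\<^sub>q(f)\<close>.
\<close>

definition subfields_of_index :: "nat \<Rightarrow> 'a::field poly fract set set" where
  "subfields_of_index n =
    {F. subfield F ratfun_field \<and> range ratfun_const \<subseteq> F \<and>
        ring.dimension ratfun_field n F (carrier ratfun_field)}"

text \<open>\<open>moebius A = (a X + b) / (c X + d)\<close>; polynomial coefficients are listed from the constant term up.\<close>

definition moebius :: "'a::field^2^2 \<Rightarrow> 'a poly fract" where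
  "moebius A = Fract [:A $ 1 $ 2, A $ 1 $ 1:] [:A $ 2 $ 2, A $ 2 $ 1:]"

text \<open>
  The action of \<open>GL(2, \<bbbF>\<^sub>q)\<close> on \<open>subfields_of_index n\<close>, meaningful for invertible \<open>A\<close>.  The
  resulting field does not depend on the generator \<open>f\<close>, and a generator exists by Lueroth's theorem.
\<close>

definition gl2_act :: "'a::field^2^2 \<Rightarrow> 'a poly fract set \<Rightarrow> 'a poly fract set" where
  "gl2_act A F =
    (THE G. \<exists>f. F = adjoin_ratfun f \<and> G = adjoin_ratfun (ratfun_compose f (moebius A)))"

definition num_fixed :: "nat \<Rightarrow> 'a::field^2^2 \<Rightarrow> nat" where
  "num_fixed n A = card {F \<in> subfields_of_index n. gl2_act A F = F}"

definition diag2 :: "'a::zero \<Rightarrow> 'a \<Rightarrow> 'a^2^2" where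
  "diag2 a b = vector [vector [a, 0], vector [0, b]]"

definition mult_order :: "'a::field \<Rightarrow> nat" where
  "mult_order x = group.ord (mult_of ring_of_type_algebra) x"

end

theory Submission
  imports Defs
begin

text \<open>
  A subfield of index \<open>n\<close> is \<open>\<bbbF>\<^sub>q(P / Q)\<close> for coprime \<open>P, Q\<close> with \<open>max (deg P) (deg Q) = n\<close> (Lueroth), and it
  determines and is determined by the plane \<open>\<langle>P, Q\<rangle>\<close> of polynomials.  So \<open>Fix(A)\<close> counts the planes invariant
  under \<open>X \<mapsto> cX\<close>, \<open>c = a / b\<close>.  This substitution is diagonalizable with eigenspaces \<open>X\<^sup>j \<bbbF>\<^sub>q[X\<^sup>d]\<close>, \<open>j < d\<close>, and
  coprimality forces an invariant plane to meet the one with \<open>j = 0\<close>.  Either the plane lies in \<open>\<bbbF>\<^sub>q[X\<^sup>d]\<close>, which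
  requires \<open>d\<close> to divide \<open>n\<close> and gives the term \<open>q\<^bsup>2n/d-2\<^esup>\<close>, or it has a unique basis
  \<open>X\<^sup>j P(X\<^sup>d), Q(X\<^sup>d)\<close> with \<open>0 < j < d\<close>, \<open>P, Q\<close> monic and coprime and \<open>Q(0) \<noteq> 0\<close>.  Let \<open>u\<^sub>m\<close> and \<open>v\<^sub>m\<close> be the numbers
  of such \<open>(P, Q)\<close> with \<open>deg P < deg Q = m\<close> and with \<open>deg Q \<le> deg P = m\<close>.  Dividing a \<open>Q\<close> with \<open>Q(0) = 0\<close> by \<open>X\<close> and
  exchanging the two polynomials gives \<open>u\<^sub>m + v\<^bsub>m-1\<^esub> = q\<^bsup>2m-1\<^esup>\<close> and \<open>v\<^sub>m + u\<^sub>m = q\<^bsup>2m\<^esup>\<close>, whence the fractions with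
  denominator \<open>q + 1\<close>.
\<close>

subsection \<open>Subfields of a type-class field and degrees of elements\<close>

text \<open>The index is read off from X alone: as X generates everything over F, [F_q(X):F] is the
  degree of X over F, and comparing minimal polynomials of X recovers the plane. Coprimality forces
  the eigenvalue-1 component because every other eigenspace lies in X F_q[X]: a plane without
  constant terms would have the common factor X. A plane with two eigenvalues splits canonically
  into two lines, so monic generators are unique; a plane inside F_q[X^d] has no distinguished lines
  and is counted by echelon bases instead. The two cases of the formula come from max(d deg P + j, d
  deg Q) = n, where modulo d the first entry is j and the second is 0. If d divides n, then Q
  attains the maximum for each of the d - 1 values of j, giving (d - 1) u_m with m = n/d; otherwise
  P attains it, j must be n mod d, and the count is v_m with m = floor(n/d). The recurrences unroll
  to v_m = 1 - q + q^2 - ... + q^(2m) and u_m = -1 + q - ... + q^(2m-1), geometric sums with ratio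
  -q.\<close>

definition field_closed :: "'b::field set \<Rightarrow> bool" where
  "field_closed F \<longleftrightarrow> 0 \<in> F \<and> 1 \<in> F \<and> (\<forall>x\<in>F. \<forall>y\<in>F. x + y \<in> F \<and> x * y \<in> F) \<and>
     (\<forall>x\<in>F. - x \<in> F \<and> inverse x \<in> F)"

lemma field_closedD:
  assumes "field_closed F"
  shows "0 \<in> F" "1 \<in> F" "x \<in> F \<Longrightarrow> y \<in> F \<Longrightarrow> x + y \<in> F" "x \<in> F \<Longrightarrow> y \<in> F \<Longrightarrow> x * y \<in> F"
    "x \<in> F \<Longrightarrow> - x \<in> F" "x \<in> F \<Longrightarrow> inverse x \<in> F" "x \<in> F \<Longrightarrow> y \<in> F \<Longrightarrow> x - y \<in> F"
    "x \<in> F \<Longrightarrow> y \<in> F \<Longrightarrow> x / y \<in> F"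
proof -
  show "x - y \<in> F" if "x \<in> F" "y \<in> F"
    using assms that unfolding field_closed_def by (metis diff_conv_add_uminus)
  show "x / y \<in> F" if "x \<in> F" "y \<in> F"
    using assms that unfolding field_closed_def by (metis divide_inverse)
qed (use assms in \<open>auto simp: field_closed_def\<close>)

lemma field_closed_sum:
  assumes "field_closed F" "\<And>i. i \<in> I \<Longrightarrow> g i \<in> F"
  shows "(\<Sum>i\<in>I. g i) \<in> F"
  using assms(2) by (induction I rule: infinite_finite_induct) (auto intro: field_closedD[OF assms(1)])

lemma ring_of_type_algebra_simps [simp]:
  "carrier ring_of_type_algebra = UNIV"
  "\<zero>\<^bsub>ring_of_type_algebra\<^esub> = 0" "\<one>\<^bsub>ring_of_type_algebra\<^esub> = 1"
  "x \<oplus>\<^bsub>ring_of_type_algebra\<^esub> y = x + y" "x \<otimes>\<^bsub>ring_of_type_algebra\<^esub> y = x * y"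
  by (simp_all add: ring_of_type_algebra_def)

lemma a_inv_ring_of_type_algebra [simp]:
  fixes x :: "'b::field"
  shows "\<ominus>\<^bsub>ring_of_type_algebra\<^esub> x = - x"
proof -
  interpret R: field "ring_of_type_algebra :: 'b ring" by (rule field_from_type_algebra)
  show ?thesis using R.minus_equality[of "-x" x] by simp
qed

lemma m_inv_ring_of_type_algebra:
  fixes x :: "'b::field"
  assumes "x \<noteq> 0"
  shows "inv\<^bsub>ring_of_type_algebra\<^esub> x = inverse x"
proof -
  interpret R: field "ring_of_type_algebra :: 'b ring" by (rule field_from_type_algebra)
  show ?thesis using R.inv_unique'[of x "inverse x"] assms by simp
qed

text \<open>Since \<open>inverse 0 = 0\<close>, closure under \<open>inverse\<close> can be demanded
  of all elements; the ring-theoretic inverse is controlled only off 0, hence the separate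
  case.\<close>

lemma subfield_ring_of_type_algebra_iff:
  fixes F :: "'b::field set"
  shows "subfield F ring_of_type_algebra \<longleftrightarrow> field_closed F"
proof
  interpret R: field "ring_of_type_algebra :: 'b ring" by (rule field_from_type_algebra)
  assume F: "subfield F ring_of_type_algebra"
  note sr = subringE[OF subfieldE(1)[OF F]]
  have "inverse x \<in> F" if "x \<in> F" for x
  proof (cases "x = 0")
    case True then show ?thesis using sr(2) by simp
  next
    case False then show ?thesis
      using R.subfield_m_inv(1)[OF F, of x] that by (simp add: m_inv_ring_of_type_algebra)
  qed
  then show "field_closed F" using sr by (auto simp: field_closed_def)
next
  interpret R: field "ring_of_type_algebra :: 'b ring" by (rule field_from_type_algebra)
  assume F: "field_closed F"
  show "subfield F ring_of_type_algebra"
    by (intro R.subfieldI' R.subringI)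
       (auto simp: m_inv_ring_of_type_algebra intro: field_closedD[OF F])
qed

section \<open>Degree of an element over a subfield\<close>

definition polys_over :: "'b::zero set \<Rightarrow> 'b poly set" where
  "polys_over F = {p. \<forall>i. coeff p i \<in> F}"

lemma polys_overD: "p \<in> polys_over F \<Longrightarrow> coeff p i \<in> F"
  by (simp add: polys_over_def)

lemma polys_over_closed:
  assumes "field_closed F"
  shows "0 \<in> polys_over F" "1 \<in> polys_over F"
    "p \<in> polys_over F \<Longrightarrow> r \<in> polys_over F \<Longrightarrow> p + r \<in> polys_over F"
    "p \<in> polys_over F \<Longrightarrow> r \<in> polys_over F \<Longrightarrow> p - r \<in> polys_over F"
    "p \<in> polys_over F \<Longrightarrow> r \<in> polys_over F \<Longrightarrow> p * r \<in> polys_over F"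
    "c \<in> F \<Longrightarrow> p \<in> polys_over F \<Longrightarrow> smult c p \<in> polys_over F"
    "c \<in> F \<Longrightarrow> monom c k \<in> polys_over F"
  using assms
  by (auto simp: polys_over_def coeff_mult coeff_1 intro!: field_closed_sum intro: field_closedD)

text \<open>A relation rather than a function: it holds for no \<open>n\<close> when
  \<open>x\<close> is transcendental over \<open>F\<close>, so no default value can pass for a
  degree.\<close>

definition alg_degree :: "'b::field set \<Rightarrow> 'b \<Rightarrow> nat \<Rightarrow> bool" where
  "alg_degree F x n \<longleftrightarrow>
     (\<exists>m\<in>polys_over F. lead_coeff m = 1 \<and> degree m = n \<and> poly m x = 0) \<and>
     (\<forall>p\<in>polys_over F. p \<noteq> 0 \<longrightarrow> poly p x = 0 \<longrightarrow> n \<le> degree p)"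

lemma alg_degree_unique: "alg_degree F x n \<Longrightarrow> alg_degree F x k \<Longrightarrow> n = k"
  unfolding alg_degree_def by (metis dual_order.antisym leading_coeff_0_iff zero_neq_one)

text \<open>Long division by a monic polynomial only adds and multiplies coefficients, so the
  remainder stays over \<open>F\<close> although all polynomials live over the big field.\<close>

lemma polys_over_division:
  assumes F: "field_closed F" and m: "m \<in> polys_over F" "lead_coeff m = 1" "degree m > 0"
    and p: "p \<in> polys_over F"
  shows "\<exists>r\<in>polys_over F. degree r < degree m \<and> m dvd p - r"
  using p
proof (induction "degree p" arbitrary: p rule: less_induct)
  case less
  show ?case
  proof (cases "degree p < degree m")
    case True then show ?thesis using less.prems by (intro bexI[of _ p]) auto
  next
    case False
    define s where "s = monom (lead_coeff p) (degree p - degree m) * m"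
    have pF: "lead_coeff p \<in> F" using less.prems by (simp add: polys_over_def)
    have "p \<noteq> 0" using False m by auto
    have deg: "degree s = degree p" and lc: "lead_coeff s = lead_coeff p"
    proof -
      have "monom (lead_coeff p) (degree p - degree m) \<noteq> 0" "m \<noteq> 0"
        using \<open>p \<noteq> 0\<close> m by (auto simp: monom_eq_0_iff)
      then have "degree s = degree (monom (lead_coeff p) (degree p - degree m)) + degree m"
        unfolding s_def by (rule degree_mult_eq)
      also have "degree (monom (lead_coeff p) (degree p - degree m)) = degree p - degree m"
        using \<open>p \<noteq> 0\<close> by (intro Polynomial.degree_monom_eq) simp
      finally show "degree s = degree p"
        using False by simp
      show "lead_coeff s = lead_coeff p"
        unfolding s_def lead_coeff_mult m(2) lead_coeff_monom by simp
    qed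
    have "degree (p - s) < degree p"
    proof (rule degree_lessI)
      show "p - s \<noteq> 0 \<or> 0 < degree p" using False m by auto
      show "\<forall>k\<ge>degree p. coeff (p - s) k = 0"
        using deg lc by (auto simp: le_less coeff_eq_0)
    qed
    moreover have "p - s \<in> polys_over F"
      unfolding s_def by (intro polys_over_closed F less.prems m pF)
    ultimately obtain r where r: "r \<in> polys_over F" "degree r < degree m" "m dvd p - s - r"
      using less.hyps by blast
    have "m dvd (p - s - r) + s" using r(3) unfolding s_def by (intro dvd_add) auto
    then have "m dvd p - r" by (simp add: algebra_simps)
    then show ?thesis using r by blast
  qed
qed

text \<open>The remainder modulo \<open>m\<close> is over \<open>F\<close>, vanishes at
  \<open>x\<close> and has degree below the minimum, hence is 0.\<close>

lemma alg_degree_minimal_dvd: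
  assumes F: "field_closed F" and d: "alg_degree F x (degree m)"
    and m: "m \<in> polys_over F" "lead_coeff m = 1" "poly m x = 0"
    and p: "p \<in> polys_over F" "poly p x = 0"
  shows "m dvd p"
proof -
  have "degree m > 0"
  proof (rule ccontr)
    assume "\<not> degree m > 0"
    then obtain c where "m = [:c:]" by (auto elim: degree_eq_zeroE)
    then show False using m by auto
  qed
  then obtain r where r: "r \<in> polys_over F" "degree r < degree m" "m dvd p - r"
    using polys_over_division[OF F m(1,2) _ p(1)] by blast
  have "poly (p - r) x = 0" using r(3) m(3) by (auto elim!: dvdE simp del: poly_diff)
  then have "r = 0" using d r p unfolding alg_degree_def by fastforce
  then show ?thesis using r by simp
qed

section \<open>The index of a subfield as the degree of a generator\<close>

context
  fixes F :: "'b::field set" and x :: 'b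
  assumes F: "field_closed F"
begin

interpretation R: field "ring_of_type_algebra :: 'b ring" by (rule field_from_type_algebra)

text \<open>The offset \<open>k\<close> carries the induction; the factor \<open>y\<close> is kept
  because the powers are later scaled by a denominator.\<close>

lemma combine_powers:
  "R.combine Ks (map (\<lambda>i. y * x ^ i) [k..<k + length Ks]) = y * x ^ k * poly (Poly Ks) x"
proof (induction Ks arbitrary: k)
  case Nil then show ?case by simp
next
  case (Cons a Ks)
  have "[k..<k + length (a # Ks)] = k # [Suc k..<Suc k + length Ks]"
    by (simp add: upt_rec)
  then show ?case using Cons[of "Suc k"] by (simp add: algebra_simps)
qed

lemma Poly_in_polys_over: "set Ks \<subseteq> F \<Longrightarrow> Poly Ks \<in> polys_over F"
  using field_closedD(1)[OF F] by (auto simp: polys_over_def nth_default_def)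

lemma degree_Poly_less: "length Ks = n \<Longrightarrow> Poly Ks = 0 \<or> degree (Poly Ks) < n"
  by (metis Poly.simps(1) coeff_Poly_eq degree_Poly leading_coeff_0_iff le_neq_implies_less
      length_0_conv nth_default_beyond order_refl)

lemma Span_powers:
  "R.Span F (map (\<lambda>i. y * x ^ i) [0..<n]) = {y * poly p x |p. p \<in> polys_over F \<and> (p = 0 \<or> degree p < n)}"
proof -
  let ?Us = "map (\<lambda>i. y * x ^ i) [0..<n]"
  have sf: "subfield F ring_of_type_algebra" using F by (simp add: subfield_ring_of_type_algebra_iff)
  have "R.Span F ?Us = {R.combine Ks ?Us |Ks. length Ks = length ?Us \<and> set Ks \<subseteq> F}"
    by (rule R.Span_eq_combine_set_length_version[OF sf]) simp
  also have "\<dots> = {y * poly (Poly Ks) x |Ks. length Ks = n \<and> set Ks \<subseteq> F}"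
    using combine_powers[where k = 0 and y = y] by (auto; metis length_map length_upt)
  also have "\<dots> = {y * poly p x |p. p \<in> polys_over F \<and> (p = 0 \<or> degree p < n)}"
  proof (intro equalityI subsetI)
    fix z assume "z \<in> {y * poly p x |p. p \<in> polys_over F \<and> (p = 0 \<or> degree p < n)}"
    then obtain p where p: "z = y * poly p x" "p \<in> polys_over F" "p = 0 \<or> degree p < n" by blast
    have "Poly (map (coeff p) [0..<n]) = p"
      using p(3) by (intro poly_eqI) (auto simp: nth_default_def coeff_eq_0)
    moreover have "set (map (coeff p) [0..<n]) \<subseteq> F" using p by (auto simp: polys_over_def)
    ultimately show "z \<in> {y * poly (Poly Ks) x |Ks. length Ks = n \<and> set Ks \<subseteq> F}"
      using p(1) by (metis (mono_tags, lifting) diff_zero length_map length_upt mem_Collect_eq)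
  qed (use Poly_in_polys_over degree_Poly_less in blast)
  finally show ?thesis .
qed

lemma independent_powers_iff:
  assumes "y \<noteq> 0"
  shows "R.independent F (map (\<lambda>i. y * x ^ i) [0..<n]) \<longleftrightarrow>
    (\<forall>p\<in>polys_over F. poly p x = 0 \<longrightarrow> degree p < n \<longrightarrow> p = 0)"
proof -
  let ?Us = "map (\<lambda>i. y * x ^ i) [0..<n]"
  have sf: "subfield F ring_of_type_algebra" using F by (simp add: subfield_ring_of_type_algebra_iff)
  have cmb: "R.combine Ks ?Us = y * poly (Poly Ks) x" if "length Ks = n" for Ks
    using combine_powers[where k = 0 and y = y and Ks = Ks] that by simp
  show ?thesis
  proof (intro iffI ballI impI)
    fix p assume ind: "R.independent F ?Us" and p: "p \<in> polys_over F" "poly p x = 0" "degree p < n"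
    let ?Ks = "map (coeff p) [0..<n]"
    have P: "Poly ?Ks = p"
      using p(3) by (intro poly_eqI) (auto simp: nth_default_def coeff_eq_0)
    have "set (take (length ?Us) ?Ks) \<subseteq> {0}"
      using R.independent_imp_trivial_combine[OF sf ind, of ?Ks] p cmb[of ?Ks] P
      by (auto simp: polys_over_def)
    then have "\<forall>i<n. coeff p i = 0" by (auto simp: image_subset_iff)
    then show "p = 0" using p(3) by (metis leading_coeff_0_iff)
  next
    assume A: "\<forall>p\<in>polys_over F. poly p x = 0 \<longrightarrow> degree p < n \<longrightarrow> p = 0"
    show "R.independent F ?Us"
    proof (rule ccontr)
      assume "\<not> R.independent F ?Us"
      then obtain Ks where Ks: "length Ks = length ?Us" "R.combine Ks ?Us = 0" "set Ks \<subseteq> F" "set Ks \<noteq> {0}"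
        using R.dependent_imp_non_trivial_combine[OF sf, of ?Us] by (auto simp del: set_map)
      have n: "length Ks = n" using Ks(1) by simp
      then have "poly (Poly Ks) x = 0" using Ks(2) cmb assms by simp
      then have "Poly Ks = 0" using A Poly_in_polys_over[OF Ks(3)] degree_Poly_less[OF n] by blast
      then obtain k where k: "Ks = replicate k 0" by (auto simp: Poly_eq_0)
      \<comment> \<open>\<open>set Ks \<noteq> {0}\<close> is also true of the empty list, so what
        survives is n = 0, where independence is trivial.\<close>
      then have "Ks = []" using Ks(4) by (cases k) (auto simp: set_replicate_Suc)
      then show False using \<open>\<not> R.independent F ?Us\<close> n by simp
    qed
  qed
qed

text \<open>A dimension count replaces the computation of 1 / s(x): multiplication by the nonzero
  s(x) maps the n-dimensional space of polynomial values injectively into itself, so its image is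
  the whole space and contains 1.\<close>

lemma alg_degree_expansion:
  assumes gen: "\<And>z. \<exists>p\<in>polys_over F. \<exists>s\<in>polys_over F. poly s x \<noteq> 0 \<and> z = poly p x / poly s x"
    and n: "alg_degree F x n"
  shows "\<exists>p\<in>polys_over F. degree p < n \<and> z = poly p x"
proof -
  have sf: "subfield F ring_of_type_algebra" using F by (simp add: subfield_ring_of_type_algebra_iff)
  obtain m where m: "m \<in> polys_over F" "lead_coeff m = 1" "degree m = n" "poly m x = 0"
    using n unfolding alg_degree_def by blast
  have n0: "n > 0"
  proof (rule ccontr)
    assume "\<not> n > 0"
    then obtain c where "m = [:c:]" using m(3) by (auto elim: degree_eq_zeroE)
    then show False using m by auto
  qed
  let ?V = "{poly p x |p. p \<in> polys_over F \<and> (p = 0 \<or> degree p < n)}"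
  have V: "poly p x \<in> ?V" if p: "p \<in> polys_over F" for p
  proof -
    obtain r where r: "r \<in> polys_over F" "degree r < n" "m dvd p - r"
      using polys_over_division[OF F m(1,2) _ p] n0 m by auto
    then have "poly (p - r) x = 0" using m(4) by (auto elim!: dvdE simp del: poly_diff)
    then have "poly p x = poly r x" by simp
    then show ?thesis using r by blast
  qed
  have ind: "R.independent F (map (\<lambda>i. y * x ^ i) [0..<n])" if "y \<noteq> 0" for y
    using n by (subst independent_powers_iff[OF that]) (auto simp: alg_degree_def leD)
  have dimV: "R.dimension n F ?V"
    using R.dimension_independent[OF ind[of 1]] Span_powers[of 1 n] by simp
  have "z \<in> ?V"
  proof -
    obtain p s where ps: "p \<in> polys_over F" "s \<in> polys_over F" "poly s x \<noteq> 0" "z = poly p x / poly s x"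
      using gen by blast
    let ?Us = "map (\<lambda>i. poly s x * x ^ i) [0..<n]"
    have "set ?Us \<subseteq> ?V"
    proof clarsimp
      fix i
      have "poly (s * monom 1 i) x \<in> ?V"
        by (intro V polys_over_closed F ps field_closedD)
      then show "\<exists>p. poly s x * x ^ i = poly p x \<and> p \<in> polys_over F \<and> (p = 0 \<or> degree p < n)"
        by (simp add: poly_monom)
    qed
    then have "R.Span F ?Us = ?V"
      using R.independent_length_eq_dimension[OF sf dimV ind[OF ps(3)]] by simp
    moreover have "1 \<in> ?V" using V[of 1] polys_over_closed[OF F] by simp
    ultimately have "1 \<in> R.Span F ?Us" by simp
    then obtain v where v: "v \<in> polys_over F" "1 = poly s x * poly v x"
      unfolding Span_powers by blast
    then have "poly v x = 1 / poly s x" using ps(3) by (simp add: field_simps)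
    then have "z = poly (p * v) x" using ps(4) by simp
    then show ?thesis using V[OF polys_over_closed(5)[OF F ps(1) v(1)]] by simp
  qed
  then obtain p where "p \<in> polys_over F" "p = 0 \<or> degree p < n" "z = poly p x" by blast
  then show ?thesis using n0 by (intro bexI[of _ p]) auto
qed

lemma dimension_of_alg_degree:
  assumes gen: "\<And>z. \<exists>p\<in>polys_over F. \<exists>s\<in>polys_over F. poly s x \<noteq> 0 \<and> z = poly p x / poly s x"
    and n: "alg_degree F x n"
  shows "R.dimension n F UNIV"
proof -
  have "R.independent F (map (\<lambda>i. 1 * x ^ i) [0..<n])"
    using n by (subst independent_powers_iff) (auto simp: alg_degree_def leD)
  from R.dimension_independent[OF this]
  have "R.dimension n F {poly p x |p. p \<in> polys_over F \<and> (p = 0 \<or> degree p < n)}"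
    using Span_powers[of 1 n] by simp
  also have "{poly p x |p. p \<in> polys_over F \<and> (p = 0 \<or> degree p < n)} = UNIV"
    using alg_degree_expansion[OF assms] by blast
  finally show ?thesis .
qed

text \<open>In dimension \<open>n\<close> the n + 1 powers 1, ..., x^n are dependent, so
  \<open>x\<close> is algebraic. An annihilator of least degree gives some
  \<open>alg_degree\<close>, and uniqueness of the dimension identifies that degree with
  \<open>n\<close>.\<close>

lemma dimension_iff_alg_degree:
  assumes gen: "\<And>z. \<exists>p\<in>polys_over F. \<exists>s\<in>polys_over F. poly s x \<noteq> 0 \<and> z = poly p x / poly s x"
  shows "R.dimension n F UNIV \<longleftrightarrow> alg_degree F x n"
proof
  assume dim: "R.dimension n F UNIV"
  have sf: "subfield F ring_of_type_algebra" using F by (simp add: subfield_ring_of_type_algebra_iff)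
  define P where "P p \<longleftrightarrow> p \<in> polys_over F \<and> p \<noteq> 0 \<and> poly p x = 0" for p
  have "\<exists>p. P p"
  proof (rule ccontr)
    assume "\<nexists>p. P p"
    then have "R.independent F (map (\<lambda>i. 1 * x ^ i) [0..<Suc n])"
      by (subst independent_powers_iff) (auto simp: P_def)
    from R.independent_length_le_dimension[OF sf dim this] show False by simp
  qed
  then obtain p where p: "P p" "\<And>r. P r \<Longrightarrow> degree p \<le> degree r"
    by (metis arg_min_nat_lemma)
  let ?m = "smult (inverse (lead_coeff p)) p"
  have "alg_degree F x (degree p)"
    unfolding alg_degree_def
  proof (intro conjI bexI[of _ ?m] ballI impI)
    show "?m \<in> polys_over F"
      using p(1) unfolding P_def by (auto intro!: polys_over_closed F field_closedD(6)[OF F] polys_overD)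
  qed (use p in \<open>auto simp: P_def\<close>)
  moreover from dimension_of_alg_degree[OF gen this] have "degree p = n"
    using R.dimension_is_inj[OF sf _ dim] by blast
  ultimately show "alg_degree F x n" by simp
qed (rule dimension_of_alg_degree[OF gen])

end

subsection \<open>Coprime pairs of polynomials and the planes they span\<close>

lemma poly_bezout:
  fixes p q :: "'a::field poly"
  shows "\<exists>g u v. g = u * p + v * q \<and> g dvd p \<and> g dvd q"
\<comment> \<open>The zero polynomial has degree 0 too; the measure separates it from the nonzero
  constants, so the last division of Euclid's algorithm still decreases.\<close>
proof (induction "if q = 0 then 0 else Suc (degree q)" arbitrary: p q rule: less_induct)
  case less
  show ?case
  proof (cases "q = 0")
    case True
    then show ?thesis by (intro exI[of _ p] exI[of _ 1] exI[of _ 0]) simp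
  next
    case False
    have "(if p mod q = 0 then 0 else Suc (degree (p mod q))) < (if q = 0 then 0 else Suc (degree q))"
      using False degree_mod_less[of q p] by auto
    from less[OF this, of q] obtain g u v
      where g: "g = u * q + v * (p mod q)" "g dvd q" "g dvd p mod q" by blast
    have "g dvd p" using g(2,3) by (simp add: dvd_mod_iff)
    moreover have "g = v * p + (u - v * (p div q)) * q"
      using g(1) by (simp add: minus_div_mult_eq_mod [symmetric] algebra_simps)
    ultimately show ?thesis using g(2) by blast
  qed
qed

text \<open>Turns coprimality into an equation, which substitutions such as X \<mapsto> cX and X
  \<mapsto> X^d preserve.\<close>

lemma coprime_poly_iff_bezout:
  fixes p q :: "'a::field poly"
  shows "coprime p q \<longleftrightarrow> (\<exists>u v. u * p + v * q = 1)"
proof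
  assume c: "coprime p q"
  obtain g u v where g: "g = u * p + v * q" "g dvd p" "g dvd q" using poly_bezout by blast
  have "g dvd 1" using c g(2,3) by (rule coprime_common_divisor)
  then obtain k where "1 = g * k" by (rule dvdE)
  then have "(u * k) * p + (v * k) * q = 1" using g(1) by (simp add: algebra_simps)
  then show "\<exists>u v. u * p + v * q = 1" by blast
next
  assume "\<exists>u v. u * p + v * q = 1"
  then obtain u v where uv: "u * p + v * q = 1" by blast
  show "coprime p q"
  proof (rule coprimeI)
    fix c assume "c dvd p" "c dvd q"
    then have "c dvd u * p + v * q" by simp
    then show "c dvd 1" using uv by simp
  qed
qed

lemma coprime_poly_dvd_mult:
  fixes p q r :: "'a::field poly"
  assumes "coprime p q" "p dvd q * r"
  shows "p dvd r"
proof -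
  obtain u v where "u * p + v * q = 1" using assms(1) by (auto simp: coprime_poly_iff_bezout)
  then have "r = (u * p + v * q) * r" by simp
  also have "\<dots> = p * (u * r) + v * (q * r)" by (simp add: algebra_simps)
  also have "p dvd \<dots>" using assms(2) by simp
  finally show ?thesis .
qed

lemma coprime_poly_dvd_power_mult:
  fixes p q r :: "'a::field poly"
  assumes "coprime p q" "p dvd q ^ k * r"
  shows "p dvd r"
  using assms(2) by (induction k) (auto simp: mult.assoc dest: coprime_poly_dvd_mult[OF assms(1)])

text \<open>\<open>g\<close> is the greatest common divisor; taking it monic removes the freedom of
  a scalar, which the later count of pairs relies on.\<close>

lemma coprime_decomposition:
  fixes p q :: "'a::field poly"
  assumes "p \<noteq> 0 \<or> q \<noteq> 0"
  shows "\<exists>g p' q'. lead_coeff g = 1 \<and> p = g * p' \<and> q = g * q' \<and> coprime p' q'"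
proof -
  obtain g u v where g: "g = u * p + v * q" "g dvd p" "g dvd q" using poly_bezout by blast
  have g0: "g \<noteq> 0" using assms g by auto
  obtain p' q' where pq: "p = g * p'" "q = g * q'" using g(2,3) unfolding dvd_def by blast
  have "g * (u * p' + v * q') = g * 1" using g(1) pq by (simp add: algebra_simps)
  then have "u * p' + v * q' = 1" using g0 mult_cancel_left by blast
  then have "coprime p' q'" by (auto simp: coprime_poly_iff_bezout)
  moreover have "lead_coeff (smult (inverse (lead_coeff g)) g) = 1" using g0 by simp
  ultimately have "lead_coeff (smult (inverse (lead_coeff g)) g) = 1 \<and>
      p = smult (inverse (lead_coeff g)) g * smult (lead_coeff g) p' \<and>
      q = smult (inverse (lead_coeff g)) g * smult (lead_coeff g) q' \<and>
      coprime (smult (lead_coeff g) p') (smult (lead_coeff g) q')"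
    using g0 pq by (simp add: coprime_def dvd_smult_iff)
  then show ?thesis by blast
qed

definition pair_span :: "'a::field poly \<Rightarrow> 'a poly \<Rightarrow> 'a poly set" where
  "pair_span P Q = {smult a P + smult b Q |a b. True}"

text \<open>Numerators and denominators of the rational functions of degree \<open>n\<close>. For n
  \<ge> 1 neither entry is 0, since coprimality to 0 forces a constant.\<close>

definition coprime_pairs :: "nat \<Rightarrow> ('a::field poly \<times> 'a poly) set" where
  "coprime_pairs n = {(P, Q). coprime P Q \<and> max (degree P) (degree Q) = n}"

definition pair_indep :: "'a::field poly \<Rightarrow> 'a poly \<Rightarrow> bool" where
  "pair_indep P Q \<longleftrightarrow> (\<forall>a b. smult a P + smult b Q = 0 \<longrightarrow> a = 0 \<and> b = 0)"

lemma pair_indepD: "pair_indep P Q \<Longrightarrow> smult a P + smult b Q = 0 \<Longrightarrow> a = 0 \<and> b = 0"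
  by (simp add: pair_indep_def)

lemma pair_span_mem: "P \<in> pair_span P Q" "Q \<in> pair_span P Q"
proof -
  have "P = smult 1 P + smult 0 Q" "Q = smult 0 P + smult 1 Q" by auto
  then show "P \<in> pair_span P Q" "Q \<in> pair_span P Q" unfolding pair_span_def by blast+
qed

lemma pair_span_closed:
  assumes "x \<in> pair_span P Q" "y \<in> pair_span P Q"
  shows "smult a x + smult b y \<in> pair_span P Q"
proof -
  obtain c d e f where "x = smult c P + smult d Q" "y = smult e P + smult f Q"
    using assms unfolding pair_span_def by blast
  then have "smult a x + smult b y = smult (a * c + b * e) P + smult (a * d + b * f) Q"
    by (simp add: smult_add_left smult_add_right algebra_simps)
  then show ?thesis unfolding pair_span_def by blast
qed

lemma pair_span_subset_iff:
  "pair_span R S \<subseteq> pair_span P Q \<longleftrightarrow> R \<in> pair_span P Q \<and> S \<in> pair_span P Q"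
proof
  assume "R \<in> pair_span P Q \<and> S \<in> pair_span P Q"
  then have "smult a R + smult b S \<in> pair_span P Q" for a b using pair_span_closed by blast
  then show "pair_span R S \<subseteq> pair_span P Q" by (auto simp: pair_span_def)
qed (use pair_span_mem in blast)

lemma pair_span_swap: "pair_span P Q = pair_span Q P"
  unfolding pair_span_def by (metis add.commute)

text \<open>Cramer's rule with determinant \<open>e\<close>: if it vanished, the adjugate relations
  between \<open>R\<close> and \<open>S\<close> would force a = b = 0 and hence R = 0.\<close>

lemma pair_span_basis:
  assumes R: "R \<in> pair_span P Q" and S: "S \<in> pair_span P Q" and ind: "pair_indep R S"
  shows "pair_span R S = pair_span P Q"
proof
  show "pair_span R S \<subseteq> pair_span P Q" using R S by (simp add: pair_span_subset_iff)
  obtain a b c d where ab: "R = smult a P + smult b Q" and cd: "S = smult c P + smult d Q"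
    using R S unfolding pair_span_def by blast
  define e where "e = a * d - b * c"
  have e1: "smult d R + smult (- b) S = smult e P" "smult (- c) R + smult a S = smult e Q"
    unfolding ab cd e_def by (simp_all add: smult_add_left smult_add_right smult_diff_left algebra_simps)
  have "e \<noteq> 0"
  proof
    assume "e = 0"
    then have "smult d R + smult (- b) S = 0" "smult (- c) R + smult a S = 0" using e1 by simp_all
    then have "a = 0" "- b = 0" using ind unfolding pair_indep_def by blast+
    then have "R = 0" using ab by simp
    then have "smult 1 R + smult 0 S = 0" by simp
    then show False using pair_indepD[OF ind] by (metis zero_neq_one)
  qed
  have "P = smult (d / e) R + smult (- b / e) S" "Q = smult (- c / e) R + smult (a / e) S"
  proof -
    have "P = smult (inverse e) (smult e P)" "Q = smult (inverse e) (smult e Q)" using \<open>e \<noteq> 0\<close> by auto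
    then show "P = smult (d / e) R + smult (- b / e) S" "Q = smult (- c / e) R + smult (a / e) S"
      unfolding e1[symmetric] by (simp_all add: smult_diff_right divide_inverse mult.commute)
  qed
  then have "P \<in> pair_span R S" "Q \<in> pair_span R S" unfolding pair_span_def by blast+
  then show "pair_span P Q \<subseteq> pair_span R S" by (simp add: pair_span_subset_iff)
qed

text \<open>A dependency makes both polynomials multiples of a single \<open>r\<close>, which is
  then a common divisor and so constant, against n \<ge> 1.\<close>

lemma coprime_pairs_indep:
  assumes "(P, Q) \<in> coprime_pairs n" "n \<ge> 1"
  shows "pair_indep P Q"
  unfolding pair_indep_def
proof (intro allI impI)
  fix a b assume ab: "smult a P + smult b Q = 0"
  have c: "coprime P Q" and m: "max (degree P) (degree Q) = n" using assms by (auto simp: coprime_pairs_def)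
  have unit: "degree r = 0" if "r dvd P" "r dvd Q" for r
  proof -
    have "r dvd 1" using c that by (rule coprime_common_divisor)
    then show ?thesis by (metis degree_1 dvd_imp_degree_le le_zero_eq one_neq_zero)
  qed
  show "a = 0 \<and> b = 0"
  proof (rule ccontr)
    assume *: "\<not> (a = 0 \<and> b = 0)"
    have "\<exists>r c d. P = smult c r \<and> Q = smult d r"
    proof (cases "a = 0")
      case False
      have "smult a P = smult (- b) Q" using ab by (simp add: eq_neg_iff_add_eq_0)
      then have "smult (inverse a) (smult a P) = smult (inverse a) (smult (- b) Q)" by simp
      then have "P = smult (- b / a) Q" using False by (simp add: field_simps)
      then show ?thesis by (intro exI[of _ Q] exI[of _ "- b / a"] exI[of _ 1]) simp
    next
      case True
      then have "Q = 0" using ab * by auto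
      then show ?thesis by (intro exI[of _ P] exI[of _ 1] exI[of _ 0]) simp
    qed
    then obtain r c d where r: "P = smult c r" "Q = smult d r" by blast
    then have "degree r = 0" by (intro unit) (auto simp: dvd_smult)
    then have "degree P = 0" "degree Q = 0" using r by (auto simp: degree_smult_eq)
    then show False using m assms(2) by simp
  qed
qed

text \<open>Degree bounds and common divisors pass to linear combinations, so membership in
  \<open>coprime_pairs\<close> is a property of the plane.\<close>

lemma coprime_pairs_span_cong:
  assumes "pair_span P Q = pair_span R S" "(P, Q) \<in> coprime_pairs n"
  shows "(R, S) \<in> coprime_pairs n"
proof -
  have deg: "max (degree R') (degree S') \<le> max (degree P') (degree Q')"
    if "R' \<in> pair_span P' Q'" "S' \<in> pair_span P' Q'" for P' Q' R' S' :: "'a poly"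
  proof -
    have "degree T \<le> max (degree P') (degree Q')" if "T \<in> pair_span P' Q'" for T
      using that by (auto simp: pair_span_def intro!: degree_add_le) 
    then show ?thesis using that by simp
  qed
  have "R \<in> pair_span P Q" "S \<in> pair_span P Q" "P \<in> pair_span R S" "Q \<in> pair_span R S"
    using assms(1) pair_span_mem by blast+
  then have "max (degree R) (degree S) = max (degree P) (degree Q)"
    using deg by (meson order_antisym)
  moreover have "coprime R S"
  proof (rule coprimeI)
    fix c assume "c dvd R" "c dvd S"
    then have "c dvd T" if "T \<in> pair_span R S" for T
      using that by (auto simp: pair_span_def intro!: dvd_add dvd_smult)
    then have "c dvd P" "c dvd Q" using \<open>P \<in> _\<close> \<open>Q \<in> _\<close> by auto
    then show "c dvd 1" using assms(2) by (auto simp: coprime_pairs_def intro: coprime_common_divisor)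
  qed
  ultimately show ?thesis using assms(2) by (auto simp: coprime_pairs_def)
qed

text \<open>If every minor using the column \<open>degree S\<close> vanished, lead_coeff(S) R would
  be a multiple of S.\<close>

lemma pair_indep_minor:
  assumes "pair_indep R S"
  shows "\<exists>i j. coeff R i * coeff S j - coeff R j * coeff S i \<noteq> 0"
proof (rule ccontr)
  assume *: "\<not> ?thesis"
  have "S \<noteq> 0"
  proof
    assume "S = 0"
    then have "smult 0 R + smult 1 S = 0" by simp
    then show False using pair_indepD[OF assms] by (metis zero_neq_one)
  qed
  let ?j = "degree S"
  have "coeff R i * coeff S ?j = coeff R ?j * coeff S i" for i using * by simp
  then have "smult (coeff S ?j) R + smult (- coeff R ?j) S = 0"
    by (intro poly_eqI) (simp add: mult.commute)
  then have "coeff S ?j = 0" using assms unfolding pair_indep_def by blast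
  then show False using \<open>S \<noteq> 0\<close> by simp
qed

section \<open>Constants, substitution and generated subfields of the rational functions\<close>

lemma ratfun_const_simps [simp]:
  "ratfun_const 0 = 0" "ratfun_const 1 = 1"
  "ratfun_const (x + y) = ratfun_const x + ratfun_const y"
  "ratfun_const (x - y) = ratfun_const x - ratfun_const y"
  "ratfun_const (- x) = - ratfun_const x"
  "ratfun_const (x * y) = ratfun_const x * ratfun_const y"
  "ratfun_const x = ratfun_const y \<longleftrightarrow> x = y"
  "ratfun_const x = 0 \<longleftrightarrow> x = 0"
proof -
  show "ratfun_const 1 = 1" unfolding ratfun_const_def by (simp flip: one_pCons)
  show "ratfun_const (x + y) = ratfun_const x + ratfun_const y"
    unfolding ratfun_const_def by (simp flip: to_fract_add)
  show "ratfun_const (x - y) = ratfun_const x - ratfun_const y"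
    unfolding ratfun_const_def by (simp flip: to_fract_diff)
  show "ratfun_const (x * y) = ratfun_const x * ratfun_const y"
    unfolding ratfun_const_def by (simp flip: to_fract_mult)
  show "ratfun_const (- x) = - ratfun_const x"
    unfolding ratfun_const_def by (simp flip: to_fract_uminus)
qed (simp_all add: ratfun_const_def)

lemma ratfun_const_inverse: "ratfun_const (inverse x) = inverse (ratfun_const x)"
proof (cases "x = 0")
  case False
  then have "ratfun_const x * ratfun_const (inverse x) = 1"
    by (simp flip: ratfun_const_simps(6))
  then show ?thesis by (metis inverse_unique)
qed simp

lemma to_fract_smult: "to_fract (smult c p) = ratfun_const c * to_fract p"
  unfolding ratfun_const_def by (simp flip: to_fract_mult)

lemma to_fract_power: "to_fract (x ^ n) = to_fract x ^ n"
  by (induction n) simp_all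

abbreviation cpoly :: "'a::field poly \<Rightarrow> 'a poly fract poly" where
  "cpoly \<equiv> map_poly ratfun_const"

lemma cpoly_simps [simp]:
  "coeff (cpoly p) i = ratfun_const (coeff p i)"
  "cpoly (pCons a p) = pCons (ratfun_const a) (cpoly p)"
  "degree (cpoly p) = degree p"
  by (simp_all add: coeff_map_poly map_poly_pCons degree_map_poly)

lemma poly_subst_simps [simp]:
  "poly_subst 0 g = 0" "poly_subst 1 g = 1"
  "poly_subst (pCons a p) g = ratfun_const a + g * poly_subst p g"
  "poly_subst (p + q) g = poly_subst p g + poly_subst q g"
  "poly_subst (- p) g = - poly_subst p g"
  "poly_subst (p - q) g = poly_subst p g - poly_subst q g"
  "poly_subst (smult c p) g = ratfun_const c * poly_subst p g"
  "poly_subst (p * q) g = poly_subst p g * poly_subst q g"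
proof -
  have hom: "cpoly (p + q) = cpoly p + cpoly q" "cpoly (- p) = - cpoly p" "cpoly (p - q) = cpoly p - cpoly q"
    "cpoly (smult c p) = smult (ratfun_const c) (cpoly p)" for p q :: "'a poly" and c
    by (rule poly_eqI, simp)+
  show "poly_subst 1 g = 1" by (simp add: poly_subst_def)
  show add: "poly_subst (p + q) g = poly_subst p g + poly_subst q g" for p q
    by (simp add: poly_subst_def hom)
  show pc: "poly_subst (pCons a p) g = ratfun_const a + g * poly_subst p g" for a p
    by (simp add: poly_subst_def)
  show sm: "poly_subst (smult c p) g = ratfun_const c * poly_subst p g" for c p
    by (simp add: poly_subst_def hom)
  show "poly_subst (p * q) g = poly_subst p g * poly_subst q g"
  proof (induction p)
    case 0 then show ?case by (simp add: poly_subst_def)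
  next
    case (pCons a p)
    have "poly_subst (pCons a p * q) g = ratfun_const a * poly_subst q g + g * poly_subst (p * q) g"
      by (simp add: add pc sm)
    then show ?case using pCons by (simp add: pc algebra_simps)
  qed
  show "poly_subst (- p) g = - poly_subst p g" "poly_subst (p - q) g = poly_subst p g - poly_subst q g"
    "poly_subst 0 g = 0"
    by (simp_all add: poly_subst_def hom)
qed

lemma poly_subst_X: "poly_subst p (to_fract [:0, 1:]) = to_fract p"
proof (induction p)
  case (pCons a p)
  have "to_fract (pCons a p) = to_fract ([:a:] + [:0, 1:] * p)" by simp
  then show ?case using pCons by (simp only: poly_subst_simps to_fract_add to_fract_mult ratfun_const_def)
qed simp

lemma poly_cpoly_X: "poly (cpoly p) (to_fract [:0, 1:]) = to_fract p"
  using poly_subst_X[of p] by (simp add: poly_subst_def)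

lemma adjoin_ratfun_closed:
  fixes f :: "'a::field poly fract"
  shows "field_closed (adjoin_ratfun f)" "f \<in> adjoin_ratfun f" "ratfun_const c \<in> adjoin_ratfun f"
proof -
  interpret R: field "ring_of_type_algebra :: 'a poly fract ring" by (rule field_from_type_algebra)
  show "field_closed (adjoin_ratfun f)"
    unfolding subfield_ring_of_type_algebra_iff[symmetric] adjoin_ratfun_def
    by (rule R.generate_field_is_subfield) simp
qed (auto simp: adjoin_ratfun_def intro: generate_field.incl)

lemma adjoin_ratfun_minimal:
  fixes f :: "'a::field poly fract"
  assumes "field_closed G" "f \<in> G" "range ratfun_const \<subseteq> G"
  shows "adjoin_ratfun f \<subseteq> G"
proof -
  interpret R: field "ring_of_type_algebra :: 'a poly fract ring" by (rule field_from_type_algebra)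
  show ?thesis unfolding adjoin_ratfun_def
    by (rule R.generate_field_min_subfield1) (use assms in \<open>auto simp: subfield_ring_of_type_algebra_iff\<close>)
qed

lemma poly_subst_in_field:
  assumes "field_closed G" "f \<in> G" "range ratfun_const \<subseteq> G"
  shows "poly_subst p f \<in> G"
  by (induction p) (use assms in \<open>auto intro!: field_closedD[OF assms(1)]\<close>)

text \<open>The explicit fractions already form a field. This form is what allows a polynomial over
  \<open>adjoin_ratfun f\<close> to have its denominators cleared.\<close>

lemma adjoin_ratfun_eq:
  "adjoin_ratfun f = {poly_subst A f / poly_subst B f |A B. poly_subst B f \<noteq> 0}" (is "_ = ?G")
proof
  have "field_closed ?G"
    unfolding field_closed_def
  proof (intro conjI ballI)
    show "0 \<in> ?G" by clarify (intro exI[of _ 0] exI[of _ 1], simp)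
    show "1 \<in> ?G" by clarify (intro exI[of _ 1], simp)
  next
    fix x y assume "x \<in> ?G" "y \<in> ?G"
    then obtain A B C D where x: "x = poly_subst A f / poly_subst B f" "poly_subst B f \<noteq> 0"
      and y: "y = poly_subst C f / poly_subst D f" "poly_subst D f \<noteq> 0" by blast
    show "x + y \<in> ?G" using x y
      by (intro CollectI exI[of _ "A * D + C * B"] exI[of _ "B * D"]) (simp add: field_simps)
    show "x * y \<in> ?G" using x y
      by (intro CollectI exI[of _ "A * C"] exI[of _ "B * D"]) simp
  next
    fix x assume "x \<in> ?G"
    then obtain A B where x: "x = poly_subst A f / poly_subst B f" "poly_subst B f \<noteq> 0" by blast
    show "- x \<in> ?G" using x by (intro CollectI exI[of _ "- A"] exI[of _ B]) simp
    show "inverse x \<in> ?G"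
    proof (cases "poly_subst A f = 0")
      case True then show ?thesis using x by (intro CollectI exI[of _ 0] exI[of _ 1]) simp
    next
      case False then show ?thesis using x by (intro CollectI exI[of _ B] exI[of _ A]) simp
    qed
  qed
  moreover have "f \<in> ?G" by clarify (intro exI[of _ "[:0, 1:]"] exI[of _ 1], simp)
  moreover have "ratfun_const c \<in> ?G" for c by clarify (intro exI[of _ "[:c:]"] exI[of _ 1], simp)
  ultimately show "adjoin_ratfun f \<subseteq> ?G" by (intro adjoin_ratfun_minimal) auto
  have "poly_subst A f \<in> adjoin_ratfun f" for A
    by (rule poly_subst_in_field) (auto intro: adjoin_ratfun_closed)
  then show "?G \<subseteq> adjoin_ratfun f" by (auto intro: field_closedD(8)[OF adjoin_ratfun_closed(1)])
qed

lemma cpoly_polys_over: "range ratfun_const \<subseteq> F \<Longrightarrow> cpoly p \<in> polys_over F"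
  by (auto simp: polys_over_def)

text \<open>Supplies the hypothesis \<open>gen\<close> of \<open>dimension_iff_alg_degree\<close>
  for x = X; coefficients in the constants suffice.\<close>

lemma ratfun_quotient:
  assumes "range ratfun_const \<subseteq> F"
  shows "\<exists>p\<in>polys_over F. \<exists>s\<in>polys_over F.
      poly s (to_fract [:0, 1:]) \<noteq> 0 \<and> z = poly p (to_fract [:0, 1:]) / poly s (to_fract [:0, 1:])"
proof -
  obtain a b where "z = Fract a b" "b \<noteq> 0" by (cases z)
  then show ?thesis using assms
    by (intro bexI[of _ "cpoly a"] bexI[of _ "cpoly b"])
       (auto simp: poly_cpoly_X cpoly_polys_over Fract_conv_to_fract)
qed

lemma subfields_of_index_iff:
  fixes F :: "'a::field poly fract set"
  shows "F \<in> subfields_of_index n \<longleftrightarrow>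
    field_closed F \<and> range ratfun_const \<subseteq> F \<and> alg_degree F (to_fract [:0, 1:]) n"
  unfolding subfields_of_index_def
  using dimension_iff_alg_degree[OF _ ratfun_quotient, of F n]
  by (auto simp: subfield_ring_of_type_algebra_iff)

subsection \<open>Simple subfields of the rational function field\<close>

lemma pair_indep_nonzero:
  assumes "pair_indep P Q"
  shows "P \<noteq> 0" "Q \<noteq> 0"
proof -
  have "smult 1 P + smult 0 Q = 0" if "P = 0" using that by simp
  then show "P \<noteq> 0" using pair_indepD[OF assms] by (metis zero_neq_one)
  have "smult 0 P + smult 1 Q = 0" if "Q = 0" using that by simp
  then show "Q \<noteq> 0" using pair_indepD[OF assms] by (metis zero_neq_one)
qed

lemma Fract_linear_indep:
  assumes ind: "pair_indep P Q" and 0: "ratfun_const a + Fract P Q * ratfun_const b = 0"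
  shows "a = 0" "b = 0"
proof -
  have "to_fract Q \<noteq> 0" using pair_indep_nonzero[OF ind] by simp
  then have "to_fract (smult b P + smult a Q) =
      to_fract Q * (ratfun_const a + Fract P Q * ratfun_const b)"
    by (simp add: to_fract_smult Fract_conv_to_fract field_simps)
  then have "to_fract (smult b P + smult a Q) = 0" by (simp only: 0 mult_zero_right)
  then have "smult b P + smult a Q = 0" by (simp only: to_fract_eq_0_iff)
  then show "a = 0" "b = 0" using pair_indepD[OF ind] by blast+
qed

text \<open>Clearing the denominator turns evaluation at P / Q into a form in P and Q, to which
  divisibility arguments apply.\<close>

lemma homogenize:
  assumes "Q \<noteq> 0"
  shows "to_fract Q ^ degree B * poly (map_poly to_fract B) (Fract P Q) =
    to_fract (\<Sum>k\<le>degree B. coeff B k * P ^ k * Q ^ (degree B - k))"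
proof -
  have Q: "to_fract Q \<noteq> 0" using assms by simp
  have "to_fract Q ^ degree B * (to_fract (coeff B k) * (to_fract P / to_fract Q) ^ k) =
      to_fract (coeff B k * P ^ k * Q ^ (degree B - k))" if "k \<le> degree B" for k
    using Q that by (simp add: to_fract_power power_diff power_divide field_simps)
  then show ?thesis
    by (simp add: poly_altdef degree_map_poly coeff_map_poly Fract_conv_to_fract sum_distrib_left
        del: to_fract_mult)
qed

text \<open>Uniqueness of expansions in powers of P / Q whose digits are polynomials in X of degree
  below \<open>n\<close>. In the homogenized relation \<open>Q\<close> divides every term but the
  top one and \<open>P\<close> every term but the bottom one; the polynomial of degree
  \<open>n\<close> then divides a digit of smaller degree, which must vanish.\<close>

lemma base_expansion_eq_0:
  fixes B :: "'a::field poly poly"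
  assumes PQ: "(P, Q) \<in> coprime_pairs n" and n: "n \<ge> 1"
    and B: "\<And>k. degree (coeff B k) < n"
    and zero: "poly (map_poly to_fract B) (Fract P Q) = 0"
  shows "B = 0"
proof -
  have nz: "P \<noteq> 0" "Q \<noteq> 0" using pair_indep_nonzero[OF coprime_pairs_indep[OF PQ n]] by auto
  have cop: "coprime P Q" "coprime Q P" and deg: "degree P = n \<or> degree Q = n"
    using PQ by (auto simp: coprime_pairs_def coprime_commute max_def split: if_splits)
  have hom0: "(\<Sum>k\<le>degree C. coeff C k * P ^ k * Q ^ (degree C - k)) = 0"
    if "poly (map_poly to_fract C) (Fract P Q) = 0" for C
    using homogenize[OF nz(2), of C P] that by (metis mult_zero_right to_fract_eq_0_iff)
  have small: "b = 0" if "R dvd b" "degree R = n" "degree b < n" for R b :: "'a poly"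
    using that dvd_imp_degree_le by (metis leD)
  from deg show ?thesis
  proof
    \<comment> \<open>The digit that vanishes here is the leading coefficient of \<open>B\<close>,
      so B = 0 at once.\<close>
    assume degQ: "degree Q = n"
    define N where "N = degree B"
    have "Q dvd (\<Sum>k<N. coeff B k * P ^ k * Q ^ (N - k))"
      by (intro dvd_sum dvd_mult) (auto intro: dvd_power)
    moreover have "P ^ N * coeff B N = - (\<Sum>k<N. coeff B k * P ^ k * Q ^ (N - k))"
      unfolding eq_neg_iff_add_eq_0
      using hom0[OF zero] by (simp add: N_def add.commute mult.commute flip: lessThan_Suc_atMost)
    ultimately have "Q dvd P ^ N * coeff B N" by (simp only: dvd_minus_iff)
    then have "Q dvd coeff B N" by (rule coprime_poly_dvd_power_mult[OF cop(2)])
    then show "B = 0" using small degQ B unfolding N_def by (metis leading_coeff_0_iff)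
  next
    \<comment> \<open>Here the constant digit vanishes; a factor P / Q cancels and the induction
      continues with the remaining digits.\<close>
    assume degP: "degree P = n"
    show "B = 0" using B zero
    proof (induction B)
      case 0 then show ?case by simp
    next
      case (pCons b B)
      let ?C = "pCons b B" 
      define g where "g k = coeff ?C k * P ^ k * Q ^ (degree ?C - k)" for k
      have "(\<Sum>k\<le>degree ?C. g k) = g 0 + (\<Sum>k\<in>{..degree ?C} - {0}. g k)"
        by (rule sum.remove) auto
      moreover have "(\<Sum>k\<le>degree ?C. g k) = 0" unfolding g_def by (rule hom0) (rule pCons.prems)
      ultimately have "g 0 = - (\<Sum>k\<in>{..degree ?C} - {0}. g k)"
        by (simp add: eq_neg_iff_add_eq_0)
      moreover have "P dvd (\<Sum>k\<in>{..degree ?C} - {0}. g k)"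
        unfolding g_def by (intro dvd_sum dvd_mult dvd_mult2) (auto intro: dvd_power)
      ultimately have "P dvd Q ^ degree ?C * b"
        by (simp add: g_def mult.commute)
      then have "P dvd b" by (rule coprime_poly_dvd_power_mult[OF cop(1)])
      moreover have "degree b < n" using pCons.prems(1)[of 0] by simp
      ultimately have b: "b = 0" using small degP by blast
      have "Fract P Q * poly (map_poly to_fract B) (Fract P Q) = 0"
        using pCons.prems(2) b by (simp add: map_poly_pCons)
      moreover have "Fract P Q \<noteq> 0" using nz by (simp add: Fract_conv_to_fract)
      ultimately have "poly (map_poly to_fract B) (Fract P Q) = 0" by simp
      moreover have "degree (coeff B k) < n" for k using pCons.prems(1)[of "Suc k"] by simp
      ultimately show ?case using pCons.IH b by simp
    qed
  qed
qed

lemma common_denominator: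
  assumes "p \<in> polys_over (adjoin_ratfun f)"
  shows "\<exists>e A. poly_subst e f \<noteq> 0 \<and> (\<forall>i. poly_subst e f * coeff p i = poly_subst (A i) f)"
  using assms
proof (induction p)
  case 0
  show ?case by (intro exI[of _ 1] exI[of _ "\<lambda>_. 0"]) simp
next
  case (pCons a p)
  have "coeff p i \<in> adjoin_ratfun f" for i
    using polys_overD[OF pCons.prems, of "Suc i"] by simp
  then obtain e A where e: "poly_subst e f \<noteq> 0" "\<And>i. poly_subst e f * coeff p i = poly_subst (A i) f"
    using pCons.IH unfolding polys_over_def by blast
  obtain C D where CD: "a = poly_subst C f / poly_subst D f" "poly_subst D f \<noteq> 0"
    using polys_overD[OF pCons.prems, of 0] unfolding adjoin_ratfun_eq by auto
  show ?case
  proof (intro exI conjI allI)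
    show "poly_subst (e * D) f \<noteq> 0" using e CD by simp
    show "poly_subst (e * D) f * coeff (pCons a p) i =
        poly_subst (case i of 0 \<Rightarrow> C * e | Suc j \<Rightarrow> D * A j) f" for i
      using CD by (cases i) (auto simp: algebra_simps e(2)[symmetric])
  qed
qed

lemma to_fract_monom: "to_fract (monom c i) = to_fract [:0, 1:] ^ i * ratfun_const c"
  by (simp add: monom_altdef to_fract_smult to_fract_power)

text \<open>With denominators cleared, p(X) = 0 is a polynomial relation between X and f = P / Q.
  \<open>B\<close> regroups the double sum by powers of f: its digits are polynomials in X of degree
  at most deg p < n, so \<open>base_expansion_eq_0\<close> makes all coefficients vanish.\<close>

lemma degree_lower_bound:
  assumes PQ: "(P, Q) \<in> coprime_pairs n" and n: "n \<ge> 1"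
    and p: "p \<in> polys_over (adjoin_ratfun (Fract P Q))" "p \<noteq> 0" "poly p (to_fract [:0, 1:]) = 0"
  shows "n \<le> degree p"
proof (rule ccontr)
  assume "\<not> n \<le> degree p"
  define f where "f = Fract P Q"
  obtain e A where e: "poly_subst e f \<noteq> 0" "\<And>i. poly_subst e f * coeff p i = poly_subst (A i) f"
    using common_denominator[OF p(1)] unfolding f_def by blast
  define B where "B = (\<Sum>i\<le>degree p. map_poly (\<lambda>c. monom c i) (A i))"
  have cB: "coeff B k = (\<Sum>i\<le>degree p. monom (coeff (A i) k) i)" for k
    by (simp add: B_def coeff_sum coeff_map_poly)
  have "B = 0"
  proof (rule base_expansion_eq_0[OF PQ n])
    fix k
    have "degree (coeff B k) \<le> degree p"
      unfolding cB by (intro degree_sum_le) (auto intro: order.trans[OF degree_monom_le])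
    then show "degree (coeff B k) < n" using \<open>\<not> n \<le> degree p\<close> by simp
  next
    have "map_poly to_fract B = (\<Sum>i\<le>degree p. smult (to_fract [:0, 1:] ^ i) (cpoly (A i)))"
      by (rule poly_eqI) (simp add: coeff_map_poly cB to_fract_monom coeff_sum)
    then have "poly (map_poly to_fract B) f = (\<Sum>i\<le>degree p. to_fract [:0, 1:] ^ i * poly_subst (A i) f)"
      by (simp add: poly_sum poly_subst_def)
    also have "\<dots> = poly_subst e f * poly p (to_fract [:0, 1:])"
      by (simp add: poly_altdef[of p] sum_distrib_left e(2)[symmetric] algebra_simps)
    finally show "poly (map_poly to_fract B) (Fract P Q) = 0" using p(3) by (simp add: f_def)
  qed
  let ?d = "degree p"
  have "A ?d = 0"
  proof (rule poly_eqI)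
    fix k
    have "coeff (coeff B k) ?d = (\<Sum>i\<le>?d. if i = ?d then coeff (A i) k else 0)"
      by (simp add: cB coeff_sum)
    also have "\<dots> = coeff (A ?d) k" by simp
    finally show "coeff (A ?d) k = coeff 0 k" using \<open>B = 0\<close> by simp
  qed
  then have "poly_subst e f * lead_coeff p = 0" using e(2)[of ?d] by simp
  then show False using e(1) p(2) by simp
qed

text \<open>The minimal polynomial of \<open>X\<close> over \<open>\<bbbF>\<^sub>q(P / Q)\<close>, up to a scalar.\<close>

definition ratio_poly :: "'a::field poly \<Rightarrow> 'a poly \<Rightarrow> 'a poly fract poly" where
  "ratio_poly P Q = cpoly P - smult (Fract P Q) (cpoly Q)"

lemma coeff_ratio_poly:
  "coeff (ratio_poly P Q) i = ratfun_const (coeff P i) - Fract P Q * ratfun_const (coeff Q i)"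
  by (simp add: ratio_poly_def)

lemma ratio_poly_root: "Q \<noteq> 0 \<Longrightarrow> poly (ratio_poly P Q) (to_fract [:0, 1:]) = 0"
  by (simp add: ratio_poly_def poly_cpoly_X Fract_conv_to_fract)

lemma ratio_poly_polys_over:
  assumes "field_closed F" "Fract P Q \<in> F" "range ratfun_const \<subseteq> F"
  shows "ratio_poly P Q \<in> polys_over F"
  unfolding ratio_poly_def by (intro polys_over_closed cpoly_polys_over assms)

lemma coeff_ratio_poly_eq_0_iff:
  assumes "pair_indep P Q"
  shows "coeff (ratio_poly P Q) i = 0 \<longleftrightarrow> coeff P i = 0 \<and> coeff Q i = 0"
proof
  assume "coeff (ratio_poly P Q) i = 0"
  then have "ratfun_const (coeff P i) + Fract P Q * ratfun_const (- coeff Q i) = 0"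
    by (simp add: coeff_ratio_poly)
  from Fract_linear_indep[OF assms this] show "coeff P i = 0 \<and> coeff Q i = 0" by simp
qed (simp add: coeff_ratio_poly)

lemma degree_ratio_poly:
  assumes PQ: "(P, Q) \<in> coprime_pairs n" and n: "n \<ge> 1"
  shows "degree (ratio_poly P Q) = n"
proof (rule antisym)
  note ind = coprime_pairs_indep[OF PQ n]
  have m: "max (degree P) (degree Q) = n" using PQ by (auto simp: coprime_pairs_def)
  show "degree (ratio_poly P Q) \<le> n"
    using m by (intro degree_le) (auto simp: coeff_ratio_poly_eq_0_iff[OF ind] coeff_eq_0)
  have "coeff P n \<noteq> 0 \<or> coeff Q n \<noteq> 0"
    using m pair_indep_nonzero[OF ind] by (metis leading_coeff_0_iff max_def)
  then show "n \<le> degree (ratio_poly P Q)"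
    by (intro le_degree) (simp add: coeff_ratio_poly_eq_0_iff[OF ind])
qed

text \<open>\<open>ratio_poly\<close>, made monic, attains the bound of
  \<open>degree_lower_bound\<close>.\<close>

lemma alg_degree_adjoin_Fract:
  assumes PQ: "(P, Q) \<in> coprime_pairs n" and n: "n \<ge> 1"
  shows "alg_degree (adjoin_ratfun (Fract P Q)) (to_fract [:0, 1:]) n"
proof -
  let ?F = "adjoin_ratfun (Fract P Q)" and ?h = "ratio_poly P Q"
  let ?m = "smult (inverse (lead_coeff ?h)) ?h"
  have Q: "Q \<noteq> 0" using pair_indep_nonzero[OF coprime_pairs_indep[OF PQ n]] by simp
  have deg: "degree ?h = n" by (rule degree_ratio_poly[OF PQ n])
  then have h0: "?h \<noteq> 0" using n by auto
  have h: "?h \<in> polys_over ?F" by (rule ratio_poly_polys_over) (auto intro: adjoin_ratfun_closed)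
  show ?thesis unfolding alg_degree_def
  proof (intro conjI bexI[of _ ?m] ballI impI)
    show "?m \<in> polys_over ?F"
      by (intro polys_over_closed(6) field_closedD(6) adjoin_ratfun_closed h polys_overD[OF h])
  qed (use deg h0 degree_lower_bound[OF PQ n] ratio_poly_root[OF Q] in auto)
qed

text \<open>A change of basis of the plane acts on the quotient as a linear fractional
  transformation, which does not leave the generated field.\<close>

lemma adjoin_Fract_mono:
  assumes "pair_span P Q = pair_span R S" "S \<noteq> 0"
  shows "adjoin_ratfun (Fract P Q) \<subseteq> adjoin_ratfun (Fract R S)"
proof (rule adjoin_ratfun_minimal)
  let ?g = "Fract R S"
  note G = field_closedD[OF adjoin_ratfun_closed(1)[of ?g]] adjoin_ratfun_closed(2,3)
  have "P \<in> pair_span R S" "Q \<in> pair_span R S" using assms(1) pair_span_mem by blast+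
  then obtain a b c d where "P = smult a R + smult b S" "Q = smult c R + smult d S"
    unfolding pair_span_def by blast
  then have "to_fract P = to_fract S * (ratfun_const a * ?g + ratfun_const b)"
    "to_fract Q = to_fract S * (ratfun_const c * ?g + ratfun_const d)"
    using assms(2) by (simp_all add: Fract_conv_to_fract to_fract_smult field_simps)
  then have "Fract P Q = (ratfun_const a * ?g + ratfun_const b) / (ratfun_const c * ?g + ratfun_const d)"
    using assms(2) by (simp only: Fract_conv_to_fract[of P]) simp
  also have "\<dots> \<in> adjoin_ratfun ?g" by (intro G)
  finally show "Fract P Q \<in> adjoin_ratfun ?g" .
qed (auto intro: adjoin_ratfun_closed)

text \<open>
  Both sides have the same minimal polynomial of \<open>X\<close>, so \<open>P(T) - f Q(T) = u (R(T) - g S(T))\<close>.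
  Comparing coefficients shows that \<open>1, f\<close> and \<open>u, u g\<close> span the same plane over the constants.
\<close>

lemma pair_span_subset_of_adjoin_eq:
  assumes PQ: "(P, Q) \<in> coprime_pairs n" and RS: "(R, S) \<in> coprime_pairs n" and n: "n \<ge> 1"
    and eq: "adjoin_ratfun (Fract P Q) = adjoin_ratfun (Fract R S)"
  shows "pair_span P Q \<subseteq> pair_span R S"
proof -
  let ?F = "adjoin_ratfun (Fract P Q)"
  define f g where "f = Fract P Q" and "g = Fract R S"
  note indP = coprime_pairs_indep[OF PQ n] and indR = coprime_pairs_indep[OF RS n]
  define u where "u = lead_coeff (ratio_poly P Q) / lead_coeff (ratio_poly R S)"
  have deg: "degree (ratio_poly P Q) = n" "degree (ratio_poly R S) = n"
    using degree_ratio_poly[OF PQ n] degree_ratio_poly[OF RS n] by auto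
  have "Fract R S \<in> ?F" unfolding eq by (rule adjoin_ratfun_closed)
  then have h: "ratio_poly P Q \<in> polys_over ?F" "ratio_poly R S \<in> polys_over ?F"
    by (auto intro!: ratio_poly_polys_over adjoin_ratfun_closed)
  have "ratio_poly R S \<noteq> 0" using deg n by auto
  then have lc: "lead_coeff (ratio_poly R S) \<noteq> 0" by simp
  define D where "D = ratio_poly P Q - smult u (ratio_poly R S)"
  have "u \<in> ?F" unfolding u_def
    by (intro field_closedD(8) adjoin_ratfun_closed polys_overD[OF h(1)] polys_overD[OF h(2)])
  then have "D \<in> polys_over ?F" unfolding D_def by (intro polys_over_closed h adjoin_ratfun_closed)
  moreover have "poly D (to_fract [:0, 1:]) = 0"
    using pair_indep_nonzero[OF indP] pair_indep_nonzero[OF indR] by (simp add: D_def ratio_poly_root)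
  moreover have "degree D < n"
  proof (rule degree_lessI)
    show "D \<noteq> 0 \<or> 0 < n" using n by simp
    show "\<forall>k\<ge>n. coeff D k = 0"
      using deg lc by (auto simp: D_def u_def le_less coeff_eq_0)
  qed
  ultimately have "D = 0" using degree_lower_bound[OF PQ n] by fastforce
  then have eqc: "ratfun_const (coeff P i) - f * ratfun_const (coeff Q i) =
      u * (ratfun_const (coeff R i) - g * ratfun_const (coeff S i))" for i
    unfolding D_def f_def g_def coeff_ratio_poly[symmetric] by (metis coeff_smult eq_iff_diff_eq_0)
  obtain i j where ij: "coeff R i * coeff S j - coeff R j * coeff S i \<noteq> 0"
    using pair_indep_minor[OF indR] by blast
  define e where "e = coeff R i * coeff S j - coeff R j * coeff S i"
  have e: "ratfun_const e \<noteq> 0" using ij by (simp only: e_def ratfun_const_simps(8) not_False_eq_True)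
  define lhs where "lhs k = ratfun_const (coeff P k) - f * ratfun_const (coeff Q k)" for k
  \<comment> \<open>Cramer's rule on the coefficient equations \<open>i\<close> and
    \<open>j\<close>: the nonzero minor \<open>e\<close> solves them for \<open>u\<close> and
    \<open>u * g\<close>, so both are combinations of 1 and \<open>f\<close> over the
    constants.\<close>
  have "u * ratfun_const e = ratfun_const (coeff S j) * lhs i - ratfun_const (coeff S i) * lhs j"
    "u * g * ratfun_const e = ratfun_const (coeff R j) * lhs i - ratfun_const (coeff R i) * lhs j"
    unfolding lhs_def eqc e_def by (simp_all add: algebra_simps)
  moreover have "\<exists>\<alpha> \<beta>. x = ratfun_const \<alpha> + f * ratfun_const \<beta>"
    if "x * ratfun_const e = ratfun_const c * lhs i - ratfun_const d * lhs j" for x c d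
  proof -
    have "x = ratfun_const (inverse e) * (ratfun_const c * lhs i - ratfun_const d * lhs j)"
      using that[symmetric] e by (simp add: ratfun_const_inverse)
    also have "\<dots> = ratfun_const (inverse e * (c * coeff P i - d * coeff P j)) +
        f * ratfun_const (inverse e * (d * coeff Q j - c * coeff Q i))"
      by (simp add: lhs_def algebra_simps)
    finally show ?thesis by blast
  qed
  ultimately obtain \<alpha> \<beta> \<gamma> \<delta> where u: "u = ratfun_const \<alpha> + f * ratfun_const \<beta>"
    and ug: "u * g = ratfun_const \<gamma> + f * ratfun_const \<delta>"
    by metis
  have "coeff P k = \<alpha> * coeff R k - \<gamma> * coeff S k \<and> coeff Q k = \<delta> * coeff S k - \<beta> * coeff R k" for k
  proof -
    have "ratfun_const (coeff P k) - f * ratfun_const (coeff Q k) =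
        u * ratfun_const (coeff R k) - u * g * ratfun_const (coeff S k)"
      using eqc[of k] by (simp add: algebra_simps)
    then have "ratfun_const (coeff P k - (\<alpha> * coeff R k - \<gamma> * coeff S k)) +
        Fract P Q * ratfun_const (- (coeff Q k - (\<delta> * coeff S k - \<beta> * coeff R k))) = 0"
      unfolding ug unfolding u by (simp add: f_def algebra_simps)
    from Fract_linear_indep[OF indP this] show ?thesis by simp
  qed
  then have "P = smult \<alpha> R + smult (- \<gamma>) S" "Q = smult (- \<beta>) R + smult \<delta> S"
    by (auto intro!: poly_eqI)
  then have "P \<in> pair_span R S" "Q \<in> pair_span R S" unfolding pair_span_def by blast+
  then show ?thesis by (simp add: pair_span_subset_iff)
qed

lemma adjoin_Fract_eq_iff:
  assumes PQ: "(P, Q) \<in> coprime_pairs n" and RS: "(R, S) \<in> coprime_pairs n" and n: "n \<ge> 1"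
  shows "adjoin_ratfun (Fract P Q) = adjoin_ratfun (Fract R S) \<longleftrightarrow> pair_span P Q = pair_span R S"
proof
  assume "adjoin_ratfun (Fract P Q) = adjoin_ratfun (Fract R S)"
  then show "pair_span P Q = pair_span R S"
    using pair_span_subset_of_adjoin_eq[OF PQ RS n] pair_span_subset_of_adjoin_eq[OF RS PQ n] by auto
next
  assume "pair_span P Q = pair_span R S"
  then show "adjoin_ratfun (Fract P Q) = adjoin_ratfun (Fract R S)"
    using adjoin_Fract_mono pair_indep_nonzero(2) coprime_pairs_indep[OF PQ n] coprime_pairs_indep[OF RS n]
    by (metis subset_antisym)
qed

subsection \<open>Gauss' lemma and Lueroth's theorem\<close>

text \<open>A nonconstant divisor of least degree is irreducible, hence prime.\<close>

lemma prime_factor_exists: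
  fixes \<alpha> :: "'a::field poly"
  assumes "degree \<alpha> > 0"
  shows "\<exists>\<pi>. prime_elem \<pi> \<and> \<pi> dvd \<alpha>"
proof -
  obtain \<pi> where \<pi>: "degree \<pi> > 0 \<and> \<pi> dvd \<alpha>"
    and min: "\<And>\<rho>. degree \<rho> > 0 \<and> \<rho> dvd \<alpha> \<Longrightarrow> degree \<pi> \<le> degree \<rho>"
    using ex_has_least_nat[of "\<lambda>\<rho>. degree \<rho> > 0 \<and> \<rho> dvd \<alpha>" \<alpha> degree] assms by auto
  have "Factorial_Ring.irreducible \<pi>"
  proof (rule Factorial_Ring.irreducibleI)
    show "\<pi> \<noteq> 0" using \<pi> by auto
    show "\<not> \<pi> dvd 1" using \<pi> by (cases "\<pi> = 0") (auto simp: is_unit_iff_degree)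
  next
    fix a b assume ab: "\<pi> = a * b"
    have nz: "a \<noteq> 0" "b \<noteq> 0" using \<pi> ab by auto
    have "degree a = 0 \<or> degree b = 0"
    proof (rule ccontr)
      assume *: "\<not> ?thesis"
      have "a dvd \<alpha>" using \<pi> ab by (metis dvd_mult_left)
      then have "degree \<pi> \<le> degree a" using min[of a] * by auto
      then show False using * ab nz by (simp add: degree_mult_eq)
    qed
    then show "a dvd 1 \<or> b dvd 1" using nz by (auto simp: is_unit_iff_degree)
  qed
  then show ?thesis using \<pi> field_poly_irreducible_imp_prime by blast
qed

definition primitive :: "'a::field poly poly \<Rightarrow> bool" where
  "primitive \<Phi> \<longleftrightarrow> (\<forall>c. [:c:] dvd \<Phi> \<longrightarrow> degree c = 0)"

text \<open>Gauss' lemma: the prime factors of \<alpha> are cancelled one at a time. Each remains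
  prime as a polynomial constant in the outer variable, and it cannot divide the primitive \<Phi>,
  so it divides the cofactor.\<close>

lemma primitive_dvd_of_smult:
  assumes prim: "primitive \<Phi>" and "\<alpha> \<noteq> 0" "smult \<alpha> D = \<Phi> * \<Psi>"
  shows "\<Phi> dvd D"
  using assms(2,3)
proof (induction "degree \<alpha>" arbitrary: \<alpha> \<Psi> rule: less_induct)
  case less
  show ?case
  proof (cases "degree \<alpha> = 0")
    case True
    then have "\<alpha> dvd 1" using less.prems by (simp add: is_unit_iff_degree)
    then obtain \<beta> where \<beta>: "1 = \<alpha> * \<beta>" by (rule dvdE)
    have "D = smult \<beta> (smult \<alpha> D)" using \<beta> by (simp add: mult.commute)
    then have "D = \<Phi> * smult \<beta> \<Psi>" using less.prems(2) by simp
    then show ?thesis by (rule dvdI)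
  next
    case False
    then obtain \<pi> where \<pi>: "prime_elem \<pi>" "\<pi> dvd \<alpha>" using prime_factor_exists by blast
    then obtain \<alpha>' where \<alpha>': "\<alpha> = \<pi> * \<alpha>'" by (auto elim: dvdE)
    have \<pi>0: "\<pi> \<noteq> 0" using \<pi>(1) by (simp add: prime_elem_def)
    have \<pi>d: "degree \<pi> > 0"
      using prime_elem_not_unit[OF \<pi>(1)] is_unit_iff_degree[OF \<pi>0] by simp
    have eq: "\<Phi> * \<Psi> = [:\<pi>:] * smult \<alpha>' D" using less.prems(2) \<alpha>' by (simp add: mult.commute)
    have "prime_elem [:\<pi>:]" using \<pi>(1) by (rule lift_prime_elem_poly)
    moreover have "[:\<pi>:] dvd \<Phi> * \<Psi>" unfolding eq by (rule dvd_triv_left)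
    ultimately have "[:\<pi>:] dvd \<Phi> \<or> [:\<pi>:] dvd \<Psi>" by (rule prime_elem_dvd_multD)
    moreover have "\<not> [:\<pi>:] dvd \<Phi>" using prim \<pi>d unfolding primitive_def by (metis less_irrefl)
    ultimately obtain \<Psi>' where \<Psi>': "\<Psi> = [:\<pi>:] * \<Psi>'" by (auto elim: dvdE)
    have "[:\<pi>:] * smult \<alpha>' D = [:\<pi>:] * (\<Phi> * \<Psi>')" using eq \<Psi>' by (metis mult.left_commute)
    then have "smult \<alpha>' D = \<Phi> * \<Psi>'" using \<pi>0 by (metis mult_cancel_left pCons_eq_0_iff)
    moreover have "\<alpha>' \<noteq> 0" using less.prems \<alpha>' by auto
    moreover have "degree \<alpha>' < degree \<alpha>"
      using \<alpha>' \<pi>0 \<pi>d \<open>\<alpha>' \<noteq> 0\<close> by (simp add: degree_mult_eq)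
    ultimately show ?thesis using less.hyps by blast
  qed
qed

lemma clear_denominators:
  fixes h :: "'a::field poly fract poly"
  shows "\<exists>c H. c \<noteq> 0 \<and> smult (to_fract c) h = map_poly to_fract H"
proof (induction h)
  case 0
  show ?case by (intro exI[of _ 1] exI[of _ 0]) simp
next
  case (pCons a h)
  then obtain c H where cH: "c \<noteq> 0" "smult (to_fract c) h = map_poly to_fract H" by blast
  obtain x y where xy: "a = Fract x y" "y \<noteq> 0" by (cases a)
  have "smult (to_fract (y * c)) (pCons a h) =
      pCons (to_fract (c * x)) (smult (to_fract y) (smult (to_fract c) h))"
    using xy by (simp add: Fract_conv_to_fract)
  also have "\<dots> = map_poly to_fract (pCons (c * x) (smult y H))"
    unfolding cH(2) by (simp add: map_poly_pCons)
  finally have "smult (to_fract (y * c)) (pCons a h) = map_poly to_fract (pCons (c * x) (smult y H))" .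
  moreover have "y * c \<noteq> 0" using cH xy by simp
  ultimately show ?case by blast
qed

text \<open>Among the polynomial multiples of \<open>h\<close>, one whose leading coefficient has
  least degree is primitive: dividing out a nonconstant content would lower that degree.\<close>

lemma primitive_multiple_exists:
  fixes h :: "'a::field poly fract poly"
  assumes "h \<noteq> 0"
  shows "\<exists>c \<Phi>. c \<noteq> 0 \<and> smult c h = map_poly to_fract \<Phi> \<and> primitive \<Phi>"
proof -
  define M where "M \<Phi> \<longleftrightarrow> (\<exists>c. c \<noteq> 0 \<and> smult c h = map_poly to_fract \<Phi>)" for \<Phi>
  obtain c0 \<Phi>0 where "c0 \<noteq> 0" "smult (to_fract c0) h = map_poly to_fract \<Phi>0"
    using clear_denominators by blast
  then have "M \<Phi>0" unfolding M_def by (metis to_fract_eq_0_iff)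
  then obtain \<Phi> where \<Phi>: "M \<Phi>" and min: "\<And>\<Psi>. M \<Psi> \<Longrightarrow> degree (lead_coeff \<Phi>) \<le> degree (lead_coeff \<Psi>)"
    using ex_has_least_nat[of M \<Phi>0 "\<lambda>\<Psi>. degree (lead_coeff \<Psi>)"] by blast
  obtain c where c: "c \<noteq> 0" "smult c h = map_poly to_fract \<Phi>" using \<Phi> M_def by blast
  have "primitive \<Phi>"
    unfolding primitive_def
  proof (intro allI impI)
    fix d assume "[:d:] dvd \<Phi>"
    then obtain \<Psi> where \<Psi>: "\<Phi> = smult d \<Psi>" by (auto elim: dvdE)
    have "smult c h \<noteq> 0" using c(1) assms by simp
    then have nz: "\<Phi> \<noteq> 0" unfolding c(2) by auto
    then have d: "d \<noteq> 0" "\<Psi> \<noteq> 0" using \<Psi> by auto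
    have "smult (c / to_fract d) h = smult (inverse (to_fract d)) (smult c h)"
      by (simp add: divide_inverse mult.commute)
    also have "\<dots> = map_poly to_fract \<Psi>"
      unfolding c(2) \<Psi> using d by simp
    finally have "M \<Psi>" unfolding M_def using c(1) d by (intro exI[of _ "c / to_fract d"]) simp
    from min[OF this] show "degree d = 0"
      using d unfolding \<Psi> by (simp add: lead_coeff_smult degree_mult_eq)
  qed
  then show ?thesis using c by blast
qed

text \<open>For \<Phi>(X, T) with outer variable T this is the coefficient of X^N, a polynomial in
  T; it exchanges the roles of the two variables.\<close>

definition inner_coeff :: "nat \<Rightarrow> 'a::field poly poly \<Rightarrow> 'a poly" where
  "inner_coeff N \<Phi> = map_poly (\<lambda>p. coeff p N) \<Phi>"

lemma coeff_inner_coeff [simp]: "coeff (inner_coeff N \<Phi>) i = coeff (coeff \<Phi> i) N"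
  by (simp add: inner_coeff_def coeff_map_poly)

lemma coeff_mult_extreme:
  assumes "degree p \<le> M" "degree r \<le> N"
  shows "coeff (p * r) (M + N) = coeff p M * coeff r N"
proof -
  have "coeff (p * r) (M + N) = (\<Sum>i\<le>M + N. if i = M then coeff p M * coeff r N else 0)"
    unfolding coeff_mult
  proof (rule sum.cong)
    fix i assume "i \<in> {..M + N}"
    show "coeff p i * coeff r (M + N - i) = (if i = M then coeff p M * coeff r N else 0)"
    proof (cases "i < M")
      case True
      then have "coeff r (M + N - i) = 0" using assms by (intro coeff_eq_0) linarith
      then show ?thesis using True by simp
    next
      case False
      then show ?thesis using assms by (cases "i = M") (auto simp: coeff_eq_0)
    qed
  qed simp
  then show ?thesis by simp
qed

text \<open>Leading coefficients in X multiply, so degrees in X add.\<close>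

lemma inner_coeff_mult_extreme:
  assumes "\<And>i. degree (coeff \<Phi> i) \<le> M" "\<And>i. degree (coeff \<Psi> i) \<le> N"
  shows "inner_coeff (M + N) (\<Phi> * \<Psi>) = inner_coeff M \<Phi> * inner_coeff N \<Psi>"
  by (rule poly_eqI) (simp add: coeff_mult[of \<Phi>] coeff_mult[of "inner_coeff M \<Phi>"] coeff_sum
      coeff_mult_extreme[OF assms])

lemma inner_coeff_mult_const:
  assumes "\<And>i. degree (coeff \<Psi> i) = 0"
  shows "inner_coeff j (\<Phi> * \<Psi>) = inner_coeff j \<Phi> * inner_coeff 0 \<Psi>"
proof (rule poly_eqI)
  fix t
  have *: "coeff (p * coeff \<Psi> i) j = coeff p j * coeff (coeff \<Psi> i) 0" for p i
    using assms[of i] by (auto elim!: degree_eq_zeroE)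
  show "coeff (inner_coeff j (\<Phi> * \<Psi>)) t = coeff (inner_coeff j \<Phi> * inner_coeff 0 \<Psi>) t"
    by (simp add: coeff_mult[of \<Phi>] coeff_mult[of "inner_coeff j \<Phi>"] coeff_sum *)
qed

lemma inner_degree_exists:
  assumes "\<Phi> \<noteq> 0"
  shows "\<exists>M. (\<forall>i. degree (coeff \<Phi> i) \<le> M) \<and> inner_coeff M \<Phi> \<noteq> 0"
proof -
  let ?A = "(\<lambda>i. degree (coeff \<Phi> i)) ` {i. i \<le> degree \<Phi> \<and> coeff \<Phi> i \<noteq> 0}"
  have "degree \<Phi> \<in> {i. i \<le> degree \<Phi> \<and> coeff \<Phi> i \<noteq> 0}" using assms by simp
  then have A: "finite ?A" "?A \<noteq> {}" by auto
  obtain i where "Max ?A = degree (coeff \<Phi> i)" "i \<in> {i. i \<le> degree \<Phi> \<and> coeff \<Phi> i \<noteq> 0}"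
    using Max_in[OF A] by (rule imageE)
  then have i: "coeff \<Phi> i \<noteq> 0" "Max ?A = degree (coeff \<Phi> i)" by auto
  have "degree (coeff \<Phi> j) \<le> Max ?A" for j
  proof (cases "coeff \<Phi> j = 0")
    case False
    then show ?thesis by (intro Max_ge A) (auto intro: le_degree)
  qed simp
  moreover have "coeff (inner_coeff (Max ?A) \<Phi>) i \<noteq> 0" using i by simp
  ultimately show ?thesis by (metis coeff_0)
qed

lemma Fract_coprime_rep:
  fixes f :: "'a::field poly fract"
  shows "\<exists>P Q. f = Fract P Q \<and> Q \<noteq> 0 \<and> coprime P Q"
proof -
  obtain a b where f: "f = Fract a b" "b \<noteq> 0" by (cases f)
  then obtain g P Q where "lead_coeff g = 1" "a = g * P" "b = g * Q" "coprime P Q"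
    using coprime_decomposition[of a b] by blast
  then show ?thesis using f by (intro exI[of _ P] exI[of _ Q]) (auto simp: Fract_conv_to_fract)
qed

lemma nonconst_coprime_rep:
  assumes "f \<notin> range ratfun_const"
  shows "\<exists>k\<ge>1. \<exists>P Q. f = Fract P Q \<and> (P, Q) \<in> coprime_pairs k"
proof -
  obtain P Q where PQ: "f = Fract P Q" "Q \<noteq> 0" "coprime P Q" using Fract_coprime_rep by blast
  have "max (degree P) (degree Q) \<ge> 1"
  proof (rule ccontr)
    assume "\<not> ?thesis"
    then obtain p r where "P = [:p:]" "Q = [:r:]" by (auto simp: not_le elim!: degree_eq_zeroE)
    then have "f = ratfun_const (p * inverse r)"
      using PQ(1) by (simp add: Fract_conv_to_fract ratfun_const_inverse)
        (simp add: ratfun_const_def divide_inverse)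
    then show False using assms by blast
  qed
  then show ?thesis using PQ by (auto simp: coprime_pairs_def)
qed

text \<open>
  A non-constant coefficient \<open>f = P / Q\<close> of the minimal polynomial of \<open>X\<close> over \<open>F\<close>
  generates \<open>F\<close>: by Gauss' lemma the primitive form \<open>\<Phi>(X, T)\<close> of the minimal polynomial divides
  \<open>Q(X) P(T) - P(X) Q(T)\<close>, whose degree in \<open>X\<close> is not larger, so the cofactor lies in \<open>\<bbbF>\<^sub>q[T]\<close>
  and, \<open>P\<close> and \<open>Q\<close> being coprime, is constant.
\<close>

lemma lueroth:
  fixes F :: "'a::field poly fract set"
  assumes F: "field_closed F" "range ratfun_const \<subseteq> F" and deg: "alg_degree F (to_fract [:0, 1:]) n"
  shows "\<exists>P Q. (P, Q) \<in> coprime_pairs n \<and> n \<ge> 1 \<and> F = adjoin_ratfun (Fract P Q)"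
proof -
  let ?X = "to_fract [:0, 1:] :: 'a poly fract"
  obtain m where m: "m \<in> polys_over F" "lead_coeff m = 1" "degree m = n" "poly m ?X = 0"
    using deg unfolding alg_degree_def by blast
  \<comment> \<open>Otherwise X would be a root of a nonzero polynomial over the constants.\<close>
  have "\<exists>i. coeff m i \<notin> range ratfun_const"
  proof (rule ccontr)
    assume "\<nexists>i. coeff m i \<notin> range ratfun_const"
    then have c: "ratfun_const (the_inv ratfun_const (coeff m i)) = coeff m i" for i
      by (intro f_the_inv_into_f) (auto intro: injI)
    have "the_inv (ratfun_const :: 'a \<Rightarrow> _) 0 = 0"
      using the_inv_f_f[of "ratfun_const :: 'a \<Rightarrow> _" 0] by (simp add: inj_def)
    then have "m = cpoly (map_poly (the_inv ratfun_const) m)"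
      by (intro poly_eqI) (simp add: coeff_map_poly c)
    then have "map_poly (the_inv ratfun_const) m = 0"
      using m(4) poly_cpoly_X by (metis to_fract_eq_0_iff)
    then show False using \<open>m = _\<close> m(2) by simp
  qed
  then obtain i where i: "coeff m i \<notin> range ratfun_const" by blast
  then obtain k P Q where k: "k \<ge> 1" and f: "coeff m i = Fract P Q" and PQ: "(P, Q) \<in> coprime_pairs k"
    using nonconst_coprime_rep by blast
  note ind = coprime_pairs_indep[OF PQ k]
  have nz: "P \<noteq> 0" "Q \<noteq> 0" using pair_indep_nonzero[OF ind] by auto
  have cop: "coprime P Q" "coprime Q P" and kdef: "k = max (degree P) (degree Q)"
    using PQ by (auto simp: coprime_pairs_def coprime_commute)
  have fF: "Fract P Q \<in> F" using polys_overD[OF m(1), of i] f by simp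
  define h where "h = ratio_poly P Q"
  have "h \<in> polys_over F" unfolding h_def by (rule ratio_poly_polys_over[OF F(1) fF F(2)])
  moreover have "poly h ?X = 0" unfolding h_def by (rule ratio_poly_root[OF nz(2)])
  ultimately have "m dvd h"
    using alg_degree_minimal_dvd[OF F(1), of ?X m] deg m by simp
  then obtain w where w: "h = m * w" by (rule dvdE)
  have "m \<noteq> 0" using m(2) by auto
  then obtain c \<Phi> where c: "c \<noteq> 0" "smult c m = map_poly to_fract \<Phi>" and prim: "primitive \<Phi>"
    using primitive_multiple_exists by blast
  obtain d W where d: "d \<noteq> 0" "smult (to_fract d) w = map_poly to_fract W"
    using clear_denominators by blast
  \<comment> \<open>\<open>lift P\<close> is P(T), so \<open>D\<close> is Q(X) P(T) - P(X) Q(T),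
    which is Q(X) times \<open>h\<close>.\<close>
  define lift where "lift p = map_poly (\<lambda>c. [:c:]) p" for p :: "'a poly"
  define D where "D = smult Q (lift P) - smult P (lift Q)"
  have cD: "coeff D t = smult (coeff P t) Q - smult (coeff Q t) P" for t
    by (simp add: D_def lift_def coeff_map_poly)
  have fD: "map_poly to_fract D = smult (to_fract Q) h"
    by (rule poly_eqI)
      (use nz in \<open>simp add: coeff_map_poly cD to_fract_smult h_def coeff_ratio_poly Fract_conv_to_fract field_simps\<close>)
  have hdeg: "degree h = k" unfolding h_def by (rule degree_ratio_poly[OF PQ k])
  then have "h \<noteq> 0" using k by auto
  have "degree D = k"
    using fD hdeg nz by (metis degree_map_poly degree_smult_eq to_fract_eq_0_iff)
  have "D \<noteq> 0" using \<open>degree D = k\<close> k by auto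
  \<comment> \<open>All scalars in the factorization h = m w are gathered into one fraction x / y in
    X; clearing it exhibits \<Phi> as a divisor of x D, and primitivity then removes
    \<open>x\<close>.\<close>
  obtain x y where xy: "c * to_fract d / to_fract Q = Fract x y" "y \<noteq> 0" by (cases "c * to_fract d / to_fract Q")
  have "x \<noteq> 0" using xy c(1) d(1) nz by (auto simp: Fract_conv_to_fract)
  have "map_poly to_fract (smult y (\<Phi> * W)) = smult (to_fract y) (smult c m * smult (to_fract d) w)"
    unfolding c(2) d(2) by simp
  also have "\<dots> = smult (to_fract y * (c * to_fract d / to_fract Q)) (smult (to_fract Q) h)"
    using nz unfolding w by (simp add: field_simps)
  also have "\<dots> = map_poly to_fract (smult x D)"
    unfolding xy(1) fD[symmetric] using xy(2) by (simp add: Fract_conv_to_fract)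
  finally have "smult x D = \<Phi> * smult y W" by (simp del: fract_poly_mult fract_poly_smult)
  from primitive_dvd_of_smult[OF prim \<open>x \<noteq> 0\<close> this] obtain \<Psi> where \<Psi>: "D = \<Phi> * \<Psi>" by (rule dvdE)
  then have "\<Phi> \<noteq> 0" "\<Psi> \<noteq> 0" using \<open>D \<noteq> 0\<close> by auto
  obtain M where M: "\<And>i. degree (coeff \<Phi> i) \<le> M" "inner_coeff M \<Phi> \<noteq> 0"
    using inner_degree_exists[OF \<open>\<Phi> \<noteq> 0\<close>] by blast
  obtain N where N: "\<And>i. degree (coeff \<Psi> i) \<le> N" "inner_coeff N \<Psi> \<noteq> 0"
    using inner_degree_exists[OF \<open>\<Psi> \<noteq> 0\<close>] by blast
  \<comment> \<open>As \<open>m\<close> is monic, the coefficients \<open>i\<close> and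
    \<open>n\<close> of \<Phi> stand in the ratio P : Q. By coprimality they are multiples of
    \<open>P\<close> and of \<open>Q\<close>, one of which has degree \<open>k\<close>.\<close>
  have "k \<le> M"
  proof -
    have cf: "to_fract (coeff \<Phi> j) = c * coeff m j" for j
      using arg_cong[OF c(2), of "\<lambda>p. coeff p j"] by (simp add: coeff_map_poly)
    have "to_fract (coeff \<Phi> i * Q) = to_fract (P * coeff \<Phi> n)"
      using m(2,3) nz by (simp add: cf f Fract_conv_to_fract)
    then have eq: "coeff \<Phi> i * Q = P * coeff \<Phi> n" by (simp only: to_fract_eq_iff)
    have "P dvd Q * coeff \<Phi> i" using eq by (metis dvd_triv_left mult.commute)
    then have 1: "P dvd coeff \<Phi> i" by (rule coprime_poly_dvd_mult[OF cop(1)])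
    have "Q dvd P * coeff \<Phi> n" using eq by (metis dvd_triv_right)
    then have 2: "Q dvd coeff \<Phi> n" by (rule coprime_poly_dvd_mult[OF cop(2)])
    have "to_fract (coeff \<Phi> n) \<noteq> 0" unfolding cf using c(1) m(2,3) by simp
    moreover have "to_fract (coeff \<Phi> i) \<noteq> 0"
      unfolding cf using c(1) nz by (simp add: f Fract_conv_to_fract)
    ultimately have "coeff \<Phi> n \<noteq> 0" "coeff \<Phi> i \<noteq> 0" by auto
    then show ?thesis
      using dvd_imp_degree_le[OF 1] dvd_imp_degree_le[OF 2] M(1)[of i] M(1)[of n] kdef by simp
  qed
  have "inner_coeff (M + N) D \<noteq> 0"
    unfolding \<Psi> inner_coeff_mult_extreme[OF M(1) N(1)] using M(2) N(2) by simp
  then obtain t where "coeff (coeff D t) (M + N) \<noteq> 0"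
    by (metis coeff_inner_coeff leading_coeff_0_iff)
  then have "M + N \<le> degree (coeff D t)" by (rule le_degree)
  also have "\<dots> \<le> k"
    unfolding cD kdef by (intro degree_diff_le) (auto intro: order.trans[OF degree_smult_le])
  finally have "N = 0" using \<open>k \<le> M\<close> by simp
  then have \<Psi>c: "degree (coeff \<Psi> i) = 0" for i using N(1)[of i] by simp
  define \<psi> where "\<psi> = inner_coeff 0 \<Psi>"
  have div: "\<psi> dvd smult (coeff Q j) P - smult (coeff P j) Q" for j
  proof -
    have "inner_coeff j D = inner_coeff j \<Phi> * \<psi>"
      unfolding \<Psi> \<psi>_def by (rule inner_coeff_mult_const[OF \<Psi>c])
    moreover have "inner_coeff j D = smult (coeff Q j) P - smult (coeff P j) Q"
      by (rule poly_eqI) (simp add: cD mult.commute)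
    ultimately show ?thesis by simp
  qed
  \<comment> \<open>With a nonzero minor, e P and e Q are combinations of the polynomials just shown
    to be divisible by \<psi>.\<close>
  obtain i j where ij: "coeff P i * coeff Q j - coeff P j * coeff Q i \<noteq> 0"
    using pair_indep_minor[OF ind] by blast
  define e where "e = coeff P i * coeff Q j - coeff P j * coeff Q i"
  have e: "e \<noteq> 0" unfolding e_def by (rule ij)
  have "smult (coeff P i) (smult (coeff Q j) P - smult (coeff P j) Q)
      - smult (coeff P j) (smult (coeff Q i) P - smult (coeff P i) Q) = smult e P"
    "smult (coeff Q i) (smult (coeff Q j) P - smult (coeff P j) Q)
      - smult (coeff Q j) (smult (coeff Q i) P - smult (coeff P i) Q) = smult e Q"
    by (rule poly_eqI, simp add: e_def algebra_simps)+
  then have "\<psi> dvd smult e P" "\<psi> dvd smult e Q"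
    using div by (metis dvd_diff dvd_smult)+
  then have "\<psi> dvd P" "\<psi> dvd Q" using e by (simp_all add: dvd_smult_iff)
  then have "\<psi> dvd 1" using cop(1) coprime_common_divisor by blast
  moreover have "\<psi> \<noteq> 0" using \<open>\<psi> dvd P\<close> nz by auto
  ultimately have "degree \<psi> = 0" by (simp add: is_unit_iff_degree)
  have "degree \<Psi> = 0"
  proof (rule ccontr)
    assume "degree \<Psi> \<noteq> 0"
    have "coeff \<psi> (degree \<Psi>) \<noteq> 0"
    proof
      assume "coeff \<psi> (degree \<Psi>) = 0"
      then have "lead_coeff \<Psi> = 0"
        using \<Psi>c[of "degree \<Psi>"] by (auto simp: \<psi>_def elim!: degree_eq_zeroE)
      then show False using \<open>\<Psi> \<noteq> 0\<close> by simp
    qed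
    then show False using le_degree[of \<psi> "degree \<Psi>"] \<open>degree \<psi> = 0\<close> \<open>degree \<Psi> \<noteq> 0\<close> by simp
  qed
  then have "k = degree \<Phi>"
    using \<open>degree D = k\<close> \<open>\<Phi> \<noteq> 0\<close> \<open>\<Psi> \<noteq> 0\<close> unfolding \<Psi> by (simp add: degree_mult_eq)
  also have "degree \<Phi> = n"
    using arg_cong[OF c(2), of degree] c(1) m(3) by (simp add: degree_map_poly)
  finally have kn: "k = n" .
  let ?G = "adjoin_ratfun (Fract P Q)"
  have GF: "?G \<subseteq> F" by (rule adjoin_ratfun_minimal[OF F(1) fF F(2)])
  \<comment> \<open>X has the same degree over both fields: expand y = r(X) over the smaller one
    with deg r < n; then r - y is over \<open>F\<close>, vanishes at X and is too short to be
    nonzero.\<close>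
  moreover have "F \<subseteq> ?G"
  proof
    fix y assume y: "y \<in> F"
    have "alg_degree ?G ?X n" using alg_degree_adjoin_Fract[OF PQ k] kn by simp
    then obtain r where r: "r \<in> polys_over ?G" "degree r < n" "y = poly r ?X"
      using alg_degree_expansion[OF adjoin_ratfun_closed(1) ratfun_quotient, of "Fract P Q" n y]
      by (auto intro: adjoin_ratfun_closed)
    have "[:y:] \<in> polys_over F"
      using y F(1) by (auto simp: polys_over_def coeff_pCons field_closedD split: nat.split)
    moreover have "r \<in> polys_over F" using r(1) GF by (auto simp: polys_over_def)
    ultimately have "r - [:y:] \<in> polys_over F" by (intro polys_over_closed F)
    moreover have "poly (r - [:y:]) ?X = 0" using r(3) by simp
    moreover have "degree (r - [:y:]) < n" using r(2) by (intro degree_diff_less) auto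
    ultimately have "r - [:y:] = 0" using deg unfolding alg_degree_def by (meson leD)
    then have "y = coeff r 0" by simp
    then show "y \<in> ?G" using polys_overD[OF r(1)] by simp
  qed
  ultimately show ?thesis using PQ k kn by blast
qed

subsection \<open>The action of diagonal matrices\<close>

definition dilate :: "'a::field \<Rightarrow> 'a poly \<Rightarrow> 'a poly" where
  "dilate c p = pcompose p [:0, c:]"

lemma coeff_dilate [simp]: "coeff (dilate c p) i = c ^ i * coeff p i"
  by (simp add: dilate_def coeff_pcompose_linear)

lemma dilate_hom:
  "dilate c (p + r) = dilate c p + dilate c r" "dilate c (smult a p) = smult a (dilate c p)"
  "dilate c (p * r) = dilate c p * dilate c r" "dilate c 1 = 1"
  by (simp_all add: dilate_def pcompose_add pcompose_smult pcompose_mult pcompose_1)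

lemma dilate_eq_0_iff: "c \<noteq> 0 \<Longrightarrow> dilate c p = 0 \<longleftrightarrow> p = 0"
  by (auto simp: poly_eq_iff)

lemma degree_dilate: "c \<noteq> 0 \<Longrightarrow> degree (dilate c p) = degree p"
  by (simp add: dilate_def degree_pcompose)

lemma dilate_coprime_pairs:
  assumes "c \<noteq> 0" "(P, Q) \<in> coprime_pairs n"
  shows "(dilate c P, dilate c Q) \<in> coprime_pairs n"
proof -
  obtain u v where "u * P + v * Q = 1"
    using assms(2) by (auto simp: coprime_pairs_def coprime_poly_iff_bezout)
  then have "dilate c u * dilate c P + dilate c v * dilate c Q = 1"
    by (metis dilate_hom(1,3,4))
  then show ?thesis using assms by (auto simp: coprime_pairs_def coprime_poly_iff_bezout degree_dilate)
qed

lemma pair_span_dilate: "pair_span (dilate c P) (dilate c Q) = dilate c ` pair_span P Q"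
proof -
  have "smult a (dilate c P) + smult b (dilate c Q) = dilate c (smult a P + smult b Q)" for a b
    by (simp add: dilate_hom)
  then show ?thesis unfolding pair_span_def by auto
qed

lemma poly_subst_dilate: "poly_subst p (to_fract [:0, c:]) = to_fract (dilate c p)"
proof (induction p)
  case 0 then show ?case by (simp add: dilate_def)
next
  case (pCons a p)
  have "to_fract (dilate c (pCons a p)) = to_fract ([:a:] + [:0, c:] * dilate c p)"
    by (simp only: dilate_def pcompose_pCons)
  then show ?case using pCons by (simp only: poly_subst_simps to_fract_add to_fract_mult ratfun_const_def)
qed

text \<open>For c \<noteq> 0 the substitution kills no denominator and respects cross
  multiplication, so every representation of the fraction gives the same value and the definite
  description is met.\<close>

lemma ratfun_compose_dilate:
  assumes "c \<noteq> 0" "Q \<noteq> 0"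
  shows "ratfun_compose (Fract P Q) (to_fract [:0, c:]) = Fract (dilate c P) (dilate c Q)"
  unfolding ratfun_compose_def
proof (rule the_equality)
  show "\<exists>p s. s \<noteq> 0 \<and> Fract P Q = Fract p s \<and> poly_subst s (to_fract [:0, c:]) \<noteq> 0 \<and>
      Fract (dilate c P) (dilate c Q) = poly_subst p (to_fract [:0, c:]) / poly_subst s (to_fract [:0, c:])"
    using assms by (intro exI[of _ P] exI[of _ Q])
      (simp add: poly_subst_dilate dilate_eq_0_iff Fract_conv_to_fract)
next
  fix x assume "\<exists>p s. s \<noteq> 0 \<and> Fract P Q = Fract p s \<and> poly_subst s (to_fract [:0, c:]) \<noteq> 0 \<and>
      x = poly_subst p (to_fract [:0, c:]) / poly_subst s (to_fract [:0, c:])"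
  then obtain p s where s: "s \<noteq> 0" "Fract P Q = Fract p s"
    and x: "x = Fract (dilate c p) (dilate c s)"
    by (auto simp: poly_subst_dilate Fract_conv_to_fract)
  have "P * s = p * Q" using s assms by (simp add: eq_fract)
  then have "dilate c P * dilate c s = dilate c p * dilate c Q" by (metis dilate_hom(3))
  then show "x = Fract (dilate c P) (dilate c Q)"
    unfolding x using s assms by (simp add: eq_fract dilate_eq_0_iff)
qed

lemma moebius_diag2:
  assumes "b \<noteq> 0"
  shows "moebius (diag2 a b) = to_fract [:0, a / b:]"
  using assms by (simp add: moebius_def diag2_def vector_2 to_fract_def eq_fract)

text \<open>Excludes constant generators when the definite description in \<open>gl2_act\<close> is
  evaluated.\<close>

lemma adjoin_const: "adjoin_ratfun (ratfun_const c) = range ratfun_const"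
proof
  have "field_closed (range (ratfun_const :: 'a::field \<Rightarrow> _))"
    unfolding field_closed_def
  proof (intro conjI ballI)
    fix x y :: "'a poly fract" assume "x \<in> range ratfun_const" "y \<in> range ratfun_const"
    then obtain a b where "x = ratfun_const a" "y = ratfun_const b" by blast
    then show "x + y \<in> range ratfun_const" "x * y \<in> range ratfun_const"
      using rangeI[of ratfun_const "a + b"] rangeI[of ratfun_const "a * b"] by simp_all
  next
    fix x :: "'a poly fract" assume "x \<in> range ratfun_const"
    then obtain a where "x = ratfun_const a" by blast
    then show "- x \<in> range ratfun_const" "inverse x \<in> range ratfun_const"
      using rangeI[of ratfun_const "- a"] rangeI[of ratfun_const "inverse a"]
      by (simp_all add: ratfun_const_inverse)
  qed (use rangeI[of ratfun_const 0] rangeI[of ratfun_const 1] in simp_all)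
  then show "adjoin_ratfun (ratfun_const c) \<subseteq> range ratfun_const" by (rule adjoin_ratfun_minimal) auto
qed (auto intro: adjoin_ratfun_closed)

lemma Fract_notin_const:
  assumes "(P, Q) \<in> coprime_pairs n" "n \<ge> 1"
  shows "Fract P Q \<notin> range ratfun_const"
proof
  assume "Fract P Q \<in> range ratfun_const"
  then obtain c where "ratfun_const (- c) + Fract P Q * ratfun_const 1 = 0" by auto
  from Fract_linear_indep(2)[OF coprime_pairs_indep[OF assms] this] show False by simp
qed

text \<open>The description ranges over all generators \<open>f\<close>. Such an \<open>f\<close> is
  nonconstant, has degree \<open>n\<close> because the degree of X over the field is unique, and
  yields the same plane; \<open>dilate\<close> acts on planes, so the result does not depend on
  \<open>f\<close>.\<close>

lemma gl2_act_diag2: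
  assumes ab: "a \<noteq> 0" "b \<noteq> 0" and PQ: "(P, Q) \<in> coprime_pairs n" and n: "n \<ge> 1"
  shows "gl2_act (diag2 a b) (adjoin_ratfun (Fract P Q)) =
    adjoin_ratfun (Fract (dilate (a / b) P) (dilate (a / b) Q))"
  unfolding gl2_act_def moebius_diag2[OF ab(2)]
proof (rule the_equality)
  have c: "a / b \<noteq> 0" using ab by simp
  have nz: "Q \<noteq> 0" using pair_indep_nonzero[OF coprime_pairs_indep[OF PQ n]] by simp
  show "\<exists>f. adjoin_ratfun (Fract P Q) = adjoin_ratfun f \<and>
      adjoin_ratfun (Fract (dilate (a / b) P) (dilate (a / b) Q)) =
      adjoin_ratfun (ratfun_compose f (to_fract [:0, a / b:]))"
    using ratfun_compose_dilate[OF c nz] by metis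
  fix G assume "\<exists>f. adjoin_ratfun (Fract P Q) = adjoin_ratfun f \<and>
      G = adjoin_ratfun (ratfun_compose f (to_fract [:0, a / b:]))"
  then obtain f where f: "adjoin_ratfun (Fract P Q) = adjoin_ratfun f"
    and G: "G = adjoin_ratfun (ratfun_compose f (to_fract [:0, a / b:]))" by blast
  have "f \<notin> range ratfun_const"
    using Fract_notin_const[OF PQ n] adjoin_ratfun_closed(2)[of "Fract P Q"] unfolding f
    by (auto simp: adjoin_const)
  then obtain k R S where k: "k \<ge> 1" "f = Fract R S" "(R, S) \<in> coprime_pairs k"
    using nonconst_coprime_rep by blast
  have "k = n"
    using alg_degree_adjoin_Fract[OF PQ n] alg_degree_adjoin_Fract[OF k(3,1)]
    unfolding f k(2) by (rule alg_degree_unique[rotated])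
  then have RS: "(R, S) \<in> coprime_pairs n" using k by simp
  have "S \<noteq> 0" using pair_indep_nonzero[OF coprime_pairs_indep[OF RS n]] by simp
  have "pair_span P Q = pair_span R S"
    using f adjoin_Fract_eq_iff[OF PQ RS n] unfolding k(2) by simp
  then have "adjoin_ratfun (Fract (dilate (a / b) P) (dilate (a / b) Q)) =
      adjoin_ratfun (Fract (dilate (a / b) R) (dilate (a / b) S))"
    using adjoin_Fract_eq_iff[OF dilate_coprime_pairs[OF c PQ] dilate_coprime_pairs[OF c RS] n]
    by (simp add: pair_span_dilate)
  then show "G = adjoin_ratfun (Fract (dilate (a / b) P) (dilate (a / b) Q))"
    unfolding G k(2) ratfun_compose_dilate[OF c \<open>S \<noteq> 0\<close>] by simp
qed

text \<open>Allows planes to be counted in place of fields: on pairs the two maps have the same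
  fibres.\<close>

lemma card_image_eq_card_image:
  assumes "\<And>x y. x \<in> A \<Longrightarrow> y \<in> A \<Longrightarrow> f x = f y \<longleftrightarrow> g x = g y"
  shows "card (f ` A) = card (g ` A)"
proof (rule bij_betw_same_card)
  have *: "g (inv_into A f (f x)) = g x" if "x \<in> A" for x
    using assms that by (metis f_inv_into_f imageI inv_into_into)
  show "bij_betw (\<lambda>z. g (inv_into A f z)) (f ` A) (g ` A)"
    unfolding bij_betw_def inj_on_def using assms * by (auto simp: image_image)
qed

definition invariant_pairs :: "'a::field \<Rightarrow> nat \<Rightarrow> ('a poly \<times> 'a poly) set" where
  "invariant_pairs c n =
    {(P, Q). (P, Q) \<in> coprime_pairs n \<and> pair_span (dilate c P) (dilate c Q) = pair_span P Q}"

lemma num_fixed_diag2: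
  fixes a b :: "'a::field"
  assumes ab: "a \<noteq> 0" "b \<noteq> 0" and n: "n \<ge> 1"
  shows "num_fixed n (diag2 a b) = card ((\<lambda>(P, Q). pair_span P Q) ` invariant_pairs (a / b) n)"
proof -
  have c: "a / b \<noteq> 0" using ab by simp
  let ?K = "\<lambda>(P, Q). adjoin_ratfun (Fract P Q)"
  have fix_iff: "gl2_act (diag2 a b) (adjoin_ratfun (Fract P Q)) = adjoin_ratfun (Fract P Q) \<longleftrightarrow>
      pair_span (dilate (a / b) P) (dilate (a / b) Q) = pair_span P Q"
    if "(P, Q) \<in> coprime_pairs n" for P Q
    unfolding gl2_act_diag2[OF ab that n] by (rule adjoin_Fract_eq_iff[OF dilate_coprime_pairs[OF c that] that n])
  have "{F \<in> subfields_of_index n. gl2_act (diag2 a b) F = F} = ?K ` invariant_pairs (a / b) n"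
  proof (intro equalityI subsetI)
    fix F assume F: "F \<in> {F \<in> subfields_of_index n. gl2_act (diag2 a b) F = F}"
    then obtain P Q where "(P, Q) \<in> coprime_pairs n" "F = adjoin_ratfun (Fract P Q)"
      using lueroth[of F n] by (auto simp: subfields_of_index_iff)
    then show "F \<in> ?K ` invariant_pairs (a / b) n"
      using F fix_iff by (auto simp: invariant_pairs_def)
  next
    fix F assume "F \<in> ?K ` invariant_pairs (a / b) n"
    then obtain P Q where "(P, Q) \<in> invariant_pairs (a / b) n" "F = adjoin_ratfun (Fract P Q)" by auto
    then show "F \<in> {F \<in> subfields_of_index n. gl2_act (diag2 a b) F = F}"
      using fix_iff alg_degree_adjoin_Fract[OF _ n]
      by (auto simp: invariant_pairs_def subfields_of_index_iff intro: adjoin_ratfun_closed)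
  qed
  then have "num_fixed n (diag2 a b) = card (?K ` invariant_pairs (a / b) n)"
    by (simp add: num_fixed_def)
  also have "\<dots> = card ((\<lambda>(P, Q). pair_span P Q) ` invariant_pairs (a / b) n)"
  proof (rule card_image_eq_card_image, clarify)
    fix P Q R S :: "'a poly"
    assume "(P, Q) \<in> invariant_pairs (a / b) n" "(R, S) \<in> invariant_pairs (a / b) n"
    then have "(P, Q) \<in> coprime_pairs n" "(R, S) \<in> coprime_pairs n"
      by (simp_all add: invariant_pairs_def)
    from adjoin_Fract_eq_iff[OF this n]
    show "adjoin_ratfun (Fract P Q) = adjoin_ratfun (Fract R S) \<longleftrightarrow> pair_span P Q = pair_span R S" .
  qed
  finally show ?thesis .
qed

lemma mult_order_finite_field:
  fixes x :: "'a::{field,finite}"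
  assumes "x \<noteq> 0"
  shows "mult_order x > 0" "x ^ k = 1 \<longleftrightarrow> mult_order x dvd k"
proof -
  interpret R: field "ring_of_type_algebra :: 'a ring" by (rule field_from_type_algebra)
  interpret G: group "mult_of (ring_of_type_algebra :: 'a ring)" 
    using R.field_mult_group
    by (simp add: Ring_Divisibility.mult_of_def Multiplicative_Group.mult_of_def)
  have x: "x \<in> carrier (mult_of (ring_of_type_algebra :: 'a ring))" using assms by simp
  have pow: "x [^]\<^bsub>mult_of (ring_of_type_algebra :: 'a ring)\<^esub> k = x ^ k" for k :: nat
    unfolding Ring_Divisibility.nat_pow_mult_of by (induction k) (simp_all add: mult.commute)
  show "x ^ k = 1 \<longleftrightarrow> mult_order x dvd k"
    using G.pow_eq_id[OF x, of k] unfolding pow mult_order_def by simp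
  have "finite (carrier (mult_of (ring_of_type_algebra :: 'a ring)))" by simp
  from G.ord_ge_1[OF this x] show "mult_order x > 0" unfolding mult_order_def by simp
qed

subsection \<open>Invariant planes\<close>

lemma pair_span_smult:
  assumes "a \<noteq> 0" "b \<noteq> 0"
  shows "pair_span (smult a P) (smult b Q) = pair_span P Q"
proof
  have "smult a P = smult a P + smult 0 Q" "smult b Q = smult 0 P + smult b Q" by simp_all
  then have "smult a P \<in> pair_span P Q" "smult b Q \<in> pair_span P Q" unfolding pair_span_def by blast+
  then show "pair_span (smult a P) (smult b Q) \<subseteq> pair_span P Q" by (simp add: pair_span_subset_iff)
  have "P = smult (1 / a) (smult a P) + smult 0 (smult b Q)" "Q = smult 0 (smult a P) + smult (1 / b) (smult b Q)"
    using assms by simp_all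
  then have "P \<in> pair_span (smult a P) (smult b Q)" "Q \<in> pair_span (smult a P) (smult b Q)"
    unfolding pair_span_def by blast+
  then show "pair_span P Q \<subseteq> pair_span (smult a P) (smult b Q)" by (simp add: pair_span_subset_iff)
qed

lemma pair_span_add_multiple: "pair_span P (Q + smult t P) = pair_span P Q"
proof
  have "Q + smult t P = smult t P + smult 1 Q" by simp
  then have "Q + smult t P \<in> pair_span P Q" unfolding pair_span_def by blast
  then show "pair_span P (Q + smult t P) \<subseteq> pair_span P Q" by (simp add: pair_span_subset_iff pair_span_mem)
  have "Q = smult (- t) P + smult 1 (Q + smult t P)" by simp
  then have "Q \<in> pair_span P (Q + smult t P)" unfolding pair_span_def by blast
  then show "pair_span P Q \<subseteq> pair_span P (Q + smult t P)" by (simp add: pair_span_subset_iff pair_span_mem)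
qed

lemma coprime_poly_mult_left:
  fixes a b c :: "'a::field poly"
  assumes "coprime a c" "coprime b c"
  shows "coprime (a * b) c"
proof -
  obtain u v u' v' where 1: "u * a + v * c = 1" and 2: "u' * b + v' * c = 1"
    using assms by (auto simp: coprime_poly_iff_bezout)
  have "(u * u') * (a * b) + (u * a * v' + v * (u' * b + v' * c)) * c = (u * a + v * c) * (u' * b + v' * c)"
    by (simp add: algebra_simps)
  also have "\<dots> = 1" unfolding 1 2 by simp
  finally show ?thesis unfolding coprime_poly_iff_bezout by blast
qed

lemma coprime_poly_dvd_left:
  fixes a b c :: "'a::field poly"
  assumes "coprime b c" "a dvd b"
  shows "coprime a c"
  using assms by (meson coprime_common_divisor coprimeI dvd_trans)

lemma X_dvd_iff: "[:0, 1:] dvd p \<longleftrightarrow> coeff p 0 = 0"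
  for p :: "'a::field poly"
  using poly_eq_0_iff_dvd[of p 0] by (simp add: poly_0_coeff_0)

lemma coprime_X_iff:
  fixes q :: "'a::field poly"
  shows "coprime [:0, 1:] q \<longleftrightarrow> coeff q 0 \<noteq> 0"
proof
  assume c: "coprime [:0, 1:] q"
  show "coeff q 0 \<noteq> 0"
  proof
    assume "coeff q 0 = 0"
    then have "[:0, 1:] dvd q" by (simp add: X_dvd_iff)
    with c dvd_refl have "is_unit [:0, 1 :: 'a:]" by (rule coprime_common_divisor)
    then show False by (simp add: is_unit_iff_degree)
  qed
next
  assume q: "coeff q 0 \<noteq> 0"
  obtain a r where "q = pCons a r" by (cases q)
  then have "(- smult (inverse a) r) * [:0, 1:] + [:inverse a:] * q = 1"
    using q by (simp add: one_pCons)
  then show "coprime [:0, 1:] q" unfolding coprime_poly_iff_bezout by blast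
qed

lemma coprime_X_mult_iff:
  fixes p q :: "'a::field poly"
  shows "coprime ([:0, 1:] * p) q \<longleftrightarrow> coprime p q \<and> coeff q 0 \<noteq> 0"
  unfolding coprime_X_iff[symmetric]
  using coprime_poly_mult_left[of "[:0, 1:]" q p] coprime_poly_dvd_left[of "[:0, 1:] * p" q]
  by (meson dvd_triv_left dvd_triv_right)

text \<open>\<open>spread d j p = X\<^sup>j p(X\<^sup>d)\<close>; for \<open>j < d\<close> these are the eigenvectors of \<open>X \<mapsto> cX\<close> for the eigenvalue \<open>c\<^sup>j\<close>,
  where \<open>d\<close> is the order of \<open>c\<close>.\<close>

definition spread :: "nat \<Rightarrow> nat \<Rightarrow> 'a::field poly \<Rightarrow> 'a poly" where
  "spread d j p = monom 1 j * pcompose p (monom 1 d)"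

lemma coeff_pcompose_monom:
  fixes p :: "'a::field poly"
  assumes "d > 0"
  shows "coeff (pcompose p (monom 1 d)) k = (if d dvd k then coeff p (k div d) else 0)"
proof (induction p arbitrary: k)
  case 0 then show ?case by simp
next
  case (pCons a p)
  show ?case
  proof (cases "k < d")
    case True
    then have "d dvd k \<longleftrightarrow> k = 0" by (auto dest: nat_dvd_not_less)
    then show ?thesis using True assms by (auto simp: pcompose_pCons coeff_monom_mult coeff_pCons split: nat.split)
  next
    case False
    then have "k div d = Suc ((k - d) div d)" "d dvd k - d \<longleftrightarrow> d dvd k" "k > 0"
      using assms by (auto simp: le_div_geq dvd_minus_self)
    then show ?thesis using False pCons.IH[of "k - d"]
      by (simp add: pcompose_pCons coeff_monom_mult coeff_pCons split: nat.split)
  qed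
qed

lemma coeff_spread:
  assumes "j < d"
  shows "coeff (spread d j p) k = (if k mod d = j then coeff p (k div d) else 0)"
proof (cases "k < j")
  case True
  then show ?thesis using assms by (simp add: spread_def coeff_monom_mult)
next
  case False
  define t where "t = k - j"
  have k: "k = t + j" using False by (simp add: t_def)
  have "d dvd t \<longleftrightarrow> (t + j) mod d = j"
  proof
    assume "(t + j) mod d = j"
    then show "d dvd t" using dvd_minus_mod[of d "t + j"] by simp
  qed (use assms in auto)
  moreover have "(t + j) div d = t div d" if "d dvd t" using that assms by (auto elim!: dvdE)
  ultimately show ?thesis using assms
    by (simp add: spread_def coeff_monom_mult k coeff_pcompose_monom)
qed

lemma coeff_spread_same: "j < d \<Longrightarrow> coeff (spread d j p) (d * k + j) = coeff p k"
  by (simp add: coeff_spread)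

lemma spread_hom:
  "spread d j (smult a p) = smult a (spread d j p)" "spread d j (p + r) = spread d j p + spread d j r"
  by (simp_all add: spread_def pcompose_smult pcompose_add algebra_simps)

lemma spread_inj: "j < d \<Longrightarrow> spread d j p = spread d j r \<Longrightarrow> p = r"
  by (metis coeff_spread_same poly_eqI)

lemma spread_eq_0_iff: "j < d \<Longrightarrow> spread d j p = 0 \<longleftrightarrow> p = 0"
  using spread_inj[of j d p 0] by (auto simp: spread_def)

lemma degree_spread:
  assumes "j < d" "p \<noteq> 0"
  shows "degree (spread d j p) = d * degree p + j"
proof (rule antisym)
  show "degree (spread d j p) \<le> d * degree p + j"
  proof (rule degree_le, intro allI impI)
    fix k assume k: "d * degree p + j < k"
    show "coeff (spread d j p) k = 0"
    proof (cases "k mod d = j")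
      case True
      then have "k = d * (k div d) + j" by (metis mult_div_mod_eq)
      then have "degree p < k div d" using k by (metis add_less_cancel_right nat_mult_less_cancel1 zero_less_iff_neq_zero assms(1) not_less_zero)
      then show ?thesis using assms by (simp add: coeff_spread coeff_eq_0)
    qed (use assms in \<open>simp add: coeff_spread\<close>)
  qed
  show "d * degree p + j \<le> degree (spread d j p)"
    using assms by (intro le_degree) (simp add: coeff_spread_same)
qed

lemma spreadI:
  assumes j: "j < d" and w: "\<And>k. coeff w k \<noteq> 0 \<Longrightarrow> k mod d = j"
  shows "\<exists>p. w = spread d j p"
proof -
  \<comment> \<open>Every d-th coefficient is read off, starting at \<open>j\<close>;
    \<open>Suc (degree w)\<close> entries suffice because k \<le> d k.\<close>
  let ?p = "Poly (map (\<lambda>k. coeff w (d * k + j)) [0..<Suc (degree w)])"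
  have cp: "coeff ?p k = coeff w (d * k + j)" for k
  proof (cases "k < Suc (degree w)")
    case False
    have "k \<le> d * k" using j by (cases d) auto
    then have "degree w < d * k + j" using False by linarith
    then show ?thesis using False by (simp add: nth_default_def coeff_eq_0 del: upt_Suc)
  qed (simp add: nth_default_def del: upt_Suc)
  have "coeff w k = coeff (spread d j ?p) k" for k
  proof (cases "k mod d = j")
    case True
    then have "k = d * (k div d) + j" by (metis mult_div_mod_eq)
    then show ?thesis using True cp[of "k div d"] unfolding coeff_spread[OF j] by simp
  next
    case False
    then show ?thesis using w[of k] unfolding coeff_spread[OF j] by auto
  qed
  then have "w = spread d j ?p" by (rule poly_eqI)
  then show ?thesis by blast
qed

text \<open>A Bezout equation survives X \<mapsto> X^d; conversely a common divisor \<open>r\<close>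
  yields the common divisor r(X^d), a unit only if \<open>r\<close> is constant.\<close>

lemma coprime_spread_iff:
  fixes P Q :: "'a::field poly"
  assumes "d > 0"
  shows "coprime (spread d 0 P) (spread d 0 Q) \<longleftrightarrow> coprime P Q"
proof
  have s: "spread d 0 p = pcompose p (monom 1 d)" for p :: "'a poly" by (simp add: spread_def)
  show "coprime (spread d 0 P) (spread d 0 Q)" if "coprime P Q"
  proof -
    obtain u v where "u * P + v * Q = 1" using \<open>coprime P Q\<close> by (auto simp: coprime_poly_iff_bezout)
    then have "spread d 0 u * spread d 0 P + spread d 0 v * spread d 0 Q = 1"
      unfolding s by (metis pcompose_1 pcompose_add pcompose_mult)
    then show ?thesis unfolding coprime_poly_iff_bezout by blast
  qed
  assume c: "coprime (spread d 0 P) (spread d 0 Q)"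
  show "coprime P Q"
  proof (rule coprimeI)
    fix r assume "r dvd P" "r dvd Q"
    then have "spread d 0 r dvd spread d 0 P" "spread d 0 r dvd spread d 0 Q"
      unfolding s dvd_def by (auto simp: pcompose_mult)
    with c have u: "is_unit (spread d 0 r)" by (rule coprime_common_divisor)
    then have "r \<noteq> 0" using assms by (metis not_is_unit_0 spread_eq_0_iff)
    moreover have "spread d 0 r \<noteq> 0" using u by auto
    ultimately show "is_unit r" using u assms by (simp add: is_unit_iff_degree degree_spread)
  qed
qed

text \<open>For j > 0 the factor X^j adds just the condition that X does not divide Q(X^d), that is
  Q(0) \<noteq> 0.\<close>

lemma coprime_spread_X_iff:
  fixes P Q :: "'a::field poly"
  assumes j: "0 < j" "j < d"
  shows "coprime (spread d j P) (spread d 0 Q) \<longleftrightarrow> coprime P Q \<and> coeff Q 0 \<noteq> 0"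
proof -
  let ?Q = "spread d 0 Q"
  have d: "0 < d" using j by simp
  have s: "spread d j P = [:0, 1:] ^ j * spread d 0 P"
    by (simp add: spread_def monom_altdef)
  have "coprime (spread d j P) ?Q \<longleftrightarrow> coprime [:0, 1:] ?Q \<and> coprime (spread d 0 P) ?Q"
  proof
    assume *: "coprime (spread d j P) ?Q"
    have "[:0, 1:] dvd spread d j P" unfolding s using j by (intro dvd_mult2 dvd_power) simp
    then show "coprime [:0, 1:] ?Q \<and> coprime (spread d 0 P) ?Q"
      using * coprime_poly_dvd_left unfolding s by (metis dvd_triv_right)
  next
    assume *: "coprime [:0, 1:] ?Q \<and> coprime (spread d 0 P) ?Q"
    have "coprime ([:0, 1:] ^ k * spread d 0 P) ?Q" for k
    proof (induction k)
      case (Suc k)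
      then show ?case using * coprime_poly_mult_left[of "[:0, 1:]" ?Q] by (simp only: power_Suc mult.assoc)
    qed (use * in simp)
    then show "coprime (spread d j P) ?Q" unfolding s by blast
  qed
  then show ?thesis using d by (auto simp: coprime_X_iff coprime_spread_iff coeff_spread)
qed

section \<open>Normal forms of bases\<close>

definition reduced_pairs :: "nat \<Rightarrow> ('a::field poly \<times> 'a poly) set" where
  "reduced_pairs m = {(P, Q). lead_coeff P = 1 \<and> lead_coeff Q = 1 \<and> degree P < m \<and> degree Q = m \<and>
     coprime P Q \<and> coeff Q (degree P) = 0}"

text \<open>(P, Q) stands for the pair X^j P(X^d), Q(X^d): the maximum is the degree of that pair,
  and Q(0) \<noteq> 0 is coprimality to X^j.\<close>

definition eigen_pairs :: "nat \<Rightarrow> nat \<Rightarrow> nat \<Rightarrow> ('a::field poly \<times> 'a poly) set" where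
  "eigen_pairs d n j = {(P, Q). lead_coeff P = 1 \<and> lead_coeff Q = 1 \<and> coprime P Q \<and> coeff Q 0 \<noteq> 0 \<and>
     max (d * degree P + j) (d * degree Q) = n}"

lemma reduced_pairs_coprime: "PQ \<in> reduced_pairs m \<Longrightarrow> PQ \<in> coprime_pairs m"
  by (auto simp: reduced_pairs_def coprime_pairs_def)

text \<open>Gaussian elimination with the powers of X in descending order as columns:
  \<open>reduced_pairs\<close> is the reduced echelon form, with pivot \<open>m\<close> for Q, a
  smaller pivot for P, and Q cleared at the pivot of P.\<close>

lemma reduced_basis_exists:
  assumes PQ: "(P, Q) \<in> coprime_pairs m" and m: "m \<ge> 1"
  shows "\<exists>R S. (R, S) \<in> reduced_pairs m \<and> pair_span R S = pair_span P Q"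
proof -
  have "\<exists>P1 Q1. degree Q1 = m \<and> pair_span P1 Q1 = pair_span P Q"
  proof (cases "degree Q = m")
    case False
    then have "degree P = m" using PQ by (auto simp: coprime_pairs_def max_def split: if_splits)
    then show ?thesis using pair_span_swap by blast
  qed blast
  then obtain P1 Q1 where 1: "degree Q1 = m" "pair_span P1 Q1 = pair_span P Q" by blast
  then have "Q1 \<noteq> 0" using m by auto
  define S1 where "S1 = smult (inverse (lead_coeff Q1)) Q1"
  have S1: "degree S1 = m" "lead_coeff S1 = 1" using 1 \<open>Q1 \<noteq> 0\<close> by (auto simp: S1_def)
  define P2 where "P2 = P1 + smult (- coeff P1 m) S1"
  have span2: "pair_span P2 S1 = pair_span P Q"
    using pair_span_add_multiple[of S1 P1 "- coeff P1 m"]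
      pair_span_smult[of "inverse (lead_coeff Q1)" 1 Q1 P1] \<open>Q1 \<noteq> 0\<close> 1(2)
    unfolding P2_def S1_def by (simp add: pair_span_swap[of _ P1] pair_span_swap[of _ "P1 + _"] pair_span_swap[of "smult _ _"])
  then have "(P2, S1) \<in> coprime_pairs m" using coprime_pairs_span_cong[OF _ PQ] by simp
  then have P20: "P2 \<noteq> 0" and le: "degree P2 \<le> m"
    using pair_indep_nonzero[OF coprime_pairs_indep[OF _ m]] by (auto simp: coprime_pairs_def)
  have "coeff P2 m = 0" using S1 by (simp add: P2_def)
  then have "degree P2 < m" using le P20 by (metis le_neq_implies_less leading_coeff_0_iff)
  define R where "R = smult (inverse (lead_coeff P2)) P2"
  have R: "degree R < m" "lead_coeff R = 1" using P20 \<open>degree P2 < m\<close> by (auto simp: R_def)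
  define S where "S = S1 + smult (- coeff S1 (degree R)) R"
  have dS: "degree S = m"
    unfolding S_def using S1 R(1) by (subst degree_add_eq_left) (auto intro: le_less_trans[OF degree_smult_le])
  moreover have "lead_coeff S = 1" unfolding dS using S1 R(1) by (simp add: S_def coeff_eq_0)
  moreover have "coeff S (degree R) = 0" using R(2) by (simp add: S_def)
  moreover have span: "pair_span R S = pair_span P Q"
    unfolding S_def pair_span_add_multiple R_def
    using pair_span_smult[of "inverse (lead_coeff P2)" 1 P2 S1] P20 span2 by simp
  moreover have "coprime R S" using coprime_pairs_span_cong[OF span[symmetric] PQ] by (simp add: coprime_pairs_def)
  ultimately show ?thesis using R by (auto simp: reduced_pairs_def)
qed

text \<open>The coefficients at the two pivots determine all four scalars of the change of
  basis.\<close>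

lemma reduced_basis_unique:
  assumes PQ: "(P, Q) \<in> reduced_pairs m" and RS: "(R, S) \<in> reduced_pairs m"
    and eq: "pair_span P Q = pair_span R S"
  shows "P = R \<and> Q = S"
proof -
  note r = PQ[unfolded reduced_pairs_def] RS[unfolded reduced_pairs_def]
  have "P \<in> pair_span R S" "Q \<in> pair_span R S" using eq pair_span_mem by blast+
  then obtain a b c e where P: "P = smult a R + smult b S" and Q: "Q = smult c R + smult e S"
    unfolding pair_span_def by blast
  have "coeff P m = b" "coeff Q m = e"
    unfolding P Q using r by (auto simp: coeff_eq_0)
  then have b: "b = 0" and e: "e = 1" using r by (auto simp: coeff_eq_0)
  have "P = smult a R" using P b by simp
  then have "lead_coeff P = a * lead_coeff R" by (simp only: lead_coeff_smult)
  then have "a = 1" using r by simp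
  then have PR: "P = R" using P b by simp
  have "coeff Q (degree R) = c + e * coeff S (degree R)" unfolding Q using r by simp
  then have "c = 0" using r PR by simp
  then show ?thesis using PR Q e by simp
qed

section \<open>Eigenspace decomposition of invariant planes\<close>

context
  fixes c :: "'a::field" and d :: nat
  assumes d: "d > 0" and ord: "\<And>k. c ^ k = 1 \<longleftrightarrow> d dvd k"
begin

lemma power_mod_order: "c ^ k = c ^ (k mod d)"
proof -
  have "c ^ k = (c ^ d) ^ (k div d) * c ^ (k mod d)"
    by (simp flip: power_mult power_add)
  then show ?thesis using ord[of d] by simp
qed

text \<open>The eigenvalues c^j with j < d are distinct, which is what separates the
  eigenspaces.\<close>

lemma power_eq_below_order:
  assumes "c ^ i = c ^ j" "i < d" "j < d"
  shows "i = j"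
proof -
  have c0: "c \<noteq> 0" using ord[of d] d by (metis dvd_refl power_0_left less_irrefl zero_neq_one)
  have *: "i = j" if "c ^ i = c ^ j" "i \<le> j" "j < d" for i j
  proof -
    have "c ^ (i + (j - i)) = c ^ j" using that(2) by simp
    then have "c ^ i * c ^ (j - i) = c ^ i * 1" unfolding power_add using that(1) by simp
    then have "c ^ (j - i) = 1" using c0 by simp
    then have "d dvd j - i" using ord by simp
    moreover have "j - i < d" using that(3) by simp
    ultimately have "j - i = 0" using nat_dvd_not_less by blast
    then show ?thesis using that(2) by simp
  qed
  show ?thesis using *[of i j] *[of j i] assms by (metis le_cases)
qed

lemma dilate_spread: "j < d \<Longrightarrow> dilate c (spread d j p) = smult (c ^ j) (spread d j p)"
  by (rule poly_eqI) (use power_mod_order in \<open>auto simp: coeff_spread\<close>)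

text \<open>The operator \<open>\<Prod>i\<noteq>j. (\<sigma> - c\<^sup>i)\<close>, with \<open>\<sigma>\<close> the substitution \<open>X \<mapsto> cX\<close>, projects onto the \<open>j\<close>-th eigenspace.\<close>

lemma eigen_component_in_span:
  assumes inv: "\<And>w. w \<in> pair_span P Q \<Longrightarrow> dilate c w \<in> pair_span P Q"
    and w: "w \<in> pair_span P Q" and j: "j < d"
  shows "\<exists>v\<in>pair_span P Q. \<forall>k. coeff v k = (if k mod d = j then coeff w k else 0)"
proof -
  have prod: "\<exists>v\<in>pair_span P Q. \<forall>k. coeff v k = (\<Prod>i\<in>I. c ^ k - c ^ i) * coeff w k" if "finite I" for I
    using that
  proof (induction I rule: finite_induct)
    case empty
    then show ?case using w by auto
  next
    case (insert i I)
    then obtain v where v: "v \<in> pair_span P Q" "\<And>k. coeff v k = (\<Prod>i\<in>I. c ^ k - c ^ i) * coeff w k" by blast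
    have "smult 1 (dilate c v) + smult (- (c ^ i)) v \<in> pair_span P Q"
      by (intro pair_span_closed inv v)
    then show ?case
      by (rule bexI[rotated]) (use insert v(2) in \<open>simp add: algebra_simps\<close>)
  qed
  \<comment> \<open>\<open>e\<close> is the scalar by which the operator acts on the j-th
    eigenspace; dividing by it makes the operator a projection.\<close>
  define e where "e = (\<Prod>i\<in>{..<d} - {j}. c ^ j - c ^ i)"
  obtain v where v: "v \<in> pair_span P Q" "\<And>k. coeff v k = (\<Prod>i\<in>{..<d} - {j}. c ^ k - c ^ i) * coeff w k"
    using prod[of "{..<d} - {j}"] by auto
  have e: "e \<noteq> 0"
    unfolding e_def using power_eq_below_order j by (auto simp: prod_zero_iff)
  have "(\<Prod>i\<in>{..<d} - {j}. c ^ k - c ^ i) = (if k mod d = j then e else 0)" for k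
  proof (cases "k mod d = j")
    case True
    then have "c ^ k = c ^ j" using power_mod_order[of k] by simp
    then show ?thesis using True by (simp add: e_def)
  next
    case False
    have "k mod d \<in> {..<d} - {j}" using False d by simp
    moreover have "c ^ k - c ^ (k mod d) = 0" using power_mod_order[of k] by simp
    ultimately have "(\<Prod>i\<in>{..<d} - {j}. c ^ k - c ^ i) = 0" by (intro prod_zero) auto
    then show ?thesis using False by simp
  qed
  then have "\<forall>k. coeff (smult (1 / e) v + smult 0 v) k = (if k mod d = j then coeff w k else 0)"
    using e v(2) by simp
  moreover have "smult (1 / e) v + smult 0 v \<in> pair_span P Q" by (rule pair_span_closed[OF v(1) v(1)])
  ultimately show ?thesis by blast
qed

lemma invariant_spans:
  assumes n: "n \<ge> 1"
  shows "(\<lambda>(P, Q). pair_span P Q) ` invariant_pairs c n =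
    (if d dvd n then (\<lambda>(P, Q). pair_span (spread d 0 P) (spread d 0 Q)) ` reduced_pairs (n div d) else {}) \<union>
    (\<lambda>(j, P, Q). pair_span (spread d j P) (spread d 0 Q)) ` (SIGMA j:{1..<d}. eigen_pairs d n j)"
    (is "?W = ?A \<union> ?B")
proof (intro equalityI subsetI)
  fix W assume "W \<in> ?W"
  then obtain P Q where PQ: "(P, Q) \<in> coprime_pairs n" and W: "W = pair_span P Q"
    and "pair_span (dilate c P) (dilate c Q) = pair_span P Q" by (auto simp: invariant_pairs_def)
  then have inv: "dilate c w \<in> pair_span P Q" if "w \<in> pair_span P Q" for w
    using that unfolding pair_span_dilate by blast
  show "W \<in> ?A \<union> ?B"
  proof (cases "\<forall>w\<in>W. \<forall>k. coeff w k \<noteq> 0 \<longrightarrow> k mod d = 0")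
    case True
    \<comment> \<open>Only eigenvalue 1 occurs: in the variable X^d this is an arbitrary plane of
      degree n / d.\<close>
    then obtain P1 Q1 where P1: "P = spread d 0 P1" "Q = spread d 0 Q1"
      using spreadI[of 0 d P] spreadI[of 0 d Q] d pair_span_mem unfolding W by blast
    have nz: "P1 \<noteq> 0" "Q1 \<noteq> 0"
      using pair_indep_nonzero[OF coprime_pairs_indep[OF PQ n]] d unfolding P1 by (auto simp: spread_eq_0_iff)
    define m where "m = max (degree P1) (degree Q1)"
    have nm: "n = d * m"
      using PQ d nz unfolding P1 m_def by (auto simp: coprime_pairs_def degree_spread nat_mult_max_right)
    then have "(P1, Q1) \<in> coprime_pairs m" "m \<ge> 1"
      using PQ d n unfolding P1 by (auto simp: coprime_pairs_def coprime_spread_iff m_def intro: Suc_leI)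
    then obtain R S where RS: "(R, S) \<in> reduced_pairs m" "pair_span R S = pair_span P1 Q1"
      using reduced_basis_exists by blast
    have sp: "pair_span (spread d 0 A) (spread d 0 B) = spread d 0 ` pair_span A B" for A B :: "'a poly"
    proof -
      have "smult a (spread d 0 A) + smult b (spread d 0 B) = spread d 0 (smult a A + smult b B)" for a b
        by (simp add: spread_hom)
      then show ?thesis unfolding pair_span_def by auto
    qed
    have "W = pair_span (spread d 0 R) (spread d 0 S)" unfolding W P1 sp RS(2) ..
    then have "W \<in> ?A" using RS(1) nm d by force
    then show ?thesis by blast
  next
    case False
    then obtain w k where w: "w \<in> W" "coeff w k \<noteq> 0" "k mod d \<noteq> 0" by blast
    define j where "j = k mod d"
    have j: "0 < j" "j < d" using w d by (auto simp: j_def)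
    obtain v where v: "v \<in> pair_span P Q" "\<And>k. coeff v k = (if k mod d = j then coeff w k else 0)"
      using eigen_component_in_span[OF inv w(1)[unfolded W] j(2)] by blast
    have "coeff v k \<noteq> 0" using v(2) w by (simp add: j_def)
    then have "v \<noteq> 0" by auto
    obtain R where R: "v = spread d j R" using spreadI[OF j(2), of v] v(2) by metis
    have "coeff P 0 \<noteq> 0 \<or> coeff Q 0 \<noteq> 0"
    proof (rule ccontr)
      assume "\<not> ?thesis"
      then have X: "[:0, 1:] dvd P" "[:0, 1:] dvd Q"
        by (simp_all add: X_dvd_iff)
      have "coprime P Q" using PQ by (simp add: coprime_pairs_def)
      then have "is_unit [:0, 1 :: 'a:]" using X by (rule coprime_common_divisor)
      then show False by (simp add: is_unit_iff_degree)
    qed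
    \<comment> \<open>The component of \<open>w'\<close> on exponents divisible by \<open>d\<close>
      keeps the constant term, so it is a nonzero eigenvector for eigenvalue 1.\<close>
    then obtain w' where w': "w' \<in> pair_span P Q" "coeff w' 0 \<noteq> 0" using pair_span_mem by blast
    obtain u where u: "u \<in> pair_span P Q" "\<And>k. coeff u k = (if k mod d = 0 then coeff w' k else 0)"
      using eigen_component_in_span[OF inv w'(1) d] by blast
    have "coeff u 0 \<noteq> 0" using u(2) w' by simp
    then have "u \<noteq> 0" by auto
    obtain S where S: "u = spread d 0 S" using spreadI[OF d, of u] u(2) by metis
    have "pair_indep v u"
      unfolding pair_indep_def
    proof (intro allI impI)
      fix a b assume 0: "smult a v + smult b u = 0"
      \<comment> \<open>The exponents k and 0 lie in different residue classes: \<open>u\<close>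
        vanishes at the first and \<open>v\<close> at the second, which isolates each
        scalar.\<close>
      have "a * coeff v k + b * coeff u k = 0" for k
        using arg_cong[OF 0, of "\<lambda>p. coeff p k"] by simp
      moreover have "coeff u k = 0" using u(2) w by simp
      moreover have "coeff v 0 = 0" using v(2) j by simp
      ultimately show "a = 0 \<and> b = 0"
        using \<open>coeff v k \<noteq> 0\<close> \<open>coeff u 0 \<noteq> 0\<close>
        by (metis add_cancel_left_left add_cancel_right_right mult_eq_0_iff)
    qed
    then have span1: "pair_span v u = pair_span P Q" by (rule pair_span_basis[OF v(1) u(1)])
    have nz: "R \<noteq> 0" "S \<noteq> 0" using \<open>v \<noteq> 0\<close> \<open>u \<noteq> 0\<close> d j unfolding R S by (auto simp: spread_eq_0_iff)
    define R1 S1 where "R1 = smult (inverse (lead_coeff R)) R" and "S1 = smult (inverse (lead_coeff S)) S"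
    have lc: "lead_coeff R1 = 1" "lead_coeff S1 = 1" using nz by (auto simp: R1_def S1_def)
    then have nz1: "R1 \<noteq> 0" "S1 \<noteq> 0" by auto
    have span: "pair_span (spread d j R1) (spread d 0 S1) = pair_span P Q"
      unfolding R1_def S1_def spread_hom using nz by (subst pair_span_smult) (auto simp: span1 R[symmetric] S[symmetric])
    have "(spread d j R1, spread d 0 S1) \<in> coprime_pairs n"
      by (rule coprime_pairs_span_cong[OF span[symmetric] PQ])
    then have "(R1, S1) \<in> eigen_pairs d n j"
      using lc nz1 j d by (auto simp: coprime_pairs_def eigen_pairs_def coprime_spread_X_iff degree_spread)
    then have "(j, R1, S1) \<in> (SIGMA j:{1..<d}. eigen_pairs d n j)" using j by simp
    then have "W \<in> ?B" unfolding W span[symmetric] by force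
    then show ?thesis by blast
  qed
next
  \<comment> \<open>Conversely \<open>dilate\<close> only rescales two eigenvectors by nonzero
    powers of \<open>c\<close>, so their plane is invariant.\<close>
  have inv: "W \<in> ?W" if "(spread d i P, spread d j Q) \<in> coprime_pairs n" "i < d" "j < d"
    "W = pair_span (spread d i P) (spread d j Q)" for W P Q i j
  proof -
    have "c \<noteq> 0" using ord[of d] d by (metis dvd_refl power_0_left less_irrefl zero_neq_one)
    then show ?thesis using that
      by (auto simp: invariant_pairs_def dilate_spread pair_span_smult
          intro!: image_eqI[of _ _ "(spread d i P, spread d j Q)"])
  qed
  fix W assume "W \<in> ?A \<union> ?B"
  then show "W \<in> ?W"
  proof
    assume "W \<in> ?A"
    then obtain P Q where *: "d dvd n" "(P, Q) \<in> reduced_pairs (n div d)"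
      "W = pair_span (spread d 0 P) (spread d 0 Q)" by (auto split: if_splits)
    from *(2) have PQ: "(P, Q) \<in> coprime_pairs (n div d)" by (rule reduced_pairs_coprime)
    have "n div d \<ge> 1" 
      using dvd_imp_le[OF *(1)] n d by (simp add: Suc_le_eq div_greater_zero_iff)
    then have nz: "P \<noteq> 0" "Q \<noteq> 0" using pair_indep_nonzero[OF coprime_pairs_indep[OF PQ]] by auto
    have "(spread d 0 P, spread d 0 Q) \<in> coprime_pairs n"
      using PQ nz d *(1) by (auto simp: coprime_pairs_def coprime_spread_iff degree_spread simp flip: nat_mult_max_right)
    then show ?thesis using inv[OF _ d d *(3)] by blast
  next
    assume "W \<in> ?B"
    then obtain j P Q where *: "1 \<le> j" "j < d" "(P, Q) \<in> eigen_pairs d n j"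
      "W = pair_span (spread d j P) (spread d 0 Q)" by auto
    have nz: "P \<noteq> 0" "Q \<noteq> 0" using *(3) by (auto simp: eigen_pairs_def)
    have "(spread d j P, spread d 0 Q) \<in> coprime_pairs n"
      using * nz d by (auto simp: coprime_pairs_def eigen_pairs_def coprime_spread_X_iff degree_spread)
    then show ?thesis using inv[OF _ *(2) d *(4)] by blast
  qed
qed

end

lemma spread_zero_residue:
  assumes "d > 0" "x \<in> pair_span (spread d 0 P) (spread d 0 Q)" "k mod d \<noteq> 0"
  shows "coeff x k = 0"
  using assms by (auto simp: pair_span_def coeff_spread)

lemma inj_on_reduced:
  assumes "d > 0"
  shows "inj_on (\<lambda>(P, Q). pair_span (spread d 0 P) (spread d 0 Q)) (reduced_pairs m)"
proof (rule inj_onI, clarify)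
  fix P Q R S :: "'a poly"
  assume *: "(P, Q) \<in> reduced_pairs m" "(R, S) \<in> reduced_pairs m"
    and eq: "pair_span (spread d 0 P) (spread d 0 Q) = pair_span (spread d 0 R) (spread d 0 S)"
  have sub: "pair_span A B \<subseteq> pair_span A' B'"
    if "pair_span (spread d 0 A) (spread d 0 B) \<subseteq> pair_span (spread d 0 A') (spread d 0 B')"
    for A B A' B' :: "'a poly"
  proof -
    have "C \<in> pair_span A' B'" if C: "spread d 0 C \<in> pair_span (spread d 0 A') (spread d 0 B')" for C
    proof -
      obtain a b where "spread d 0 C = spread d 0 (smult a A' + smult b B')"
        using C unfolding pair_span_def by (auto simp: spread_hom)
      then have "C = smult a A' + smult b B'" by (rule spread_inj[OF assms])
      then show ?thesis unfolding pair_span_def by blast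
    qed
    then show ?thesis using that by (simp add: pair_span_subset_iff)
  qed
  have "pair_span P Q = pair_span R S" using sub[of P Q R S] sub[of R S P Q] eq by simp
  from reduced_basis_unique[OF * this] show "P = R \<and> Q = S" .
qed

text \<open>Such a plane determines its two eigenlines, and monicity fixes the generator of
  each.\<close>

lemma inj_on_eigen:
  assumes "d > 0"
  shows "inj_on (\<lambda>(j, P, Q). pair_span (spread d j P) (spread d 0 Q)) (SIGMA j:{1..<d}. eigen_pairs d n j)"
proof (rule inj_onI, clarify)
  fix i j and P Q R S :: "'a poly"
  assume i: "i \<in> {1..<d}" and j: "j \<in> {1..<d}" and PQ: "(P, Q) \<in> eigen_pairs d n i" and RS: "(R, S) \<in> eigen_pairs d n j"
    and eq: "pair_span (spread d i P) (spread d 0 Q) = pair_span (spread d j R) (spread d 0 S)"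
  note r = PQ[unfolded eigen_pairs_def] RS[unfolded eigen_pairs_def]
  have nz: "P \<noteq> 0" "Q \<noteq> 0" using r by auto
  have "spread d i P \<in> pair_span (spread d j R) (spread d 0 S)" "spread d 0 Q \<in> pair_span (spread d j R) (spread d 0 S)"
    using eq pair_span_mem by blast+
  then obtain a b a' b' where P: "spread d i P = smult a (spread d j R) + smult b (spread d 0 S)"
    and Q: "spread d 0 Q = smult a' (spread d j R) + smult b' (spread d 0 S)"
    unfolding pair_span_def by blast
  have cP: "coeff (spread d i P) k = a * coeff (spread d j R) k + b * coeff (spread d 0 S) k"
    and cQ: "coeff (spread d 0 Q) k = a' * coeff (spread d j R) k + b' * coeff (spread d 0 S) k" for k
    unfolding P Q by simp_all
  \<comment> \<open>At exponent 0 the vectors with factors X^i and X^j vanish, while S(0) \<noteq>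
    0.\<close>
  have "b = 0"
    using cP[of 0] i j r by (simp add: coeff_spread)
  have ij: "i = j"
  proof (rule ccontr)
    assume "i \<noteq> j"
    have "coeff (spread d i P) (d * degree P + i) = 0"
      unfolding cP using i j \<open>i \<noteq> j\<close> by (simp add: coeff_spread)
    then show False using i nz by (simp add: coeff_spread_same)
  qed
  have "spread d j P = spread d j (smult a R)" using P \<open>b = 0\<close> ij by (simp add: spread_hom)
  then have PaR: "P = smult a R" using spread_inj[of j d P "smult a R"] j by auto
  then have "lead_coeff P = a * lead_coeff R" by (simp only: lead_coeff_smult)
  then have "a = 1" using r by simp
  have "coeff Q k = b' * coeff S k" for k
    using cQ[of "d * k"] j assms by (simp add: coeff_spread)
  then have QS: "Q = smult b' S" by (intro poly_eqI) simp
  then have "lead_coeff Q = b' * lead_coeff S" by (simp only: lead_coeff_smult)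
  then have "b' = 1" using r by simp
  then have "Q = S" using QS by simp
  then show "i = j \<and> (P, Q) = (R, S)" using ij PaR \<open>a = 1\<close> by simp
qed

lemma reduced_eigen_disjoint:
  assumes "d > 0"
  shows "(\<lambda>(P, Q). pair_span (spread d 0 P) (spread d 0 Q)) ` reduced_pairs m \<inter>
    (\<lambda>(j, P, Q). pair_span (spread d j P) (spread d 0 Q)) ` (SIGMA j:{1..<d}. eigen_pairs d n j) = {}"
  unfolding disjoint_iff
proof (intro allI impI notI)
  fix W assume W: "W \<in> (\<lambda>(P, Q). pair_span (spread d 0 P) (spread d 0 Q)) ` reduced_pairs m"
    "W \<in> (\<lambda>(j, P, Q). pair_span (spread d j P) (spread d 0 Q)) ` (SIGMA j:{1..<d}. eigen_pairs d n j)"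
  obtain P Q where "W = pair_span (spread d 0 P) (spread d 0 Q)" using W(1) by auto
  moreover obtain j R S where j: "j \<in> {1..<d}" and RS: "(R, S) \<in> eigen_pairs d n j"
    and "W = pair_span (spread d j R) (spread d 0 S)" using W(2) by auto
  ultimately have eq: "pair_span (spread d 0 P) (spread d 0 Q) = pair_span (spread d j R) (spread d 0 S)"
    by simp
  have "spread d j R \<in> pair_span (spread d 0 P) (spread d 0 Q)" unfolding eq by (rule pair_span_mem)
  from spread_zero_residue[OF assms this, of "d * degree R + j"]
  have "lead_coeff R = 0" using j by (simp add: coeff_spread_same)
  then show False using RS by (auto simp: eigen_pairs_def)
qed

subsection \<open>Counting coprime pairs\<close>

text \<open>Stated by coefficients so that m = 0 gives {0} and the cardinality q^m is valid for
  every \<open>m\<close>.\<close>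

definition polys_below :: "nat \<Rightarrow> 'a::zero poly set" where
  "polys_below m = {p. \<forall>i\<ge>m. coeff p i = 0}"

definition monics :: "nat \<Rightarrow> 'a::field poly set" where
  "monics m = {p. lead_coeff p = 1 \<and> degree p = m}"

lemma polys_below_iff: "p \<in> polys_below m \<longleftrightarrow> p = 0 \<or> degree p < m"
  unfolding polys_below_def by (auto simp: coeff_eq_0) (metis leading_coeff_0_iff not_less)

lemma finite_card_polys_below:
  "finite (polys_below m :: 'a::{field,finite} poly set) \<and>
   card (polys_below m :: 'a poly set) = CARD('a) ^ m"
proof (induction m)
  case 0
  have "polys_below 0 = {0 :: 'a poly}" by (auto simp: polys_below_iff)
  then show ?case by simp
next
  case (Suc m)
  let ?f = "\<lambda>(a :: 'a, p). pCons a p"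
  have "polys_below (Suc m) = ?f ` (UNIV \<times> polys_below m)"
  proof (intro equalityI subsetI)
    fix p :: "'a poly" assume p: "p \<in> polys_below (Suc m)"
    obtain a r where ar: "p = pCons a r" by (cases p)
    have "coeff r i = 0" if "i \<ge> m" for i
      using p that unfolding polys_below_def ar by (auto dest!: spec[of _ "Suc i"])
    then have "r \<in> polys_below m" by (simp add: polys_below_def)
    then show "p \<in> ?f ` (UNIV \<times> polys_below m)" using ar by force
  qed (auto simp: polys_below_def coeff_pCons split: nat.split)
  moreover have "inj_on ?f (UNIV \<times> polys_below m)" by (auto intro!: inj_onI)
  ultimately show ?case using Suc by (simp add: card_image card_cartesian_product)
qed

lemmas finite_polys_below [simp] = conjunct1[OF finite_card_polys_below]
lemmas card_polys_below = conjunct2[OF finite_card_polys_below]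

lemma monics_eq: "monics m = (\<lambda>p. monom 1 m + p) ` polys_below m"
proof (intro equalityI subsetI)
  fix p :: "'a poly" assume p: "p \<in> monics m"
  have "p - monom 1 m \<in> polys_below m"
    using p by (auto simp: polys_below_def monics_def coeff_eq_0 le_less)
  then show "p \<in> (\<lambda>p. monom 1 m + p) ` polys_below m" by (intro image_eqI) auto
next
  fix p :: "'a poly" assume "p \<in> (\<lambda>p. monom 1 m + p) ` polys_below m"
  then obtain r where r: "r \<in> polys_below m" "p = monom 1 m + r" by blast
  then have c: "coeff p m = 1" "\<And>i. i > m \<Longrightarrow> coeff p i = 0" by (auto simp: polys_below_def)
  then have "degree p = m" by (intro antisym degree_le le_degree) auto
  then show "p \<in> monics m" using c by (simp add: monics_def)
qed

lemma finite_monics [simp]: "finite (monics m :: 'a::{field,finite} poly set)"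
  by (simp add: monics_eq)

lemma card_monics: "card (monics m :: 'a::{field,finite} poly set) = CARD('a) ^ m"
  unfolding monics_eq by (subst card_image) (auto simp: card_polys_below inj_on_def)

text \<open>\<open>P\<close> runs through the residues that are units modulo the monic
  \<open>Q\<close>. P = 0 occurs only for m = 0, in the single pair (0, 1).\<close>

definition residue_pairs :: "nat \<Rightarrow> ('a::field poly \<times> 'a poly) set" where
  "residue_pairs m = {(P, Q). P \<in> polys_below m \<and> Q \<in> monics m \<and> coprime P Q}"

definition low_pairs :: "nat \<Rightarrow> ('a::field poly \<times> 'a poly) set" where
  "low_pairs m = {(P, Q). lead_coeff P = 1 \<and> degree P < m \<and> Q \<in> monics m \<and> coprime P Q}"

definition high_pairs :: "nat \<Rightarrow> ('a::field poly \<times> 'a poly) set" where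
  "high_pairs m = {(P, Q). P \<in> monics m \<and> lead_coeff Q = 1 \<and> degree Q \<le> m \<and> coprime P Q}"

text \<open>The cardinalities of \<open>low_pairs' m\<close> and \<open>high_pairs' m\<close> are
  u_m and v_m.\<close>

definition low_pairs' :: "nat \<Rightarrow> ('a::field poly \<times> 'a poly) set" where
  "low_pairs' m = {(P, Q) \<in> low_pairs m. coeff Q 0 \<noteq> 0}"

definition high_pairs' :: "nat \<Rightarrow> ('a::field poly \<times> 'a poly) set" where
  "high_pairs' m = {(P, Q) \<in> high_pairs m. coeff Q 0 \<noteq> 0}"

lemma finite_pairs [simp]:
  "finite (residue_pairs m :: ('a::{field,finite} poly \<times> 'a poly) set)"
  "finite (low_pairs m :: ('a poly \<times> 'a poly) set)"
  "finite (high_pairs m :: ('a poly \<times> 'a poly) set)"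
  "finite (low_pairs' m :: ('a poly \<times> 'a poly) set)"
  "finite (high_pairs' m :: ('a poly \<times> 'a poly) set)"
proof -
  have sub: "A \<subseteq> polys_below (Suc m) \<times> polys_below (Suc m) \<Longrightarrow> finite A"
    for A :: "('a poly \<times> 'a poly) set"
    by (rule finite_subset) auto
  show "finite (residue_pairs m :: ('a poly \<times> 'a poly) set)"
    "finite (low_pairs m :: ('a poly \<times> 'a poly) set)"
    "finite (high_pairs m :: ('a poly \<times> 'a poly) set)"
    "finite (low_pairs' m :: ('a poly \<times> 'a poly) set)"
    "finite (high_pairs' m :: ('a poly \<times> 'a poly) set)"
    by (intro sub; force simp: residue_pairs_def low_pairs_def high_pairs_def low_pairs'_def
        high_pairs'_def monics_def polys_below_iff)+
qed

lemma monic_dvd_antisym: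
  fixes p r :: "'a::field poly"
  assumes "p dvd r" "r dvd p" "lead_coeff p = 1" "lead_coeff r = 1"
  shows "p = r"
proof -
  obtain k where k: "r = p * k" using assms(1) by (rule dvdE)
  have nz: "p \<noteq> 0" "r \<noteq> 0" using assms(3,4) by auto
  then have "k \<noteq> 0" using k by auto
  have "degree p = degree r"
    using dvd_imp_degree_le[OF assms(1) nz(2)] dvd_imp_degree_le[OF assms(2) nz(1)] by simp
  then have "degree k = 0" using k nz \<open>k \<noteq> 0\<close> by (simp add: degree_mult_eq)
  then obtain c where c: "k = [:c:]" by (rule degree_eq_zeroE)
  have "lead_coeff r = lead_coeff p * lead_coeff k" unfolding k by (rule lead_coeff_mult)
  then have "c = 1" using assms(3,4) c by simp
  then show ?thesis using k c by simp
qed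

text \<open>Splitting off the monic greatest common divisor.\<close>

lemma card_residue_pairs_sum:
  "(\<Sum>k\<le>m. CARD('a) ^ k * card (residue_pairs (m - k) :: ('a::{field,finite} poly \<times> 'a poly) set)) =
    CARD('a) ^ (2 * m)"
proof -
  let ?S = "SIGMA k:{..m}. (monics k :: 'a poly set) \<times> (residue_pairs (m - k) :: ('a poly \<times> 'a poly) set)"
  let ?f = "\<lambda>(k :: nat, D :: 'a poly, P, Q). (D * P, D * Q)"
  have inj: "inj_on ?f ?S"
  proof (rule inj_onI)
    fix x y assume x: "x \<in> ?S" and y: "y \<in> ?S" and xy: "?f x = ?f y"
    obtain k D P Q where x': "x = (k, D, P, Q)" by (cases x)
    obtain l E R S where y': "y = (l, E, R, S)" by (cases y)
    have D: "D \<in> monics k" and E: "E \<in> monics l"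
      and PQ: "(P, Q) \<in> residue_pairs (m - k)" and RS: "(R, S) \<in> residue_pairs (m - l)"
      and eq: "D * P = E * R" "D * Q = E * S"
      using x y xy by (auto simp: x' y')
    \<comment> \<open>A Bezout equation for \<open>R\<close>, \<open>S\<close> writes E as a
      combination of the two products, both multiples of D; by symmetry the monic D and E divide
      each other.\<close>
    have dvd: "D dvd E" if cp: "coprime R S" and eq: "D * P = E * R" "D * Q = E * S" for D E P Q R S :: "'a poly"
    proof -
      obtain u v where "u * R + v * S = 1" using cp by (auto simp: coprime_poly_iff_bezout)
      then have "E = u * (E * R) + v * (E * S)" by (metis distrib_left mult.left_commute mult.right_neutral)
      also have "\<dots> = D * (u * P + v * Q)" unfolding eq[symmetric] by (simp add: algebra_simps)
      finally show ?thesis by (rule dvdI)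
    qed
    have "D dvd E" using dvd[of R S D P E Q] RS eq by (simp add: residue_pairs_def)
    moreover have "E dvd D" using dvd[of P Q E R D S] PQ eq by (simp add: residue_pairs_def)
    ultimately have "D = E"
      using D E by (intro monic_dvd_antisym) (auto simp: monics_def)
    moreover have "D \<noteq> 0" using D by (auto simp: monics_def)
    ultimately show "x = y"
      using D E eq by (auto simp: monics_def x' y')
  qed
  have img: "?f ` ?S = polys_below m \<times> monics m"
  proof (intro equalityI subsetI)
    fix x assume "x \<in> ?f ` ?S"
    then obtain k D P Q where k: "k \<le> m" and D: "D \<in> monics k" and PQ: "(P, Q) \<in> residue_pairs (m - k)"
      and x: "x = (D * P, D * Q)" by auto
    have nz: "D \<noteq> 0" "Q \<noteq> 0" using D PQ by (auto simp: monics_def residue_pairs_def)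
    have "lead_coeff (D * Q) = 1"
      using D PQ unfolding lead_coeff_mult by (auto simp: residue_pairs_def monics_def)
    moreover have "degree (D * Q) = m"
      using D PQ k nz by (simp add: residue_pairs_def monics_def degree_mult_eq)
    ultimately have "D * Q \<in> monics m" by (simp only: monics_def mem_Collect_eq)
    moreover have "D * P \<in> polys_below m"
      using D PQ k nz by (cases "P = 0") (auto simp: residue_pairs_def monics_def polys_below_iff degree_mult_eq)
    ultimately show "x \<in> polys_below m \<times> monics m" using x by simp
  next
    fix x :: "'a poly \<times> 'a poly" assume x: "x \<in> polys_below m \<times> monics m"
    obtain P Q where PQ: "x = (P, Q)" "P \<in> polys_below m" "Q \<in> monics m" using x by auto
    then have "Q \<noteq> 0" by (auto simp: monics_def)
    then obtain D P' Q' where D: "lead_coeff D = 1" "P = D * P'" "Q = D * Q'" "coprime P' Q'"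
      using coprime_decomposition[of P Q] by blast
    have nz: "D \<noteq> 0" "Q' \<noteq> 0" using D \<open>Q \<noteq> 0\<close> by auto
    have deg: "m = degree D + degree Q'" using PQ(3) D(3) nz by (simp add: monics_def degree_mult_eq)
    have "lead_coeff (D * Q') = 1" using PQ(3) unfolding D(3) monics_def by auto
    then have "lead_coeff Q' = 1" unfolding lead_coeff_mult D(1) by simp
    then have "Q' \<in> monics (m - degree D)" using deg by (simp add: monics_def)
    moreover have "P' \<in> polys_below (m - degree D)"
      using PQ(2) nz unfolding D(2) by (cases "P' = 0") (auto simp: polys_below_iff degree_mult_eq)
    ultimately have "(degree D, D, P', Q') \<in> ?S"
      using D deg by (simp add: residue_pairs_def monics_def)
    moreover have "x = ?f (degree D, D, P', Q')" using PQ D by simp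
    ultimately show "x \<in> ?f ` ?S" by blast
  qed
  have "card ?S = (\<Sum>k\<le>m. CARD('a) ^ k * card (residue_pairs (m - k) :: ('a poly \<times> 'a poly) set))"
    by (simp add: card_SigmaI card_cartesian_product card_monics)
  moreover have "card ?S = card ((polys_below m :: 'a poly set) \<times> (monics m :: 'a poly set))"
    using card_image[OF inj] img by simp
  moreover have "card ((polys_below m :: 'a poly set) \<times> (monics m :: 'a poly set)) = CARD('a) ^ (2 * m)"
    by (simp add: card_cartesian_product card_polys_below card_monics mult_2 power_add)
  ultimately show ?thesis by simp
qed

text \<open>In the convolution identity for m + 1, the terms with k \<ge> 1 are q times the identity
  for m. The sum form avoids subtraction of naturals.\<close>

lemma card_residue_pairs:
  "card (residue_pairs (Suc m) :: ('a::{field,finite} poly \<times> 'a poly) set) + CARD('a) ^ (2 * m + 1) =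
    CARD('a) ^ (2 * m + 2)"
proof -
  let ?r = "\<lambda>k. card (residue_pairs k :: ('a poly \<times> 'a poly) set)"
  have "CARD('a) ^ (2 * m + 2) = (\<Sum>k\<le>Suc m. CARD('a) ^ k * ?r (Suc m - k))"
    using card_residue_pairs_sum[where 'a = 'a, of "Suc m"] by simp
  also have "\<dots> = ?r (Suc m) + CARD('a) * (\<Sum>k\<le>m. CARD('a) ^ k * ?r (m - k))"
    by (subst sum.atMost_Suc_shift) (simp add: sum_distrib_left mult.assoc)
  also have "\<dots> = ?r (Suc m) + CARD('a) ^ (2 * m + 1)"
    unfolding card_residue_pairs_sum by simp
  finally show ?thesis by simp
qed

lemma card_field_ge_2: "CARD('a::{field,finite}) \<ge> 2"
proof -
  have "card {0, 1 :: 'a} \<le> CARD('a)" by (intro card_mono) auto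
  then show ?thesis by simp
qed

text \<open>Since deg Q > 0 the residue \<open>P\<close> is nonzero, and it is a unique scalar
  multiple of a monic one.\<close>

lemma card_residue_low:
  "card (residue_pairs (Suc m) :: ('a::{field,finite} poly \<times> 'a poly) set) =
    (CARD('a) - 1) * card (low_pairs (Suc m) :: ('a poly \<times> 'a poly) set)"
proof -
  let ?f = "\<lambda>(a :: 'a, P, Q). (smult a P, Q)"
  have cop: "coprime (smult a P) Q \<longleftrightarrow> coprime P Q" if "a \<noteq> 0" for a and P Q :: "'a poly"
    using that by (simp add: coprime_def dvd_smult_iff)
  have "inj_on ?f ((UNIV - {0}) \<times> low_pairs (Suc m))"
  proof (rule inj_onI)
    fix x y assume x: "x \<in> (UNIV - {0}) \<times> low_pairs (Suc m)" and y: "y \<in> (UNIV - {0}) \<times> low_pairs (Suc m)"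
      and eq: "?f x = ?f y"
    obtain a P Q where x': "x = (a, P, Q)" by (cases x)
    obtain b R S where y': "y = (b, R, S)" by (cases y)
    have *: "(P, Q) \<in> low_pairs (Suc m)" "(R, S) \<in> low_pairs (Suc m)" "smult a P = smult b R" "a \<noteq> 0" "Q = S"
      using x y eq by (auto simp: x' y')
    have "lead_coeff (smult a P) = lead_coeff (smult b R)" using * by simp
    then have "a = b" using * unfolding lead_coeff_smult low_pairs_def by simp
    then show "x = y" using arg_cong[OF *(3), of "smult (inverse a)"] *(4,5) by (simp add: x' y')
  qed
  moreover have "?f ` ((UNIV - {0}) \<times> low_pairs (Suc m)) = residue_pairs (Suc m)"
  proof (intro equalityI subsetI)
    fix x assume "x \<in> ?f ` ((UNIV - {0}) \<times> low_pairs (Suc m))"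
    then show "x \<in> residue_pairs (Suc m)"
      by (auto simp: low_pairs_def residue_pairs_def cop polys_below_iff)
  next
    fix x :: "'a poly \<times> 'a poly" assume "x \<in> residue_pairs (Suc m)"
    then obtain P Q where PQ: "x = (P, Q)" "P \<in> polys_below (Suc m)" "Q \<in> monics (Suc m)" "coprime P Q"
      by (auto simp: residue_pairs_def)
    have "P \<noteq> 0"
    proof
      assume "P = 0"
      then have "is_unit Q" using PQ(4) by simp
      moreover have "Q \<noteq> 0" using PQ(3) by (auto simp: monics_def)
      ultimately show False using PQ(3) by (simp add: is_unit_iff_degree monics_def)
    qed
    then have "(inverse (lead_coeff P) :: 'a) \<noteq> 0" by simp
    then have "(smult (inverse (lead_coeff P)) P, Q) \<in> low_pairs (Suc m)"
      using PQ \<open>P \<noteq> 0\<close> cop by (auto simp: low_pairs_def polys_below_iff)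
    moreover have "x = ?f (lead_coeff P, smult (inverse (lead_coeff P)) P, Q)"
      using PQ \<open>P \<noteq> 0\<close> by simp
    ultimately show "x \<in> ?f ` ((UNIV - {0}) \<times> low_pairs (Suc m))"
      using \<open>P \<noteq> 0\<close> by (intro image_eqI[where x = "(lead_coeff P, smult (inverse (lead_coeff P)) P, Q)"]) auto
  qed
  ultimately have "card (residue_pairs (Suc m) :: ('a poly \<times> 'a poly) set) =
      card ((UNIV - {0 :: 'a}) \<times> (low_pairs (Suc m) :: ('a poly \<times> 'a poly) set))"
    by (metis card_image)
  also have "\<dots> = (CARD('a) - 1) * card (low_pairs (Suc m) :: ('a poly \<times> 'a poly) set)"
    by (simp add: card_cartesian_product card_Diff_singleton)
  finally show ?thesis .
qed

lemma card_low_pairs: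
  "card (low_pairs (Suc m) :: ('a::{field,finite} poly \<times> 'a poly) set) = CARD('a) ^ (2 * m + 1)"
proof -
  obtain q where q: "CARD('a) = Suc q" "q > 0"
    using card_field_ge_2[where 'a = 'a] by (cases "CARD('a)") auto
  have "q * card (low_pairs (Suc m) :: ('a poly \<times> 'a poly) set) + Suc q ^ (2 * m + 1) = Suc q ^ (2 * m + 2)"
    using card_residue_pairs[where 'a = 'a, of m] unfolding card_residue_low q(1) by simp
  also have "\<dots> = q * Suc q ^ (2 * m + 1) + Suc q ^ (2 * m + 1)" by simp
  finally show ?thesis using q by simp
qed

text \<open>If deg Q < deg P, exchanging the entries gives a low pair. If the degrees agree, Q - P
  is a residue coprime to P. The counts add up to q^(2m+1) + (q^(2m+2) - q^(2m+1)).\<close>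

lemma card_high_pairs:
  "card (high_pairs (Suc m) :: ('a::{field,finite} poly \<times> 'a poly) set) = CARD('a) ^ (2 * m + 2)"
proof -
  let ?f = "\<lambda>(P, Q). (Q, P) :: 'a poly \<times> 'a poly" and ?g = "\<lambda>(R, P). (P, P + R) :: 'a poly \<times> 'a poly"
  have cop: "coprime P (P + R) \<longleftrightarrow> coprime R P" for P R :: "'a poly"
  proof -
    have "(\<exists>u v. u * P + v * (P + R) = 1) \<longleftrightarrow> (\<exists>u v. u * R + v * P = 1)"
    proof safe
      fix u v assume "u * P + v * (P + R) = 1"
      then have "v * R + (u + v) * P = 1" by (simp add: algebra_simps)
      then show "\<exists>u v. u * R + v * P = 1" by blast
    next
      fix u v assume "u * R + v * P = 1"
      then have "(v - u) * P + u * (P + R) = 1" by (simp add: algebra_simps)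
      then show "\<exists>u v. u * P + v * (P + R) = 1" by blast
    qed
    then show ?thesis by (simp add: coprime_poly_iff_bezout)
  qed
  have "high_pairs (Suc m) = ?f ` low_pairs (Suc m) \<union> ?g ` residue_pairs (Suc m)"
  proof (intro equalityI subsetI)
    fix x :: "'a poly \<times> 'a poly" assume "x \<in> high_pairs (Suc m)"
    then obtain P Q where x: "x = (P, Q)" "P \<in> monics (Suc m)" "lead_coeff Q = 1" "degree Q \<le> Suc m" "coprime P Q"
      by (auto simp: high_pairs_def)
    show "x \<in> ?f ` low_pairs (Suc m) \<union> ?g ` residue_pairs (Suc m)"
    proof (cases "degree Q = Suc m")
      case True
      have "Q - P \<in> polys_below (Suc m)"
        using x True by (auto simp: polys_below_def monics_def coeff_eq_0 le_less)
      moreover have "coprime (Q - P) P" using cop[of P "Q - P"] x by simp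
      ultimately have "(Q - P, P) \<in> residue_pairs (Suc m)" using x by (simp add: residue_pairs_def)
      moreover have "x = ?g (Q - P, P)" using x by simp
      ultimately show ?thesis by blast
    next
      case False
      then have "(Q, P) \<in> low_pairs (Suc m)" using x by (simp add: low_pairs_def coprime_commute)
      then show ?thesis using x by force
    qed
  next
    fix x assume "x \<in> ?f ` low_pairs (Suc m) \<union> ?g ` residue_pairs (Suc m)"
    then show "x \<in> high_pairs (Suc m)"
    proof
      assume "x \<in> ?g ` residue_pairs (Suc m)"
      then obtain R P where x: "x = (P, P + R)" "R \<in> polys_below (Suc m)" "P \<in> monics (Suc m)" "coprime R P"
        by (auto simp: residue_pairs_def)
      have "coeff (P + R) (Suc m) = 1" "\<And>i. i > Suc m \<Longrightarrow> coeff (P + R) i = 0"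
        using x by (auto simp: monics_def polys_below_def coeff_eq_0)
      moreover from this have "degree (P + R) = Suc m" by (intro antisym degree_le le_degree) auto
      ultimately show ?thesis using x cop by (simp add: high_pairs_def)
    qed (auto simp: low_pairs_def high_pairs_def coprime_commute)
  qed
  moreover have "?f ` low_pairs (Suc m) \<inter> ?g ` residue_pairs (Suc m) = {}"
  proof -
    have "degree (P + R) = Suc m" if "R \<in> polys_below (Suc m)" "P \<in> monics (Suc m)" for R P :: "'a poly"
    proof -
      have "coeff (P + R) (Suc m) = 1" "\<And>i. i > Suc m \<Longrightarrow> coeff (P + R) i = 0"
        using that by (auto simp: monics_def polys_below_def coeff_eq_0)
      then show ?thesis by (intro antisym degree_le le_degree) auto
    qed
    then have g: "degree (snd x) = Suc m" if "x \<in> ?g ` residue_pairs (Suc m)" for x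
      using that by (auto simp: residue_pairs_def)
    have f: "degree (snd x) < Suc m" if "x \<in> ?f ` low_pairs (Suc m)" for x
      using that by (auto simp: low_pairs_def)
    show ?thesis
      unfolding disjoint_iff
    proof (intro allI impI notI)
      fix x assume "x \<in> ?f ` low_pairs (Suc m)" "x \<in> ?g ` residue_pairs (Suc m)"
      from f[OF this(1)] g[OF this(2)] show False by simp
    qed
  qed
  ultimately have "card (high_pairs (Suc m) :: ('a poly \<times> 'a poly) set) =
      card (?f ` low_pairs (Suc m)) + card (?g ` residue_pairs (Suc m))"
    by (simp add: card_Un_disjoint)
  also have "card (?f ` low_pairs (Suc m)) = card (low_pairs (Suc m) :: ('a poly \<times> 'a poly) set)"
    by (intro card_image) (auto intro!: inj_onI)
  also have "card (?g ` residue_pairs (Suc m)) = card (residue_pairs (Suc m) :: ('a poly \<times> 'a poly) set)"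
    by (intro card_image) (auto intro!: inj_onI)
  finally show ?thesis using card_residue_pairs[where 'a = 'a, of m] card_low_pairs[where 'a = 'a, of m] by simp
qed

text \<open>A low pair with Q = X Q' has P(0) \<noteq> 0 by coprimality, and deg P \<le> m = deg Q',
  so (Q', P) is counted by \<open>high_pairs' m\<close>.\<close>

lemma card_low_split:
  "card (low_pairs' (Suc m) :: ('a::{field,finite} poly \<times> 'a poly) set) +
    card (high_pairs' m :: ('a poly \<times> 'a poly) set) = card (low_pairs (Suc m) :: ('a poly \<times> 'a poly) set)"
proof -
  let ?f = "\<lambda>(Q, P). (P, [:0, 1:] * Q) :: 'a poly \<times> 'a poly"
  have "low_pairs (Suc m) - low_pairs' (Suc m) = ?f ` high_pairs' m"
  proof (intro equalityI subsetI)
    fix x :: "'a poly \<times> 'a poly" assume "x \<in> low_pairs (Suc m) - low_pairs' (Suc m)"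
    then obtain P Q where x: "x = (P, Q)" "(P, Q) \<in> low_pairs (Suc m)" "coeff Q 0 = 0"
      by (auto simp: low_pairs'_def)
    obtain Q' where Q': "Q = pCons 0 Q'" using x(3) by (cases Q) auto
    have cop: "coprime Q' P" "coeff P 0 \<noteq> 0"
      using x(2) coprime_X_mult_iff[of Q' P] by (auto simp: low_pairs_def Q' coprime_commute)
    have "Q' \<noteq> 0" using x(2) by (auto simp: Q' low_pairs_def monics_def)
    then have "(Q', P) \<in> high_pairs' m"
      using x(2) cop by (auto simp: low_pairs_def monics_def high_pairs'_def high_pairs_def Q')
    then show "x \<in> ?f ` high_pairs' m" using x Q' by force
  next
    fix x assume "x \<in> ?f ` high_pairs' m"
    then obtain P Q where x: "x = (P, pCons 0 Q)" "(Q, P) \<in> high_pairs' m" by auto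
    then have "Q \<noteq> 0" by (auto simp: high_pairs'_def high_pairs_def monics_def)
    moreover have "coprime P (pCons 0 Q)"
      using x(2) coprime_X_mult_iff[of Q P] by (simp add: high_pairs'_def high_pairs_def coprime_commute)
    ultimately show "x \<in> low_pairs (Suc m) - low_pairs' (Suc m)"
      using x by (auto simp: low_pairs_def low_pairs'_def high_pairs'_def high_pairs_def monics_def)
  qed
  moreover have "inj_on ?f (high_pairs' m)" by (auto intro!: inj_onI)
  ultimately have "card (low_pairs (Suc m) - low_pairs' (Suc m) :: ('a poly \<times> 'a poly) set) =
      card (high_pairs' m :: ('a poly \<times> 'a poly) set)"
    by (metis card_image)
  moreover have "low_pairs' (Suc m) \<subseteq> (low_pairs (Suc m) :: ('a poly \<times> 'a poly) set)"
    by (auto simp: low_pairs'_def)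
  ultimately show ?thesis
    by (metis card_Diff_subset card_mono finite_pairs(2,4) le_add_diff_inverse)
qed

text \<open>The same cancellation of X, but now deg Q' < deg P = m + 1: the exchanged pair is low
  with the index unchanged.\<close>

lemma card_high_split:
  "card (high_pairs' (Suc m) :: ('a::{field,finite} poly \<times> 'a poly) set) +
    card (low_pairs' (Suc m) :: ('a poly \<times> 'a poly) set) = card (high_pairs (Suc m) :: ('a poly \<times> 'a poly) set)"
proof -
  let ?f = "\<lambda>(Q, P). (P, [:0, 1:] * Q) :: 'a poly \<times> 'a poly"
  have "high_pairs (Suc m) - high_pairs' (Suc m) = ?f ` low_pairs' (Suc m)"
  proof (intro equalityI subsetI)
    fix x :: "'a poly \<times> 'a poly" assume "x \<in> high_pairs (Suc m) - high_pairs' (Suc m)"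
    then obtain P Q where x: "x = (P, Q)" "(P, Q) \<in> high_pairs (Suc m)" "coeff Q 0 = 0"
      by (auto simp: high_pairs'_def)
    obtain Q' where Q': "Q = pCons 0 Q'" using x(3) by (cases Q) auto
    have cop: "coprime Q' P" "coeff P 0 \<noteq> 0"
      using x(2) coprime_X_mult_iff[of Q' P] by (auto simp: high_pairs_def Q' coprime_commute)
    have "Q' \<noteq> 0" using x(2) by (auto simp: Q' high_pairs_def)
    then have "(Q', P) \<in> low_pairs' (Suc m)"
      using x(2) cop by (auto simp: low_pairs'_def low_pairs_def monics_def high_pairs_def Q')
    then show "x \<in> ?f ` low_pairs' (Suc m)" using x Q' by force
  next
    fix x assume "x \<in> ?f ` low_pairs' (Suc m)"
    then obtain P Q where x: "x = (P, pCons 0 Q)" "(Q, P) \<in> low_pairs' (Suc m)" by auto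
    then have "Q \<noteq> 0" by (auto simp: low_pairs'_def low_pairs_def)
    moreover have "coprime P (pCons 0 Q)"
      using x(2) coprime_X_mult_iff[of Q P] by (simp add: low_pairs'_def low_pairs_def coprime_commute)
    ultimately show "x \<in> high_pairs (Suc m) - high_pairs' (Suc m)"
      using x by (auto simp: low_pairs_def low_pairs'_def high_pairs'_def high_pairs_def monics_def)
  qed
  moreover have "inj_on ?f (low_pairs' (Suc m))" by (auto intro!: inj_onI)
  ultimately have "card (high_pairs (Suc m) - high_pairs' (Suc m) :: ('a poly \<times> 'a poly) set) =
      card (low_pairs' (Suc m) :: ('a poly \<times> 'a poly) set)"
    by (metis card_image)
  moreover have "high_pairs' (Suc m) \<subseteq> (high_pairs (Suc m) :: ('a poly \<times> 'a poly) set)"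
    by (auto simp: high_pairs'_def)
  ultimately show ?thesis
    by (metis card_Diff_subset card_mono finite_pairs(3,5) le_add_diff_inverse)
qed

lemma card_high_pairs'_0: "card (high_pairs' 0 :: ('a::{field,finite} poly \<times> 'a poly) set) = 1"
proof -
  have "p = 1" if "degree p = 0" "lead_coeff p = 1" for p :: "'a poly"
    using that by (auto elim!: degree_eq_zeroE simp: one_pCons)
  then have "high_pairs' 0 = {(1, 1) :: 'a poly \<times> 'a poly}"
    by (auto simp: high_pairs'_def high_pairs_def monics_def)
  then show ?thesis by simp
qed

text \<open>The two splittings combine to v_(m+1) = v_m + q^(2m+2) - q^(2m+1) with v_0 = 1;
  multiplying by q + 1 makes this telescope.\<close>

lemma card_high_pairs':
  "(CARD('a) + 1) * card (high_pairs' m :: ('a::{field,finite} poly \<times> 'a poly) set) = CARD('a) ^ (2 * m + 1) + 1"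
proof (induction m)
  case 0
  then show ?case by (simp add: card_high_pairs'_0)
next
  case (Suc m)
  let ?q = "CARD('a)" and ?h = "\<lambda>m. card (high_pairs' m :: ('a poly \<times> 'a poly) set)"
  have "?h (Suc m) + ?q ^ (2 * m + 1) = ?q ^ (2 * m + 2) + ?h m"
    using card_low_split[where 'a = 'a, of m] card_high_split[where 'a = 'a, of m]
      card_low_pairs[where 'a = 'a, of m] card_high_pairs[where 'a = 'a, of m] by simp
  then have "(?q + 1) * ?h (Suc m) + (?q + 1) * ?q ^ (2 * m + 1) =
      (?q + 1) * ?q ^ (2 * m + 2) + (?q ^ (2 * m + 1) + 1)"
    unfolding Suc.IH[symmetric] by (metis distrib_left)
  then show ?case by (simp add: algebra_simps)
qed

lemma card_low_pairs':
  "(CARD('a) + 1) * card (low_pairs' (Suc m) :: ('a::{field,finite} poly \<times> 'a poly) set) + 1 =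
    CARD('a) ^ (2 * Suc m)"
proof -
  let ?q = "CARD('a)"
  have "(?q + 1) * card (low_pairs' (Suc m) :: ('a poly \<times> 'a poly) set) +
      (?q + 1) * card (high_pairs' m :: ('a poly \<times> 'a poly) set) = (?q + 1) * ?q ^ (2 * m + 1)"
    unfolding distrib_left[symmetric] card_low_split card_low_pairs ..
  then have "(?q + 1) * card (low_pairs' (Suc m) :: ('a poly \<times> 'a poly) set) + (?q ^ (2 * m + 1) + 1) =
      (?q + 1) * ?q ^ (2 * m + 1)" by (simp only: card_high_pairs')
  then show ?thesis by (simp add: algebra_simps)
qed

text \<open>A low pair is a reduced pair with a multiple t P added to Q, and \<open>t\<close> is the
  coefficient of Q at deg P. Hence q times the count is q^(2m+1).\<close>

lemma card_reduced_pairs: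
  "card (reduced_pairs (Suc m) :: ('a::{field,finite} poly \<times> 'a poly) set) = CARD('a) ^ (2 * m)"
proof -
  let ?f = "\<lambda>((P, Q), t :: 'a). (P, Q + smult t P) :: 'a poly \<times> 'a poly"
  have inj: "inj_on ?f (reduced_pairs (Suc m) \<times> UNIV)"
  proof (rule inj_onI, clarify)
    fix P Q S :: "'a poly" and s t
    assume *: "(P, Q) \<in> reduced_pairs (Suc m)" "(P, S) \<in> reduced_pairs (Suc m)"
      "Q + smult t P = S + smult s P"
    have "t = s" using arg_cong[OF *(3), of "\<lambda>p. coeff p (degree P)"] *(1,2) by (simp add: reduced_pairs_def)
    then show "(P, Q) = (P, S) \<and> t = s" using *(3) by simp
  qed
  have cop: "coprime P (Q + smult t P) \<longleftrightarrow> coprime P Q" for P Q :: "'a poly" and t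
  proof -
    have "coprime P Q" if "coprime P (Q + smult t P)" for P Q :: "'a poly" and t
    proof (rule coprimeI)
      fix c assume "c dvd P" "c dvd Q"
      show "is_unit c"
        by (rule coprime_common_divisor[OF that \<open>c dvd P\<close> dvd_add[OF \<open>c dvd Q\<close> dvd_smult[OF \<open>c dvd P\<close>]]])
    qed
    from this[of P Q t] this[of P "Q + smult t P" "- t"] show ?thesis by auto
  qed
  have monic: "Q + smult t P \<in> monics (Suc m) \<longleftrightarrow> Q \<in> monics (Suc m)"
    if "degree P < Suc m" for P Q :: "'a poly" and t
  proof -
    have "Q + smult t P \<in> monics (Suc m)" if "Q \<in> monics (Suc m)" "degree P < Suc m" for P Q :: "'a poly" and t
    proof -
      have "degree (smult t P) < degree Q" using that degree_smult_le[of t P] by (simp add: monics_def)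
      then have "degree (Q + smult t P) = degree Q" by (rule degree_add_eq_left)
      then show ?thesis using that by (auto simp: monics_def coeff_eq_0)
    qed
    from this[of Q P t] this[of "Q + smult t P" P "- t"] that show ?thesis by auto
  qed
  have "?f ` (reduced_pairs (Suc m) \<times> UNIV) = low_pairs (Suc m)"
  proof (intro equalityI subsetI)
    fix x assume "x \<in> ?f ` (reduced_pairs (Suc m) \<times> UNIV)"
    then obtain P Q t where "(P, Q) \<in> reduced_pairs (Suc m)" "x = (P, Q + smult t P)" by auto
    then show "x \<in> low_pairs (Suc m)"
      using monic[of P Q t] cop[of P Q t] by (auto simp: reduced_pairs_def low_pairs_def monics_def)
  next
    fix x :: "'a poly \<times> 'a poly" assume "x \<in> low_pairs (Suc m)"
    then obtain P Q where x: "x = (P, Q)" "(P, Q) \<in> low_pairs (Suc m)" by (cases x) auto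
    let ?t = "coeff Q (degree P)"
    have "(P, Q + smult (- ?t) P) \<in> reduced_pairs (Suc m)"
      using x(2) monic[of P Q "- ?t"] cop[of P Q "- ?t"]
      by (auto simp: reduced_pairs_def low_pairs_def monics_def)
    moreover have "x = ?f ((P, Q + smult (- ?t) P), ?t)" using x by simp
    ultimately show "x \<in> ?f ` (reduced_pairs (Suc m) \<times> UNIV)" by blast
  qed
  then have "card ((reduced_pairs (Suc m) :: ('a poly \<times> 'a poly) set) \<times> (UNIV :: 'a set)) = CARD('a) ^ (2 * m + 1)"
    using card_image[OF inj] card_low_pairs[where 'a = 'a, of m] by simp
  then show ?thesis by (simp add: card_cartesian_product)
qed

text \<open>As 0 < j < d, the entry d deg P + j is never divisible by \<open>d\<close>, so
  \<open>Q\<close> must attain the maximum; the result is the same for every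
  \<open>j\<close>.\<close>

lemma eigen_pairs_dvd:
  assumes "j \<in> {1..<d}"
  shows "eigen_pairs d (d * m) j = low_pairs' m"
proof -
  have "max (d * a + j) (d * b) = d * m \<longleftrightarrow> a < m \<and> b = m" for a b
  proof -
    have *: "d * a + j < d * m \<longleftrightarrow> a < m"
    proof
      assume "a < m"
      then have "d * Suc a \<le> d * m" by (intro mult_le_mono2) simp
      then show "d * a + j < d * m" using assms by simp
    next
      assume "d * a + j < d * m"
      then have "d * a < d * m" by (rule add_lessD1)
      then show "a < m" by simp
    qed
    have "d * a + j \<noteq> d * m"
    proof
      assume "d * a + j = d * m"
      then have "(d * a + j) mod d = 0" by simp
      then show False using assms by simp
    qed
    then show ?thesis using * assms by (auto simp: max_def)
  qed
  then show ?thesis by (auto simp: eigen_pairs_def low_pairs'_def low_pairs_def monics_def)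
qed

text \<open>The entry d deg Q has residue 0 and cannot equal d m + r, so \<open>P\<close> attains
  the maximum and its residue forces j = r.\<close>

lemma eigen_pairs_not_dvd:
  assumes j: "j \<in> {1..<d}" and r: "r \<in> {1..<d}"
  shows "eigen_pairs d (d * m + r) j = (if j = r then high_pairs' m else {})"
proof -
  have mods: "(d * a + j) mod d = j" "(d * b) mod d = 0" "(d * m + r) mod d = r" for a b
    using j r by auto
  have 1: "d * b \<le> d * m + r \<longleftrightarrow> b \<le> m" for b
  proof
    assume "d * b \<le> d * m + r"
    also have "\<dots> < d * Suc m" using r by simp
    finally have "b < Suc m" by (simp only: mult_less_cancel1)
    then show "b \<le> m" by simp
  next
    assume "b \<le> m"
    then have "d * b \<le> d * m" by (rule mult_le_mono2)
    then show "d * b \<le> d * m + r" by (rule trans_le_add1)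
  qed
  have 2: "d * a + j = d * m + r \<longleftrightarrow> a = m \<and> j = r" for a
  proof
    assume eq: "d * a + j = d * m + r"
    then have "j = r" using mods by metis
    then show "a = m \<and> j = r" using eq r by simp
  qed simp
  have "max (d * a + j) (d * b) = d * m + r \<longleftrightarrow> j = r \<and> a = m \<and> b \<le> m" for a b
  proof -
    have "d * b \<noteq> d * m + r" using mods(2)[of b] mods(3) r by (metis atLeastLessThan_iff not_one_le_zero)
    then have "max (d * a + j) (d * b) = d * m + r \<longleftrightarrow> d * a + j = d * m + r \<and> d * b \<le> d * m + r"
      by (auto simp: max_def)
    then show ?thesis unfolding 1 2 by auto
  qed
  then show ?thesis by (auto simp: eigen_pairs_def high_pairs'_def high_pairs_def monics_def)
qed

theorem theorem3p2:
  fixes a b :: "'a :: {field, finite}" and n d q :: nat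
  assumes "q = CARD('a)"
    and "n \<ge> 1"
    and "a \<noteq> 0" and "b \<noteq> 0" and "a \<noteq> b"
    and "d = mult_order (a / b)"
  shows "real (num_fixed n (diag2 a b)) =
    (if n mod d = 0
     then real q ^ (2 * (n div d) - 2) + (real d - 1) * (real q ^ (2 * (n div d)) - 1) / (real q + 1)
     else (real q ^ (2 * (n div d) + 1) + 1) / (real q + 1))"
proof -
  have c: "a / b \<noteq> 0" using assms by simp
  have d0: "d > 0" and ord: "\<And>k. (a / b) ^ k = 1 \<longleftrightarrow> d dvd k"
    using mult_order_finite_field[OF c] assms(6) by auto
  define m where "m = n div d"
  let ?A = "(\<lambda>(P, Q). pair_span (spread d 0 P) (spread d 0 Q)) ` (reduced_pairs m :: ('a poly \<times> 'a poly) set)"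
  let ?S = "SIGMA j:{1..<d}. (eigen_pairs d n j :: ('a poly \<times> 'a poly) set)"
  let ?B = "(\<lambda>(j, P, Q). pair_span (spread d j P) (spread d 0 Q)) ` ?S"
  have fixed: "num_fixed n (diag2 a b) = card ((if d dvd n then ?A else {}) \<union> ?B)"
    unfolding num_fixed_diag2[OF assms(3,4,2)] invariant_spans[OF d0 ord assms(2)] m_def ..
  have cardB: "card ?B = card ?S" by (rule card_image[OF inj_on_eigen[OF d0]])
  show ?thesis
  proof (cases "n mod d = 0")
    case True
    then have nm: "n = d * m" and dvd: "d dvd n" by (auto simp: m_def)
    \<comment> \<open>n \<ge> 1 makes \<open>m\<close> positive, so the natural-number exponent 2 m
      - 2 is the true difference 2 k.\<close>
    then obtain k where k: "m = Suc k" using assms(2) by (cases m) auto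
    \<comment> \<open>The fibre does not depend on j; the d - 1 values of j give the factor in the
      formula.\<close>
    have "?S = {1..<d} \<times> low_pairs' m" using eigen_pairs_dvd unfolding nm by (intro Sigma_cong) auto
    then have "card ?B = (d - 1) * card (low_pairs' m :: ('a poly \<times> 'a poly) set)" and fin: "finite ?S"
      unfolding cardB by (simp_all add: card_cartesian_product)
    moreover have "card ?A = q ^ (2 * k)"
      unfolding card_image[OF inj_on_reduced[OF d0]] k card_reduced_pairs assms(1) ..
    moreover have finR: "finite (reduced_pairs m :: ('a poly \<times> 'a poly) set)"
      by (rule finite_subset[OF _ finite_pairs(2)[of m]]) (auto simp: reduced_pairs_def low_pairs_def monics_def)
    moreover have "card (?A \<union> ?B) = card ?A + card ?B"
      by (rule card_Un_disjoint[OF finite_imageI[OF finR] finite_imageI[OF fin] reduced_eigen_disjoint[OF d0]])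
    ultimately have "num_fixed n (diag2 a b) = q ^ (2 * k) + (d - 1) * card (low_pairs' m :: ('a poly \<times> 'a poly) set)"
      unfolding fixed using dvd by (simp only: if_True)
    moreover have "(real q + 1) * real (card (low_pairs' m :: ('a poly \<times> 'a poly) set)) = real q ^ (2 * m) - 1"
      using arg_cong[OF card_low_pairs'[where 'a = 'a, of k], of real] unfolding k assms(1)
      by (simp add: algebra_simps)
    then have "real (card (low_pairs' m :: ('a poly \<times> 'a poly) set)) = (real q ^ (2 * m) - 1) / (real q + 1)"
      by (simp add: field_simps)
    ultimately show ?thesis using True d0 by (simp add: m_def[symmetric] k of_nat_diff)
  next
    case False
    define r where "r = n mod d"
    have r: "r \<in> {1..<d}" and nm: "n = d * m + r" using False d0 by (auto simp: r_def m_def)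
    \<comment> \<open>Only the residue of n contributes, and planes inside F_q[X^d] do not
      occur.\<close>
    have "?S = {r} \<times> high_pairs' m"
      using eigen_pairs_not_dvd[OF _ r, where 'a = 'a] r unfolding nm by (auto split: if_splits)
    then have "card ?B = card (high_pairs' m :: ('a poly \<times> 'a poly) set)"
      unfolding cardB by (simp add: card_cartesian_product)
    then have "num_fixed n (diag2 a b) = card (high_pairs' m :: ('a poly \<times> 'a poly) set)"
      unfolding fixed using False by (simp add: dvd_eq_mod_eq_0)
    moreover have "(real q + 1) * real (card (high_pairs' m :: ('a poly \<times> 'a poly) set)) = real q ^ (2 * m + 1) + 1"
      using arg_cong[OF card_high_pairs'[where 'a = 'a, of m], of real] unfolding assms(1)
      by (simp add: algebra_simps)
    then have "real (card (high_pairs' m :: ('a poly \<times> 'a poly) set)) = (real q ^ (2 * m + 1) + 1) / (real q + 1)"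
      by (simp add: field_simps)
    ultimately show ?thesis using False by (simp add: m_def[symmetric])
  qed
qed

end
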